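(* Let $\mathcal{A}$ be a unital exact $C^*$-algebra and $\theta:\mathcal{A}\to\mathcal{A}$ a unital completely positive map. If $a\in\mathcal{A}$ is self-adjoint and $\sigma$ is a $\theta$-invariant state on $\mathcal{A}$, then $$P_\theta(a)\geq hm_\sigma(\theta)+\sigma(a),$$ where $P_\theta(a)$ is the approximation pressure and $hm_\sigma(\theta)$ the local state approximation entropy.
   Context: (u.c.p. = unital completely positive.) **Approximation pressure.** Fix a faithful unital $*$-representation $\pi:\mathcal{A}\to\mathcal{B}(\mathcal{H})$. For a finite set $\Omega\subset\mathcal{A}$ and $\delta>0$, $\mathrm{CPA}(\pi,\Omega,\delta)$ is the set of triples $(\phi,\psi,\mathcal{B})$ with $\mathcal{B}$ a finite-dimensional $C^*$-algebra and $\phi:\mathcal{A}\to\mathcal{B}$, $\psi:\mathcal{B}\to\mathcal{B}(\mathcal{H})$ u.c.p. with $\|\psi(\phi(x))-\pi(x)\|<\delta$ for all $x\in\Omega$. Put $\Omega^{(n)}=\Omega\cup\theta(\Omega)\cup\dots\cup\theta^{n-1}(\Omega)$, $a^{(n)}=\sum_{j=0}^{n-1}\theta^j(a)$, $Z_{\theta,n}(\pi,a,\Omega,\delta)=\inf\{\mathrm{Tr}\,e^{\phi(a^{(n)})}:(\phi,\psi,\mathcal{B})\in\mathrm{CPA}(\pi,\Omega^{(n)},\delta)\}$, where $\mathrm{Tr}$ is the trace on $\mathcal{B}$ with value $1$ on every minimal projection. Then $P_\theta(a)=\sup_\Omega\sup_{\delta>0}\limsup_n\frac1n\log Z_{\theta,n}(\pi,a,\Omega,\delta)$,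 $\Omega$ ranging over finite subsets of $\mathcal{A}$ (independent of $\pi$). **Local state approximation entropy.** Let $\iota:\mathcal{A}\to\mathcal{D}$ be a unital complete order embedding into an injective $C^*$-algebra. $\mathrm{CPA}(\iota,\Omega,\delta)$ is the set of triples $(\phi,\psi,\mathcal{B})$ with $\mathcal{B}$ finite-dimensional and $\phi:\mathcal{A}\to\mathcal{B}$, $\psi:\mathcal{B}\to\mathcal{D}$ u.c.p. with $\|\psi(\phi(x))-\iota(x)\|<\delta$ on $\Omega$. $\mathfrak{E}(\sigma,\iota)$ is the set of states on $\mathcal{D}$ extending $\sigma\circ\iota^{-1}$ on $\iota(\mathcal{A})$. $cpe(\iota,\omega,\Omega,\delta)=\inf\{S(\omega\circ\psi):(\phi,\psi,\mathcal{B})\in\mathrm{CPA}(\iota,\Omega,\delta)\}$, with $S$ the von Neumann entropy of a state on $\mathcal{B}$ (density taken with respect to $\mathrm{Tr}$). Then $hm_\sigma(\theta)=\sup_{\omega\in\mathfrak{E}(\sigma,\iota)}\sup_\Omega\sup_{\delta>0}\limsup_n\frac1n cpe(\iota,\omega,\Omega^{(n)},\delta)$; it does not depend on $\iota,\mathcal{D}$. *)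

theory Defs
  imports
    "HOL-Analysis.Analysis"
    "HOL-Algebra.Module"
    "HOL-Computational_Algebra.Polynomial"
begin

section \<open>Unital C*-algebras\<close>

definition complex_ring :: "complex ring" where
  "complex_ring = \<lparr>carrier = UNIV, mult = (*), one = 1, zero = 0, add = (+)\<rparr>"

record 'a cstar = "(complex, 'a) module" +
  star :: "'a \<Rightarrow> 'a"
  cnorm :: "'a \<Rightarrow> real"

locale cstar_algebra = ring A + module complex_ring A for A :: "'a cstar" (structure) +
  assumes smult_mult_left: "x \<in> carrier A \<Longrightarrow> y \<in> carrier A \<Longrightarrow> (c \<odot> x) \<otimes> y = c \<odot> (x \<otimes> y)"
    and smult_mult_right: "x \<in> carrier A \<Longrightarrow> y \<in> carrier A \<Longrightarrow> x \<otimes> (c \<odot> y) = c \<odot> (x \<otimes> y)"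
    and star_closed: "x \<in> carrier A \<Longrightarrow> star A x \<in> carrier A"
    and star_star: "x \<in> carrier A \<Longrightarrow> star A (star A x) = x"
    and star_add: "x \<in> carrier A \<Longrightarrow> y \<in> carrier A \<Longrightarrow> star A (x \<oplus> y) = star A x \<oplus> star A y"
    and star_smult: "x \<in> carrier A \<Longrightarrow> star A (c \<odot> x) = cnj c \<odot> star A x"
    and star_mult: "x \<in> carrier A \<Longrightarrow> y \<in> carrier A \<Longrightarrow> star A (x \<otimes> y) = star A y \<otimes> star A x"
    and cnorm_eq_0: "x \<in> carrier A \<Longrightarrow> cnorm A x = 0 \<longleftrightarrow> x = \<zero>"
    and cnorm_add: "x \<in> carrier A \<Longrightarrow> y \<in> carrier A \<Longrightarrow> cnorm A (x \<oplus> y) \<le> cnorm A x + cnorm A y"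
    and cnorm_smult: "x \<in> carrier A \<Longrightarrow> cnorm A (c \<odot> x) = cmod c * cnorm A x"
    and cnorm_mult: "x \<in> carrier A \<Longrightarrow> y \<in> carrier A \<Longrightarrow> cnorm A (x \<otimes> y) \<le> cnorm A x * cnorm A y"
    and cnorm_cstar: "x \<in> carrier A \<Longrightarrow> cnorm A (star A x \<otimes> x) = (cnorm A x)\<^sup>2"
    and cnorm_complete:
      "(\<And>n. X n \<in> carrier A) \<Longrightarrow>
       (\<And>e. e > 0 \<Longrightarrow> \<exists>N. \<forall>m\<ge>N. \<forall>n\<ge>N. cnorm A (X m \<ominus> X n) < e) \<Longrightarrow>
       \<exists>x\<in>carrier A. (\<lambda>n. cnorm A (X n \<ominus> x)) \<longlonglongrightarrow> 0"

definition finite_dim :: "'a cstar \<Rightarrow> bool" where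
  "finite_dim A \<longleftrightarrow> (\<exists>S. finite S \<and> S \<subseteq> carrier A \<and>
     (\<forall>x\<in>carrier A. \<exists>c. x = (\<Oplus>\<^bsub>A\<^esub>s\<in>S. c s \<odot>\<^bsub>A\<^esub> s)))"

definition unital_star_hom :: "'a cstar \<Rightarrow> 'b cstar \<Rightarrow> ('a \<Rightarrow> 'b) \<Rightarrow> bool" where
  "unital_star_hom A B f \<longleftrightarrow> f \<in> ring_hom A B \<and>
     (\<forall>c. \<forall>x\<in>carrier A. f (c \<odot>\<^bsub>A\<^esub> x) = c \<odot>\<^bsub>B\<^esub> f x) \<and>
     (\<forall>x\<in>carrier A. f (star A x) = star B (f x))"

section \<open>Bounded operators on a Hilbert space\<close>

text \<open>Convention: the inner product is linear in the first variable.\<close>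

class complex_hilbert_space = real_normed_vector + complete_space +
  fixes scaleC :: "complex \<Rightarrow> 'a \<Rightarrow> 'a"
    and cinner :: "'a \<Rightarrow> 'a \<Rightarrow> complex"
  assumes scaleR_scaleC: "scaleR r x = scaleC (of_real r) x"
    and scaleC_add_right: "scaleC c (x + y) = scaleC c x + scaleC c y"
    and scaleC_add_left: "scaleC (c + d) x = scaleC c x + scaleC d x"
    and scaleC_scaleC: "scaleC c (scaleC d x) = scaleC (c * d) x"
    and cinner_commute: "cinner x y = cnj (cinner y x)"
    and cinner_add_left: "cinner (x + y) z = cinner x z + cinner y z"
    and cinner_scaleC_left: "cinner (scaleC c x) y = c * cinner x y"
    and cinner_self: "cinner x x = of_real ((norm x)\<^sup>2)"

definition bounded_ops :: "('h::complex_hilbert_space \<Rightarrow> 'h) cstar" where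
  "bounded_ops =
     \<lparr>carrier = {T. bounded_linear T \<and> (\<forall>c x. T (scaleC c x) = scaleC c (T x))},
      mult = (\<circ>), one = id, zero = (\<lambda>x. 0), add = (\<lambda>S T x. S x + T x),
      smult = (\<lambda>c T x. scaleC c (T x)),
      star = (\<lambda>T. THE S. \<forall>x y. cinner (T x) y = cinner x (S y)),
      cnorm = onorm\<rparr>"

section \<open>Complete positivity\<close>

text \<open>Families \<open>X i j\<close> with \<open>i, j < n\<close> stand for elements of the matrix algebra over \<open>A\<close>;
  \<open>matrix_pos A n X\<close> says that \<open>X = Y\<^sup>* Y\<close> there.\<close>

definition matrix_pos :: "'a cstar \<Rightarrow> nat \<Rightarrow> (nat \<Rightarrow> nat \<Rightarrow> 'a) \<Rightarrow> bool" where
  "matrix_pos A n X \<longleftrightarrow> (\<exists>Y. (\<forall>i<n. \<forall>j<n. Y i j \<in> carrier A) \<and>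
     (\<forall>i<n. \<forall>j<n. X i j = (\<Oplus>\<^bsub>A\<^esub>k\<in>{..<n}. star A (Y k i) \<otimes>\<^bsub>A\<^esub> Y k j)))"

definition operator_system :: "'a cstar \<Rightarrow> 'a set \<Rightarrow> bool" where
  "operator_system A E \<longleftrightarrow> E \<subseteq> carrier A \<and> \<one>\<^bsub>A\<^esub> \<in> E \<and>
     (\<forall>x\<in>E. \<forall>y\<in>E. x \<oplus>\<^bsub>A\<^esub> y \<in> E) \<and> (\<forall>c. \<forall>x\<in>E. c \<odot>\<^bsub>A\<^esub> x \<in> E) \<and> (\<forall>x\<in>E. star A x \<in> E)"

definition clinear_on :: "'a cstar \<Rightarrow> 'a set \<Rightarrow> 'b cstar \<Rightarrow> ('a \<Rightarrow> 'b) \<Rightarrow> bool" where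
  "clinear_on A E B f \<longleftrightarrow> f \<in> E \<rightarrow> carrier B \<and>
     (\<forall>x\<in>E. \<forall>y\<in>E. f (x \<oplus>\<^bsub>A\<^esub> y) = f x \<oplus>\<^bsub>B\<^esub> f y) \<and>
     (\<forall>c. \<forall>x\<in>E. f (c \<odot>\<^bsub>A\<^esub> x) = c \<odot>\<^bsub>B\<^esub> f x)"

definition cp_on :: "'a cstar \<Rightarrow> 'a set \<Rightarrow> 'b cstar \<Rightarrow> ('a \<Rightarrow> 'b) \<Rightarrow> bool" where
  "cp_on A E B f \<longleftrightarrow> clinear_on A E B f \<and>
     (\<forall>n X. (\<forall>i<n. \<forall>j<n. X i j \<in> E) \<longrightarrow> matrix_pos A n X \<longrightarrow> matrix_pos B n (\<lambda>i j. f (X i j)))"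

definition ucp :: "'a cstar \<Rightarrow> 'b cstar \<Rightarrow> ('a \<Rightarrow> 'b) \<Rightarrow> bool" where
  "ucp A B f \<longleftrightarrow> cp_on A (carrier A) B f \<and> f \<one>\<^bsub>A\<^esub> = \<one>\<^bsub>B\<^esub>"

definition unital_complete_order_embedding :: "'a cstar \<Rightarrow> 'b cstar \<Rightarrow> ('a \<Rightarrow> 'b) \<Rightarrow> bool" where
  "unital_complete_order_embedding A B f \<longleftrightarrow>
     clinear_on A (carrier A) B f \<and> f \<one>\<^bsub>A\<^esub> = \<one>\<^bsub>B\<^esub> \<and> inj_on f (carrier A) \<and>
     (\<forall>n X. (\<forall>i<n. \<forall>j<n. X i j \<in> carrier A) \<longrightarrow>
        (matrix_pos A n X \<longleftrightarrow> matrix_pos B n (\<lambda>i j. f (X i j))))"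

text \<open>Injectivity: completely positive maps into \<open>D\<close> extend from operator systems to the
  ambient C*-algebra. HOL cannot quantify over all types in a formula, so the ambient algebras
  \<open>F\<close> range over those whose elements lie in one type \<open>'u\<close>. An injective C*-algebra
  satisfies this for every \<open>'u\<close>; as a hypothesis it is at most weaker than injectivity.\<close>

definition injective_cstar :: "'u itself \<Rightarrow> 'd cstar \<Rightarrow> bool" where
  "injective_cstar _ D \<longleftrightarrow> cstar_algebra D \<and>
     (\<forall>(F :: 'u cstar) E f. cstar_algebra F \<longrightarrow> operator_system F E \<longrightarrow> cp_on F E D f \<longrightarrow>
        (\<exists>g. cp_on F (carrier F) D g \<and> (\<forall>x\<in>E. g x = f x)))"

section \<open>Completely positive approximation and exactness\<close>

text \<open>Every finite-dimensional C*-algebra is isomorphic to one whose elements are coordinate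
  vectors, so those with carrier in \<open>nat \<Rightarrow> complex\<close> represent all of them.\<close>

type_synonym fd_elem = "nat \<Rightarrow> complex"

definition CPA ::
  "'a cstar \<Rightarrow> 'c cstar \<Rightarrow> ('a \<Rightarrow> 'c) \<Rightarrow> 'a set \<Rightarrow> real \<Rightarrow>
   (('a \<Rightarrow> fd_elem) \<times> (fd_elem \<Rightarrow> 'c) \<times> fd_elem cstar) set" where
  "CPA A C \<pi> \<Omega> \<delta> = {(\<phi>, \<psi>, B). cstar_algebra B \<and> finite_dim B \<and> ucp A B \<phi> \<and> ucp B C \<psi> \<and>
     (\<forall>x\<in>\<Omega>. cnorm C (\<psi> (\<phi> x) \<ominus>\<^bsub>C\<^esub> \<pi> x) < \<delta>)}"

text \<open>Exactness, as existence of a faithful nuclear representation. The type argument carries the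
  Hilbert space of that representation. A hypothesis with a type variable \<open>'k\<close> occurring nowhere
  else amounts to existence of such a representation on some Hilbert space.\<close>

definition exact_cstar :: "'k::complex_hilbert_space itself \<Rightarrow> 'a cstar \<Rightarrow> bool" where
  "exact_cstar _ A \<longleftrightarrow> cstar_algebra A \<and>
     (\<exists>\<pi> :: 'a \<Rightarrow> 'k \<Rightarrow> 'k. unital_star_hom A bounded_ops \<pi> \<and> inj_on \<pi> (carrier A) \<and>
        (\<forall>\<Omega> \<delta>. finite \<Omega> \<longrightarrow> \<Omega> \<subseteq> carrier A \<longrightarrow> \<delta> > 0 \<longrightarrow> CPA A bounded_ops \<pi> \<Omega> \<delta> \<noteq> {}))"

section \<open>States\<close>

definition linear_functional :: "'a cstar \<Rightarrow> ('a \<Rightarrow> complex) \<Rightarrow> bool" where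
  "linear_functional A f \<longleftrightarrow>
     (\<forall>x\<in>carrier A. \<forall>y\<in>carrier A. f (x \<oplus>\<^bsub>A\<^esub> y) = f x + f y) \<and>
     (\<forall>c. \<forall>x\<in>carrier A. f (c \<odot>\<^bsub>A\<^esub> x) = c * f x)"

definition state :: "'a cstar \<Rightarrow> ('a \<Rightarrow> complex) \<Rightarrow> bool" where
  "state A f \<longleftrightarrow> linear_functional A f \<and>
     (\<forall>x\<in>carrier A. f (star A x \<otimes>\<^bsub>A\<^esub> x) \<in> \<real>\<^sub>\<ge>\<^sub>0) \<and>
     (SUP x\<in>{x\<in>carrier A. cnorm A x \<le> 1}. ereal (cmod (f x))) = 1"

section \<open>Trace, exponential and entropy in finite dimensions\<close>

definition projection :: "'a cstar \<Rightarrow> 'a \<Rightarrow> bool" where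
  "projection A p \<longleftrightarrow> p \<in> carrier A \<and> star A p = p \<and> p \<otimes>\<^bsub>A\<^esub> p = p"

definition minimal_projection :: "'a cstar \<Rightarrow> 'a \<Rightarrow> bool" where
  "minimal_projection A p \<longleftrightarrow> projection A p \<and> p \<noteq> \<zero>\<^bsub>A\<^esub> \<and>
     (\<forall>q. projection A q \<longrightarrow> p \<otimes>\<^bsub>A\<^esub> q = q \<longrightarrow> q = \<zero>\<^bsub>A\<^esub> \<or> q = p)"

text \<open>In finite dimensions the functional chosen here exists and is unique on the carrier,
  since the minimal projections span.\<close>

definition fd_trace :: "'b cstar \<Rightarrow> 'b \<Rightarrow> complex" where
  "fd_trace B = (SOME \<tau>. linear_functional B \<tau> \<and>
     (\<forall>x\<in>carrier B. \<forall>y\<in>carrier B. \<tau> (x \<otimes>\<^bsub>B\<^esub> y) = \<tau> (y \<otimes>\<^bsub>B\<^esub> x)) \<and>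
     (\<forall>p. minimal_projection B p \<longrightarrow> \<tau> p = 1))"

definition cstar_exp :: "'b cstar \<Rightarrow> 'b \<Rightarrow> 'b" where
  "cstar_exp B x = (THE y. y \<in> carrier B \<and>
     (\<lambda>n. cnorm B ((\<Oplus>\<^bsub>B\<^esub>k\<in>{..<n}. complex_of_real (1 / fact k) \<odot>\<^bsub>B\<^esub> (x [^]\<^bsub>B\<^esub> k)) \<ominus>\<^bsub>B\<^esub> y))
       \<longlonglongrightarrow> 0)"

definition spectrum :: "'b cstar \<Rightarrow> 'b \<Rightarrow> complex set" where
  "spectrum B x = {c. x \<ominus>\<^bsub>B\<^esub> (c \<odot>\<^bsub>B\<^esub> \<one>\<^bsub>B\<^esub>) \<notin> Units B}"

definition poly_cstar :: "'b cstar \<Rightarrow> complex poly \<Rightarrow> 'b \<Rightarrow> 'b" where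
  "poly_cstar B p x = (\<Oplus>\<^bsub>B\<^esub>k\<in>{..degree p}. coeff p k \<odot>\<^bsub>B\<^esub> (x [^]\<^bsub>B\<^esub> k))"

text \<open>Functional calculus \<open>g(x)\<close> for self-adjoint \<open>x\<close>. In finite dimensions the spectrum is finite,
  so \<open>g\<close> agrees on it with a polynomial \<open>p\<close>, and \<open>g(x) = p(x)\<close> for any such \<open>p\<close>.\<close>

definition fd_calculus :: "'b cstar \<Rightarrow> (real \<Rightarrow> real) \<Rightarrow> 'b \<Rightarrow> 'b" where
  "fd_calculus B g x = (THE y. \<exists>p. (\<forall>c\<in>spectrum B x. poly p c = complex_of_real (g (Re c))) \<and>
     y = poly_cstar B p x)"

definition density :: "'b cstar \<Rightarrow> ('b \<Rightarrow> complex) \<Rightarrow> 'b" where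
  "density B f = (THE \<rho>. \<rho> \<in> carrier B \<and> (\<forall>x\<in>carrier B. f x = fd_trace B (\<rho> \<otimes>\<^bsub>B\<^esub> x)))"

text \<open>\<open>ln 0 = 0\<close>, so that \<open>- t * ln t\<close> vanishes at \<open>t = 0\<close> as it should.\<close>

definition von_neumann_entropy :: "'b cstar \<Rightarrow> ('b \<Rightarrow> complex) \<Rightarrow> real" where
  "von_neumann_entropy B f =
     Re (fd_trace B (fd_calculus B (\<lambda>t. - t * ln t) (density B f)))"

section \<open>Approximation pressure and local state approximation entropy\<close>

text \<open>Infima and suprema are taken in \<open>ereal\<close>; the infimum over an empty set is \<open>\<infinity>\<close>.\<close>

definition ln_ereal :: "ereal \<Rightarrow> ereal" where
  "ln_ereal x = (if x \<le> 0 then - \<infinity> else if x = \<infinity> then \<infinity> else ereal (ln (real_of_ereal x)))"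

definition orbit_set :: "('a \<Rightarrow> 'a) \<Rightarrow> nat \<Rightarrow> 'a set \<Rightarrow> 'a set" where
  "orbit_set \<theta> n \<Omega> = (\<Union>j<n. (\<theta> ^^ j) ` \<Omega>)"

definition orbit_sum :: "'a cstar \<Rightarrow> ('a \<Rightarrow> 'a) \<Rightarrow> nat \<Rightarrow> 'a \<Rightarrow> 'a" where
  "orbit_sum A \<theta> n a = (\<Oplus>\<^bsub>A\<^esub>j\<in>{..<n}. (\<theta> ^^ j) a)"

definition partition_fun ::
  "'a cstar \<Rightarrow> ('a \<Rightarrow> 'a) \<Rightarrow> nat \<Rightarrow> ('a \<Rightarrow> 'h::complex_hilbert_space \<Rightarrow> 'h) \<Rightarrow>
   'a \<Rightarrow> 'a set \<Rightarrow> real \<Rightarrow> ereal" where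
  "partition_fun A \<theta> n \<pi> a \<Omega> \<delta> =
     (INF (\<phi>, \<psi>, B) \<in> CPA A bounded_ops \<pi> (orbit_set \<theta> n \<Omega>) \<delta>.
        ereal (Re (fd_trace B (cstar_exp B (\<phi> (orbit_sum A \<theta> n a))))))"

definition approx_pressure ::
  "'a cstar \<Rightarrow> ('a \<Rightarrow> 'a) \<Rightarrow> ('a \<Rightarrow> 'h::complex_hilbert_space \<Rightarrow> 'h) \<Rightarrow> 'a \<Rightarrow> ereal" where
  "approx_pressure A \<theta> \<pi> a =
     (SUP \<Omega> \<in> {\<Omega>. finite \<Omega> \<and> \<Omega> \<subseteq> carrier A}. SUP \<delta> \<in> {0<..}.
        limsup (\<lambda>n. ereal (1 / real n) * ln_ereal (partition_fun A \<theta> n \<pi> a \<Omega> \<delta>)))"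

definition state_extensions ::
  "'a cstar \<Rightarrow> 'd cstar \<Rightarrow> ('a \<Rightarrow> complex) \<Rightarrow> ('a \<Rightarrow> 'd) \<Rightarrow> ('d \<Rightarrow> complex) set" where
  "state_extensions A D \<sigma> \<iota> = {\<omega>. state D \<omega> \<and> (\<forall>x\<in>carrier A. \<omega> (\<iota> x) = \<sigma> x)}"

definition cpe ::
  "'a cstar \<Rightarrow> 'd cstar \<Rightarrow> ('a \<Rightarrow> 'd) \<Rightarrow> ('d \<Rightarrow> complex) \<Rightarrow> 'a set \<Rightarrow> real \<Rightarrow> ereal" where
  "cpe A D \<iota> \<omega> \<Omega> \<delta> =
     (INF (\<phi>, \<psi>, B) \<in> CPA A D \<iota> \<Omega> \<delta>. ereal (von_neumann_entropy B (\<omega> \<circ> \<psi>)))"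

definition local_state_entropy ::
  "'a cstar \<Rightarrow> ('a \<Rightarrow> 'a) \<Rightarrow> ('a \<Rightarrow> complex) \<Rightarrow> 'd cstar \<Rightarrow> ('a \<Rightarrow> 'd) \<Rightarrow> ereal" where
  "local_state_entropy A \<theta> \<sigma> D \<iota> =
     (SUP \<omega> \<in> state_extensions A D \<sigma> \<iota>. SUP \<Omega> \<in> {\<Omega>. finite \<Omega> \<and> \<Omega> \<subseteq> carrier A}. SUP \<delta> \<in> {0<..}.
        limsup (\<lambda>n. ereal (1 / real n) * cpe A D \<iota> \<omega> (orbit_set \<theta> n \<Omega>) \<delta>))"

end

theory Submission
  imports Defs "HOL-Library.Function_Algebras" "HOL-Computational_Algebra.Fundamental_Theorem_Algebra"
begin

text \<open>
  Suppose a triple \<open>(\<phi>, \<psi>, B)\<close> approximates the faithful representation \<open>\<pi>\<close> on the orbit of \<open>\<Omega> \<union> {a}\<close>.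
  The map \<open>\<iota> \<circ> \<pi>\<^sup>-\<^sup>1\<close> on \<open>\<pi>(A)\<close> is completely positive and \<open>D\<close> is injective, so it extends to a unital completely
  positive map \<open>\<Phi>\<close> from all bounded operators to \<open>D\<close> (\<open>extension_to_bounded_ops\<close>). Hence \<open>(\<phi>, \<Phi> \<circ> \<psi>, B)\<close>
  approximates \<open>\<iota>\<close> on the same orbit, and every state \<open>\<omega>\<close> on \<open>D\<close> that extends \<open>\<sigma>\<close> gives a state
  \<open>f = \<omega> \<circ> \<Phi> \<circ> \<psi>\<close> on the finite-dimensional algebra \<open>B\<close>. The Gibbs variational inequality for \<open>f\<close> and the
  self-adjoint element \<open>h = \<phi> (a + \<theta>(a) + \<dots> + \<theta>^(n-1)(a))\<close> reads \<open>exp (S(f) + f(h)) \<le> Tr (exp h)\<close>. By invariance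
  of \<open>\<sigma>\<close> the number \<open>f(h)\<close> falls short of \<open>n \<sigma>(a)\<close> by at most \<open>n\<close> times the tolerance (\<open>triple_estimate\<close>).
  The infimum over all triples, the logarithm, division by \<open>n\<close> and the limit superior then
  give the pressure on one side and, up to an arbitrarily small error, the entropy plus \<open>\<sigma>(a)\<close> on the other.

  Three bodies of theory carry this argument. The first is the order structure of an abstract C*-algebra, built
  without spectra: \<open>exists_root\<close> produces square roots by iteration, and \<open>pos_star_mult\<close> is Kaplansky's theorem that
  \<open>x\<^sup>* x\<close> is the square of a self-adjoint element. It makes unital completely positive maps bounded
  (\<open>cp_map.bound\<close>) and injective *-homomorphisms isometric (\<open>star_hom.isometric\<close>). The second is that bounded
  operators and matrices of bounded operators are C*-algebras (\<open>operator_algebra.cstar_algebra_R\<close>), so that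
  a matrix over \<open>\<pi>(A)\<close> that is positive as an operator is positive over \<open>A\<close> (\<open>matrix_pos_reflect\<close>); this
  is the complete positivity of \<open>\<iota> \<circ> \<pi>\<^sup>-\<^sup>1\<close>. The third is finite-dimensional: a resolution of the
  unit into minimal eigenprojections (\<open>spectral_theorem\<close>), from which the trace, densities, the exponential and
  the Gibbs inequality follow.
\<close>

section \<open>Algebra and norm in a C*-algebra\<close>

context cstar_algebra
begin

text \<open>The scalars \<open>complex_ring\<close> are a ring in this context as well, and its facts shadow those
  of the algebra; the names are rebound to the algebra here.\<close>

lemma ring_A: "ring A"
  by unfold_locales

lemmas m_assoc = monoid.m_assoc[OF ring.is_monoid[OF ring_A]]
lemmas l_distr = ringE(3)[OF ring_A]
lemmas r_distr = ringE(4)[OF ring_A]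
lemmas l_minus = ring.l_minus[OF ring_A]
lemmas r_minus = ring.r_minus[OF ring_A]
lemmas l_neg = abelian_group.l_neg[OF ring.is_abelian_group[OF ring_A]]
lemmas r_neg = abelian_group.r_neg[OF ring.is_abelian_group[OF ring_A]]
lemmas minus_equality = abelian_group.minus_equality[OF ring.is_abelian_group[OF ring_A]]
lemmas minus_minus = abelian_group.minus_minus[OF ring.is_abelian_group[OF ring_A]]
lemmas minus_add = abelian_group.minus_add[OF ring.is_abelian_group[OF ring_A]]
lemmas a_assoc = abelian_monoid.a_assoc[OF abelian_group.axioms(1)[OF ring.is_abelian_group[OF ring_A]]]
lemmas a_comm = abelian_monoid.a_comm[OF abelian_group.axioms(1)[OF ring.is_abelian_group[OF ring_A]]]
lemmas a_lcomm = abelian_monoid.a_lcomm[OF abelian_group.axioms(1)[OF ring.is_abelian_group[OF ring_A]]]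
lemmas a_ac = a_assoc a_comm a_lcomm

lemma semiring_A: "semiring A"
proof -
  interpret ring A by (rule ring_A)
  show ?thesis by unfold_locales
qed

lemmas abelian_monoid_A = semiring.axioms(1)[OF semiring_A]
lemmas finsum_insert = abelian_monoid.finsum_insert[OF abelian_monoid_A]
lemmas finsum_empty = abelian_monoid.finsum_empty[OF abelian_monoid_A]
lemmas finsum_closed = abelian_monoid.finsum_closed[OF abelian_monoid_A]
lemmas finsum_cong' = abelian_monoid.finsum_cong'[OF abelian_monoid_A]
lemmas finsum_addf = abelian_monoid.finsum_addf[OF abelian_monoid_A]
lemmas finsum_ldistr = semiring.finsum_ldistr[OF semiring_A]
lemmas finsum_rdistr = semiring.finsum_rdistr[OF semiring_A]

lemma diff_self [simp]: "x \<in> carrier A \<Longrightarrow> x \<ominus> x = \<zero>"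
  by (simp add: a_minus_def r_neg)

lemma diff_eq_zero: "x \<in> carrier A \<Longrightarrow> y \<in> carrier A \<Longrightarrow> x \<ominus> y = \<zero> \<longleftrightarrow> x = y"
  using minus_equality[of x "\<ominus> y"] by (auto simp: a_minus_def r_neg l_neg minus_minus)

lemma minus_closed_A [simp, intro]: "x \<in> carrier A \<Longrightarrow> y \<in> carrier A \<Longrightarrow> x \<ominus> y \<in> carrier A"
  using abelian_group.minus_closed[OF ring.is_abelian_group[OF ring_A]] .

lemma diff_add_cancel: "x \<in> carrier A \<Longrightarrow> y \<in> carrier A \<Longrightarrow> (x \<ominus> y) \<oplus> y = x"
  by (simp add: a_minus_def a_assoc l_neg)

lemma diff_eq_eq: assumes "x \<in> carrier A" "y \<in> carrier A" "z \<in> carrier A"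
  shows "x \<ominus> y = z \<longleftrightarrow> x = z \<oplus> y" "z = x \<ominus> y \<longleftrightarrow> z \<oplus> y = x"
proof -
  have "x \<ominus> y = z" if "x = z \<oplus> y" using assms that by (simp add: a_minus_def a_assoc r_neg)
  then show "x \<ominus> y = z \<longleftrightarrow> x = z \<oplus> y" using diff_add_cancel[of x y] assms by auto
  then show "z = x \<ominus> y \<longleftrightarrow> z \<oplus> y = x" by auto
qed

lemma add_diff:
  assumes "x \<in> carrier A" "y \<in> carrier A" "z \<in> carrier A"
  shows "x \<oplus> (y \<ominus> z) = (x \<oplus> y) \<ominus> z" "(x \<ominus> y) \<oplus> z = (x \<oplus> z) \<ominus> y"
    "(x \<ominus> y) \<ominus> z = x \<ominus> (y \<oplus> z)" "x \<ominus> (y \<ominus> z) = (x \<oplus> z) \<ominus> y"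
  using assms by (simp_all add: a_minus_def a_ac minus_add minus_minus)

lemma mult_diff:
  assumes "x \<in> carrier A" "y \<in> carrier A" "z \<in> carrier A"
  shows "x \<otimes> (y \<ominus> z) = x \<otimes> y \<ominus> x \<otimes> z" "(x \<ominus> y) \<otimes> z = x \<otimes> z \<ominus> y \<otimes> z"
  using assms by (simp_all add: a_minus_def l_distr r_distr l_minus r_minus)

lemma uminus_diff: "x \<in> carrier A \<Longrightarrow> \<ominus> x = \<zero> \<ominus> x"
  by (simp add: a_minus_def)

text \<open>Moving all negative terms across the equation sign turns a ring identity into an
  equality of sums up to associativity and commutativity.\<close>

lemmas ring_normalize = l_distr r_distr mult_diff add_diff diff_eq_eq a_ac m_assoc

lemma smult_in [simp, intro]: "x \<in> carrier A \<Longrightarrow> c \<odot> x \<in> carrier A"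
  using smult_closed[of c x] by (simp add: complex_ring_def)

lemma smult_add_left: "x \<in> carrier A \<Longrightarrow> (c + d) \<odot> x = c \<odot> x \<oplus> d \<odot> x"
  using smult_l_distr[of c d x] by (simp add: complex_ring_def)

lemma smult_add_right: "x \<in> carrier A \<Longrightarrow> y \<in> carrier A \<Longrightarrow> c \<odot> (x \<oplus> y) = c \<odot> x \<oplus> c \<odot> y"
  using smult_r_distr[of c x y] by (simp add: complex_ring_def)

lemma smult_smult: "x \<in> carrier A \<Longrightarrow> c \<odot> (d \<odot> x) = (c * d) \<odot> x"
  using smult_assoc1[of c d x] by (simp add: complex_ring_def)

lemma smult_1 [simp]: "x \<in> carrier A \<Longrightarrow> 1 \<odot> x = x"
  using smult_one[of x] by (simp add: complex_ring_def)

lemma smult_0 [simp]: "x \<in> carrier A \<Longrightarrow> 0 \<odot> x = \<zero>"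
  using smult_l_null[of x] by (simp add: complex_ring_def)

lemma smult_zero [simp]: "c \<odot> \<zero> = \<zero>"
  using smult_r_null[of c] by (simp add: complex_ring_def)

lemma minus_smult: "x \<in> carrier A \<Longrightarrow> \<ominus> x = (-1) \<odot> x"
  using smult_add_left[of x "-1" 1] by (intro minus_equality) auto

declare star_closed [simp, intro] star_star [simp] star_add [simp] star_smult [simp] star_mult [simp]

lemma diff_smult: "x \<in> carrier A \<Longrightarrow> y \<in> carrier A \<Longrightarrow> x \<ominus> y = x \<oplus> (-1) \<odot> y"
  by (simp add: a_minus_def minus_smult)

lemma smult_uminus: "x \<in> carrier A \<Longrightarrow> c \<odot> (\<ominus> x) = \<ominus> (c \<odot> x)"
  by (simp add: minus_smult smult_smult)

lemma smult_minus_left: "x \<in> carrier A \<Longrightarrow> (- c) \<odot> x = \<ominus> (c \<odot> x)"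
  by (simp add: minus_smult smult_smult)

lemma smult_diff: "x \<in> carrier A \<Longrightarrow> y \<in> carrier A \<Longrightarrow> c \<odot> (x \<ominus> y) = c \<odot> x \<ominus> c \<odot> y"
  by (simp add: a_minus_def smult_add_right smult_uminus)

lemma smult_diff_left: "x \<in> carrier A \<Longrightarrow> (c - d) \<odot> x = c \<odot> x \<ominus> d \<odot> x"
  using smult_add_left[of x c "- d"] by (simp add: a_minus_def smult_minus_left)

lemmas calg = ring_normalize smult_add_right smult_diff smult_mult_left smult_mult_right smult_smult

lemma smult_2: "x \<in> carrier A \<Longrightarrow> 2 \<odot> x = x \<oplus> x"
  using smult_add_left[of x 1 1] by simp

lemma smult_cancel:
  assumes "c \<noteq> 0" "x \<in> carrier A" "y \<in> carrier A" "c \<odot> x = c \<odot> y"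
  shows "x = y"
proof -
  have "x = inverse c \<odot> (c \<odot> x)" using assms(1,2) by (simp add: smult_smult)
  also have "\<dots> = y" unfolding assms(4) using assms(1,3) by (simp add: smult_smult)
  finally show ?thesis .
qed

lemma star_zero [simp]: "star A \<zero> = \<zero>"
  using star_smult[of \<zero> 0] by simp

lemma star_one [simp]: "star A \<one> = \<one>"
  using star_mult[of "star A \<one>" \<one>] by simp

lemma star_uminus [simp]: "x \<in> carrier A \<Longrightarrow> star A (\<ominus> x) = \<ominus> (star A x)"
  by (simp add: minus_smult)

lemma star_diff [simp]: "x \<in> carrier A \<Longrightarrow> y \<in> carrier A \<Longrightarrow> star A (x \<ominus> y) = star A x \<ominus> star A y"
  by (simp add: a_minus_def)

lemma cnorm_zero [simp]: "cnorm A \<zero> = 0"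
  by (simp add: cnorm_eq_0)

lemma cnorm_uminus [simp]: "x \<in> carrier A \<Longrightarrow> cnorm A (\<ominus> x) = cnorm A x"
  by (simp add: minus_smult cnorm_smult)

lemma cnorm_nonneg [simp]: "x \<in> carrier A \<Longrightarrow> 0 \<le> cnorm A x"
  using cnorm_add[of x "\<ominus> x"] by (simp add: r_neg)

lemma cnorm_diff: "x \<in> carrier A \<Longrightarrow> y \<in> carrier A \<Longrightarrow> cnorm A (x \<ominus> y) \<le> cnorm A x + cnorm A y"
  using cnorm_add[of x "\<ominus> y"] by (simp add: a_minus_def)

lemma cnorm_diff_commute: "x \<in> carrier A \<Longrightarrow> y \<in> carrier A \<Longrightarrow> cnorm A (x \<ominus> y) = cnorm A (y \<ominus> x)"
  using cnorm_uminus[of "x \<ominus> y"] by (simp add: a_minus_def a_ac minus_add minus_minus)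

lemma cnorm_triangle3:
  assumes "x \<in> carrier A" "y \<in> carrier A" "z \<in> carrier A"
  shows "cnorm A (x \<ominus> z) \<le> cnorm A (x \<ominus> y) + cnorm A (y \<ominus> z)"
proof -
  have "x \<ominus> z = (x \<ominus> y) \<oplus> (y \<ominus> z)" using assms by (simp add: ring_normalize)
  then show ?thesis using cnorm_add[of "x \<ominus> y" "y \<ominus> z"] assms by simp
qed

lemma cnorm_star [simp]: assumes "x \<in> carrier A" shows "cnorm A (star A x) = cnorm A x"
proof -
  have *: "cnorm A y \<le> cnorm A (star A y)" if "y \<in> carrier A" for y
  proof (cases "cnorm A y = 0")
    case False
    have "(cnorm A y)\<^sup>2 \<le> cnorm A (star A y) * cnorm A y"
      using cnorm_cstar[of y] cnorm_mult[of "star A y" y] that by simp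
    moreover have "0 < cnorm A y" using False cnorm_nonneg[OF that] by linarith
    ultimately show ?thesis by (simp add: power2_eq_square)
  qed (use that in auto)
  from *[of x] *[of "star A x"] assms show ?thesis by simp
qed

lemma cnorm_one_le: "cnorm A \<one> \<le> 1"
proof -
  have "(cnorm A \<one>)\<^sup>2 = cnorm A \<one>" using cnorm_cstar[of \<one>] by simp
  then have "cnorm A \<one> = 0 \<or> cnorm A \<one> = 1" by (simp add: power2_eq_square)
  then show ?thesis by auto
qed

lemma cnorm_sq: "x \<in> carrier A \<Longrightarrow> star A x = x \<Longrightarrow> cnorm A (x \<otimes> x) = (cnorm A x)\<^sup>2"
  using cnorm_cstar[of x] by simp

lemma sq_eq_zero: "x \<in> carrier A \<Longrightarrow> star A x = x \<Longrightarrow> x \<otimes> x = \<zero> \<Longrightarrow> x = \<zero>"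
  using cnorm_sq[of x] cnorm_eq_0[of x] by simp

lemma star_mult_eq_zero: "x \<in> carrier A \<Longrightarrow> star A x \<otimes> x = \<zero> \<Longrightarrow> x = \<zero>"
  using cnorm_cstar[of x] cnorm_eq_0[of x] by simp

definition limit :: "(nat \<Rightarrow> 'a) \<Rightarrow> 'a \<Rightarrow> bool" where
  "limit X x \<longleftrightarrow> (\<lambda>n. cnorm A (X n \<ominus> x)) \<longlonglongrightarrow> 0"

lemma limit_squeeze:
  assumes "\<And>n. cnorm A (X n \<ominus> x) \<le> f n" "f \<longlonglongrightarrow> 0" "x \<in> carrier A" "\<And>n. X n \<in> carrier A"
  shows "limit X x"
  unfolding limit_def
  by (rule tendsto_sandwich[OF _ _ tendsto_const assms(2)]) (use assms in auto)

lemma limit_unique: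
  assumes "limit X x" "limit X y" "\<And>n. X n \<in> carrier A" "x \<in> carrier A" "y \<in> carrier A"
  shows "x = y"
proof -
  have "(\<lambda>n. cnorm A (X n \<ominus> x) + cnorm A (X n \<ominus> y)) \<longlonglongrightarrow> 0 + 0"
    using assms unfolding limit_def by (intro tendsto_add)
  moreover have "cnorm A (x \<ominus> y) \<le> cnorm A (X n \<ominus> x) + cnorm A (X n \<ominus> y)" for n
    using cnorm_triangle3[of x "X n" y] assms cnorm_diff_commute[of x "X n"] by simp
  ultimately have "cnorm A (x \<ominus> y) \<le> 0"
    by (intro LIMSEQ_le_const[of _ "0"]) auto
  then have "cnorm A (x \<ominus> y) = 0" by (rule antisym) (use assms in auto)
  then show ?thesis using cnorm_eq_0[of "x \<ominus> y"] diff_eq_zero[of x y] assms(4,5) by simp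
qed

lemma limit_add:
  assumes "limit X x" "limit Y y" "\<And>n. X n \<in> carrier A" "\<And>n. Y n \<in> carrier A" "x \<in> carrier A" "y \<in> carrier A"
  shows "limit (\<lambda>n. X n \<oplus> Y n) (x \<oplus> y)"
proof (rule limit_squeeze)
  show "(\<lambda>n. cnorm A (X n \<ominus> x) + cnorm A (Y n \<ominus> y)) \<longlonglongrightarrow> 0"
    using tendsto_add[OF assms(1,2)[unfolded limit_def]] by simp
  fix n
  have "(X n \<oplus> Y n) \<ominus> (x \<oplus> y) = (X n \<ominus> x) \<oplus> (Y n \<ominus> y)" using assms(3-)
    by (simp add: a_minus_def minus_add a_ac)
  then show "cnorm A ((X n \<oplus> Y n) \<ominus> (x \<oplus> y)) \<le> cnorm A (X n \<ominus> x) + cnorm A (Y n \<ominus> y)"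
    using cnorm_add[of "X n \<ominus> x" "Y n \<ominus> y"] assms by simp
qed (use assms in auto)

lemma limit_smult:
  assumes "limit X x" "\<And>n. X n \<in> carrier A" "x \<in> carrier A"
  shows "limit (\<lambda>n. c \<odot> X n) (c \<odot> x)"
proof (rule limit_squeeze)
  show "(\<lambda>n. cmod c * cnorm A (X n \<ominus> x)) \<longlonglongrightarrow> 0"
    using tendsto_mult_left[OF assms(1)[unfolded limit_def], of "cmod c"] by simp
qed (use assms in \<open>auto simp: cnorm_smult smult_diff[symmetric]\<close>)

lemma limit_star:
  assumes "limit X x" "\<And>n. X n \<in> carrier A" "x \<in> carrier A"
  shows "limit (\<lambda>n. star A (X n)) (star A x)"
  using assms by (simp add: limit_def flip: star_diff)

lemma limit_const: "x \<in> carrier A \<Longrightarrow> limit (\<lambda>n. x) x"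
  by (simp add: limit_def r_neg a_minus_def)

lemma cnorm_limit_le:
  assumes "limit X x" "\<And>n. X n \<in> carrier A" "x \<in> carrier A" "\<And>n. cnorm A (X n) \<le> c"
  shows "cnorm A x \<le> c"
proof -
  have "cnorm A x \<le> cnorm A (X n \<ominus> x) + c" for n
  proof -
    have "X n \<ominus> (X n \<ominus> x) = x" using assms(2,3) by (simp add: ring_normalize)
    then show ?thesis using cnorm_diff[of "X n" "X n \<ominus> x"] assms(2,3) assms(4)[of n] by simp
  qed
  moreover have "(\<lambda>n. cnorm A (X n \<ominus> x) + c) \<longlonglongrightarrow> 0 + c"
    using assms(1) unfolding limit_def by (intro tendsto_add tendsto_const)
  ultimately show ?thesis by (intro LIMSEQ_le_const[of _ c]) auto
qed

lemma limit_mult: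
  assumes "limit X x" "limit Y y" "\<And>n. X n \<in> carrier A" "\<And>n. Y n \<in> carrier A" "x \<in> carrier A" "y \<in> carrier A"
    and bd: "\<And>n. cnorm A (Y n) \<le> c"
  shows "limit (\<lambda>n. X n \<otimes> Y n) (x \<otimes> y)"
proof (rule limit_squeeze)
  have "(\<lambda>n. cnorm A (X n \<ominus> x) * c + cnorm A x * cnorm A (Y n \<ominus> y)) \<longlonglongrightarrow> 0 * c + cnorm A x * 0"
    using assms(1,2)[unfolded limit_def] by (intro tendsto_intros)
  then show "(\<lambda>n. cnorm A (X n \<ominus> x) * c + cnorm A x * cnorm A (Y n \<ominus> y)) \<longlonglongrightarrow> 0" by simp
  fix n
  have "X n \<otimes> Y n \<ominus> x \<otimes> y = (X n \<ominus> x) \<otimes> Y n \<oplus> x \<otimes> (Y n \<ominus> y)" using assms(3-6) by (simp add: ring_normalize)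
  moreover have "cnorm A ((X n \<ominus> x) \<otimes> Y n) \<le> cnorm A (X n \<ominus> x) * c"
    using cnorm_mult[of "X n \<ominus> x" "Y n"] assms mult_left_mono[OF bd[of n], of "cnorm A (X n \<ominus> x)"] by simp
  ultimately show "cnorm A (X n \<otimes> Y n \<ominus> x \<otimes> y) \<le> cnorm A (X n \<ominus> x) * c + cnorm A x * cnorm A (Y n \<ominus> y)"
    using cnorm_add[of "(X n \<ominus> x) \<otimes> Y n" "x \<otimes> (Y n \<ominus> y)"] cnorm_mult[of x "Y n \<ominus> y"] assms by simp
qed (use assms in auto)

section \<open>Square roots by iteration\<close>

text \<open>A limit of polynomials in \<open>x\<close> without constant term lies in every such set that contains \<open>x\<close>. The instances of interest are
  commutants and the matrices with entries in a represented algebra.\<close>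

definition closed_subalgebra :: "'a set \<Rightarrow> bool" where
  "closed_subalgebra M \<longleftrightarrow> M \<subseteq> carrier A \<and> \<zero> \<in> M \<and> (\<forall>x\<in>M. \<forall>y\<in>M. x \<oplus> y \<in> M \<and> x \<otimes> y \<in> M) \<and>
     (\<forall>c. \<forall>x\<in>M. c \<odot> x \<in> M) \<and> (\<forall>X x. (\<forall>n. X n \<in> M) \<longrightarrow> x \<in> carrier A \<longrightarrow> limit X x \<longrightarrow> x \<in> M)"

lemma limit_mult_const:
  assumes "limit X x" "\<And>n. X n \<in> carrier A" "x \<in> carrier A" "y \<in> carrier A"
  shows "limit (\<lambda>n. X n \<otimes> y) (x \<otimes> y)" "limit (\<lambda>n. y \<otimes> X n) (y \<otimes> x)"
proof -
  show "limit (\<lambda>n. X n \<otimes> y) (x \<otimes> y)"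
    using assms by (intro limit_mult[of X x "\<lambda>_. y" y "cnorm A y"] limit_const) auto
  have "(\<lambda>n. cnorm A y * cnorm A (X n \<ominus> x)) \<longlonglongrightarrow> cnorm A y * 0"
    using assms(1)[unfolded limit_def] by (intro tendsto_intros)
  moreover have "y \<otimes> X n \<ominus> y \<otimes> x = y \<otimes> (X n \<ominus> x)" for n using assms(2-4) by (simp add: ring_normalize)
  ultimately show "limit (\<lambda>n. y \<otimes> X n) (y \<otimes> x)"
    using assms by (intro limit_squeeze[where f = "\<lambda>n. cnorm A y * cnorm A (X n \<ominus> x)"]) (auto simp: cnorm_mult)
qed

lemma closed_subalgebraI:
  assumes "M \<subseteq> carrier A" "\<zero> \<in> M" "\<And>x y. x \<in> M \<Longrightarrow> y \<in> M \<Longrightarrow> x \<oplus> y \<in> M"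
    "\<And>x y. x \<in> M \<Longrightarrow> y \<in> M \<Longrightarrow> x \<otimes> y \<in> M" "\<And>c x. x \<in> M \<Longrightarrow> c \<odot> x \<in> M"
    "\<And>X x. (\<And>n. X n \<in> M) \<Longrightarrow> x \<in> carrier A \<Longrightarrow> limit X x \<Longrightarrow> x \<in> M"
  shows "closed_subalgebra M"
  using assms unfolding closed_subalgebra_def by blast

lemma closed_subalgebra_commutant:
  assumes y: "y \<in> carrier A"
  shows "closed_subalgebra {z \<in> carrier A. z \<otimes> y = y \<otimes> z}" (is "closed_subalgebra ?M")
proof (rule closed_subalgebraI)
  show "?M \<subseteq> carrier A" "\<zero> \<in> ?M" using y by auto
  fix x z assume xz: "x \<in> ?M" "z \<in> ?M"
  show "x \<oplus> z \<in> ?M" using y xz by (simp add: l_distr r_distr)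
  have "x \<otimes> z \<otimes> y = x \<otimes> (y \<otimes> z)" using xz y by (simp add: m_assoc)
  also have "\<dots> = y \<otimes> (x \<otimes> z)" using xz y m_assoc[of x y z] m_assoc[of y x z] by simp
  finally show "x \<otimes> z \<in> ?M" using y xz by simp
next
  fix c x assume "x \<in> ?M"
  then show "c \<odot> x \<in> ?M" using y by (simp add: smult_mult_left smult_mult_right)
next
  fix X x assume X: "\<And>n. X n \<in> ?M" "x \<in> carrier A" "limit X x"
  then have X1: "\<And>n. X n \<in> carrier A" and X2: "\<And>n. y \<otimes> X n = X n \<otimes> y" by auto
  have "limit (\<lambda>n. X n \<otimes> y) (x \<otimes> y)" "limit (\<lambda>n. X n \<otimes> y) (y \<otimes> x)"
    using limit_mult_const[OF X(3) X1 X(2) y] unfolding X2 .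
  then have "x \<otimes> y = y \<otimes> x" using X1 X(2) y by (intro limit_unique[of "\<lambda>n. X n \<otimes> y"]) auto
  then show "x \<in> ?M" using X(2) by simp
qed

text \<open>The limit \<open>g\<close> satisfies \<open>2 g = x + g\<^sup>2\<close>, that is \<open>(1 - g)\<^sup>2 = 1 - x\<close>. Solving for \<open>g\<close> instead of the root itself
  keeps the unit out of the iteration.\<close>

primrec root_iter :: "'a \<Rightarrow> nat \<Rightarrow> 'a" where
  "root_iter x 0 = \<zero>"
| "root_iter x (Suc k) = (1/2) \<odot> (x \<oplus> root_iter x k \<otimes> root_iter x k)"

text \<open>The same iteration for the number \<open>x = 1\<close>. Its increments dominate those of \<open>root_iter x\<close> whenever \<open>x\<close> has norm at
  most 1.\<close>

primrec majorant :: "nat \<Rightarrow> real" where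
  "majorant 0 = 0"
| "majorant (Suc k) = (1 + (majorant k)\<^sup>2) / 2"

lemma majorant_bounds: "0 \<le> majorant k \<and> majorant k \<le> 1"
  by (induction k) (auto simp: power_le_one)

lemma root_iter_in:
  assumes "closed_subalgebra M" "x \<in> M" shows "root_iter x k \<in> M"
  using assms by (induction k) (auto simp: closed_subalgebra_def)

text \<open>Convergence holds up to and including norm 1, where no geometric estimate is available: the iterates commute, so
  consecutive increments satisfy \<open>g'' - g' = (g' - g) (g' + g) / 2\<close> and are dominated by the increments of the
  bounded increasing sequence \<open>majorant\<close>.\<close>

lemma exists_root:
  assumes x: "x \<in> carrier A" "star A x = x" "cnorm A x \<le> 1"
  shows "\<exists>g\<in>carrier A. star A g = g \<and> cnorm A g \<le> 1 \<and> g \<oplus> g = x \<oplus> g \<otimes> g \<and>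
    (\<forall>M. closed_subalgebra M \<longrightarrow> x \<in> M \<longrightarrow> g \<in> M)"
proof -
  let ?g = "root_iter x" and ?s = majorant
  have in_A [simp]: "?g k \<in> carrier A" for k
    using x by (induction k) auto
  have comm: "?g j \<otimes> ?g k = ?g k \<otimes> ?g j" for j k
  proof -
    have "x \<otimes> ?g k = ?g k \<otimes> x" for k
      using root_iter_in[OF closed_subalgebra_commutant[OF x(1)], of x k] x by simp
    then show ?thesis
      using root_iter_in[OF closed_subalgebra_commutant[of "?g k"], of x j] x by simp
  qed
  have sa: "star A (?g k) = ?g k" for k by (induction k) (use x in auto)
  have bd: "cnorm A (?g k) \<le> ?s k" for k
  proof (induction k)
    case (Suc k)
    have "cnorm A (x \<oplus> ?g k \<otimes> ?g k) \<le> 1 + (?s k)\<^sup>2"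
      using cnorm_add[of x "?g k \<otimes> ?g k"] cnorm_sq[OF in_A sa, of k] x
        power_mono[OF Suc, of 2] by simp
    then show ?case using x by (simp add: cnorm_smult norm_divide)
  qed simp
  have step: "cnorm A (?g (Suc k) \<ominus> ?g k) \<le> ?s (Suc k) - ?s k" for k
  proof (induction k)
    case 0
    then show ?case using x by (simp add: cnorm_smult norm_divide a_minus_def)
  next
    case (Suc k)
    define p q where "p = ?g (Suc k)" and "q = ?g k"
    have [simp]: "p \<in> carrier A" "q \<in> carrier A" and pq: "p \<otimes> q = q \<otimes> p"
      using comm by (simp_all add: p_def q_def del: root_iter.simps)
    have "(x \<oplus> p \<otimes> p) \<ominus> (x \<oplus> q \<otimes> q) = (p \<ominus> q) \<otimes> (p \<oplus> q)"
      using x(1) by (simp add: ring_normalize pq)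
    then have "?g (Suc (Suc k)) \<ominus> ?g (Suc k) = (1/2) \<odot> ((p \<ominus> q) \<otimes> (p \<oplus> q))"
      using x(1) by (simp add: p_def q_def flip: smult_diff)
    then have "cnorm A (?g (Suc (Suc k)) \<ominus> ?g (Suc k)) \<le> 1/2 * (cnorm A (p \<ominus> q) * cnorm A (p \<oplus> q))"
      by (simp add: cnorm_smult norm_divide cnorm_mult del: root_iter.simps)
    also have "\<dots> \<le> 1/2 * ((?s (Suc k) - ?s k) * (?s (Suc k) + ?s k))"
    proof (intro mult_left_mono mult_mono)
      show "cnorm A (p \<ominus> q) \<le> ?s (Suc k) - ?s k" using Suc by (simp add: p_def q_def)
      show "cnorm A (p \<oplus> q) \<le> ?s (Suc k) + ?s k"
        using cnorm_add[of p q] bd[of "Suc k"] bd[of k] unfolding p_def q_def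
        by (simp del: root_iter.simps majorant.simps)
      show "0 \<le> ?s (Suc k) - ?s k"
        using order_trans[OF cnorm_nonneg[OF minus_closed_A[OF in_A in_A]] Suc] by (simp del: root_iter.simps majorant.simps)
    qed auto
    also have "\<dots> = ?s (Suc (Suc k)) - ?s (Suc k)"
    proof -
      have "1/2 * ((u - v) * (u + v)) = (1 + u\<^sup>2) / 2 - (1 + v\<^sup>2) / 2" for u v :: real
        by (simp add: power2_eq_square field_simps)
      from this[of "?s (Suc k)" "?s k"] show ?thesis by (simp only: majorant.simps(2)[symmetric])
    qed
    finally show ?case .
  qed
  have mono: "incseq ?s"
  proof (rule incseq_SucI)
    fix k show "?s k \<le> ?s (Suc k)"
      using order_trans[OF cnorm_nonneg[OF minus_closed_A[OF in_A in_A]] step[of k]] by (simp del: root_iter.simps majorant.simps)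
  qed
  obtain L where "?s \<longlonglongrightarrow> L"
    using incseq_convergent[OF mono, of 1] majorant_bounds by blast
  then have "Cauchy ?s" by (rule LIMSEQ_imp_Cauchy)
  have tele: "cnorm A (?g m \<ominus> ?g n) \<le> ?s m - ?s n" if "n \<le> m" for m n
    using that
  proof (induction m rule: dec_induct)
    case base
    show ?case by (simp add: diff_eq_zero a_minus_def r_neg)
  next
    case (step m)
    then show ?case using cnorm_triangle3[of "?g (Suc m)" "?g m" "?g n"] \<open>\<And>k. cnorm A (?g (Suc k) \<ominus> ?g k) \<le> _\<close>[of m]
      by (simp del: root_iter.simps majorant.simps)
  qed
  have "\<exists>N. \<forall>m\<ge>N. \<forall>n\<ge>N. cnorm A (?g m \<ominus> ?g n) < e" if "e > 0" for e
  proof -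
    obtain N where N: "\<And>m n. m \<ge> N \<Longrightarrow> n \<ge> N \<Longrightarrow> norm (?s m - ?s n) < e"
      using CauchyD[OF \<open>Cauchy ?s\<close> \<open>e > 0\<close>] by auto
    have "cnorm A (?g m \<ominus> ?g n) < e" if "m \<ge> N" "n \<ge> N" for m n
      using N[OF that] tele[of n m] tele[of m n] cnorm_diff_commute[of "?g m" "?g n"] by (cases "n \<le> m") auto
    then show ?thesis by blast
  qed
  then obtain g where g: "g \<in> carrier A" "limit ?g g"
    using cnorm_complete[of ?g] by (auto simp: limit_def)
  have bd1: "cnorm A (?g k) \<le> 1" for k using bd[of k] majorant_bounds[of k] by linarith
  have *: "2 \<odot> ?g (Suc k) = x \<oplus> ?g k \<otimes> ?g k" for k using x by (simp add: smult_smult)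
  have "limit (\<lambda>k. 2 \<odot> ?g (Suc k)) (2 \<odot> g)"
    using limit_smult[of "\<lambda>k. ?g (Suc k)" g 2] g LIMSEQ_Suc[of "\<lambda>k. cnorm A (?g k \<ominus> g)" 0]
    by (auto simp: limit_def simp del: root_iter.simps)
  moreover have "limit (\<lambda>k. x \<oplus> ?g k \<otimes> ?g k) (x \<oplus> g \<otimes> g)"
    using g x bd1 by (intro limit_add limit_const limit_mult[of _ _ _ _ 1]) auto
  ultimately have "2 \<odot> g = x \<oplus> g \<otimes> g"
    using limit_unique[of "\<lambda>k. x \<oplus> ?g k \<otimes> ?g k" "2 \<odot> g" "x \<oplus> g \<otimes> g"] g x unfolding * by simp
  then have "g \<oplus> g = x \<oplus> g \<otimes> g" using g by (simp add: smult_2)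
  moreover have "star A g = g"
    using limit_unique[of ?g "star A g" g] limit_star[of ?g g] g by (simp add: sa)
  moreover have "cnorm A g \<le> 1" by (rule cnorm_limit_le[of ?g]) (use g bd1 in auto)
  moreover have "g \<in> M" if "closed_subalgebra M" "x \<in> M" for M
  proof -
    have "\<forall>n. ?g n \<in> M" using root_iter_in[OF that] by blast
    then show ?thesis using that(1) g unfolding closed_subalgebra_def by blast
  qed
  ultimately show ?thesis using g(1) by blast
qed

end

section \<open>Positive elements\<close>

context cstar_algebra
begin

lemma comm_left:
  assumes "x \<otimes> y = y \<otimes> x" "x \<in> carrier A" "y \<in> carrier A" "z \<in> carrier A"
  shows "x \<otimes> (y \<otimes> z) = y \<otimes> (x \<otimes> z)"
  using assms m_assoc[of x y z] m_assoc[of y x z] by simp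

text \<open>Positivity as being a square of a self-adjoint element, which every map preserving products and stars respects.
  That sums are positive and that \<open>x\<^sup>* x\<close> is positive are then theorems.\<close>

definition pos :: "'a \<Rightarrow> bool" where
  "pos x \<longleftrightarrow> (\<exists>s\<in>carrier A. star A s = s \<and> x = s \<otimes> s)"

lemma pos_closed [simp]: "pos x \<Longrightarrow> x \<in> carrier A"
  by (auto simp: pos_def)

lemma pos_sa: "pos x \<Longrightarrow> star A x = x"
  by (auto simp: pos_def)

lemma posI: "s \<in> carrier A \<Longrightarrow> star A s = s \<Longrightarrow> pos (s \<otimes> s)"
  by (auto simp: pos_def)

lemma root_one_minus:
  assumes x: "x \<in> carrier A" "star A x = x" "cnorm A x \<le> 1"
  shows "\<exists>r\<in>carrier A. star A r = r \<and> r \<otimes> r = \<one> \<ominus> x \<and> cnorm A (\<one> \<ominus> r) \<le> 1 \<and>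
    (\<forall>y\<in>carrier A. x \<otimes> y = y \<otimes> x \<longrightarrow> r \<otimes> y = y \<otimes> r) \<and>
    (\<forall>M. closed_subalgebra M \<longrightarrow> x \<in> M \<longrightarrow> \<one> \<ominus> r \<in> M)"
proof -
  obtain g where g: "g \<in> carrier A" "star A g = g" "cnorm A g \<le> 1" "g \<oplus> g = x \<oplus> g \<otimes> g"
    and gM: "\<forall>M. closed_subalgebra M \<longrightarrow> x \<in> M \<longrightarrow> g \<in> M"
    using exists_root[OF x] by (elim bexE exE conjE) (rule that, assumption+)
  define r where "r = \<one> \<ominus> g"
  have r: "r \<in> carrier A" "star A r = r" using g by (simp_all add: r_def)
  have *: "\<one> \<ominus> r = g" using g by (simp add: r_def ring_normalize)
  have "r \<otimes> r = (\<one> \<oplus> g \<otimes> g) \<ominus> (g \<oplus> g)" using g(1) by (simp add: r_def ring_normalize)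
  also have "\<dots> = \<one> \<ominus> x" unfolding g(4) using g(1) x(1) by (simp add: ring_normalize)
  finally have rr: "r \<otimes> r = \<one> \<ominus> x" .
  have "r \<otimes> y = y \<otimes> r" if "y \<in> carrier A" "x \<otimes> y = y \<otimes> x" for y
  proof -
    have "g \<in> {z \<in> carrier A. z \<otimes> y = y \<otimes> z}"
      using gM closed_subalgebra_commutant[OF that(1)] that(2) x(1) by blast
    then have "g \<otimes> y = y \<otimes> g" by blast
    then show ?thesis using g(1) that(1) by (simp add: r_def mult_diff)
  qed
  then show ?thesis using r rr g(3) gM * by metis
qed

text \<open>The element \<open>u = a + \<i> b\<close> satisfies \<open>u\<^sup>* u = c\<close>, so its norm is known, and \<open>2 a = u + u\<^sup>*\<close>.\<close>

lemma sum_squares_norm: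
  assumes a: "a \<in> carrier A" "star A a = a" and b: "b \<in> carrier A" "star A b = b"
    and ab: "a \<otimes> b = b \<otimes> a" and sum: "a \<otimes> a \<oplus> b \<otimes> b = complex_of_real c \<odot> \<one>" and c: "0 \<le> c"
  shows "(cnorm A a)\<^sup>2 \<le> c"
proof -
  define u where "u = a \<oplus> \<i> \<odot> b"
  have u: "u \<in> carrier A" using a b by (simp add: u_def)
  have su: "star A u = a \<ominus> \<i> \<odot> b" using a b by (simp add: u_def smult_minus_left a_minus_def)
  have "star A u \<otimes> u = a \<otimes> a \<oplus> b \<otimes> b"
    unfolding su unfolding u_def using a b ab by (simp add: calg smult_minus_left uminus_diff)
  then have "(cnorm A u)\<^sup>2 = cnorm A (complex_of_real c \<odot> \<one>)"
    using cnorm_cstar[OF u] sum by simp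
  also have "\<dots> \<le> c" using c mult_left_mono[OF cnorm_one_le c] by (simp add: cnorm_smult)
  finally have *: "(cnorm A u)\<^sup>2 \<le> c" .
  have "2 \<odot> a = u \<oplus> star A u" unfolding su unfolding u_def using a b by (simp add: smult_2 ring_normalize)
  then have "2 * cnorm A a \<le> cnorm A u + cnorm A u"
    using cnorm_add[of u "star A u"] u cnorm_smult[OF a(1), of 2] by simp
  then have "(cnorm A a)\<^sup>2 \<le> (cnorm A u)\<^sup>2" using a(1) by (intro power_mono) auto
  with * show ?thesis by simp
qed

text \<open>With \<open>r\<close> a root of \<open>1 - a\<^sup>2\<close> the squares of \<open>r\<close> and \<open>a\<close> sum to 1, which bounds \<open>r\<close> by \<open>sum_squares_norm\<close>.\<close>

lemma one_minus_square_norm: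
  assumes a: "a \<in> carrier A" "star A a = a" "cnorm A a \<le> 1"
  shows "cnorm A (\<one> \<ominus> a \<otimes> a) \<le> 1"
proof -
  have aa: "a \<otimes> a \<in> carrier A" "star A (a \<otimes> a) = a \<otimes> a" using a by simp_all
  have n: "cnorm A (a \<otimes> a) \<le> 1" using a by (simp add: cnorm_sq power_le_one)
  obtain r where r: "r \<in> carrier A" "star A r = r" "r \<otimes> r = \<one> \<ominus> a \<otimes> a"
    and comm: "\<forall>y\<in>carrier A. (a \<otimes> a) \<otimes> y = y \<otimes> (a \<otimes> a) \<longrightarrow> r \<otimes> y = y \<otimes> r"
    using root_one_minus[OF aa n] by (elim bexE exE conjE) (rule that, assumption+)
  have "a \<otimes> a \<otimes> a = a \<otimes> (a \<otimes> a)" by (rule m_assoc[OF a(1) a(1) a(1)])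
  then have ra: "r \<otimes> a = a \<otimes> r" using comm a(1) by blast
  have "r \<otimes> r \<oplus> a \<otimes> a = complex_of_real 1 \<odot> \<one>"
    unfolding r(3) using a(1) by (simp add: diff_add_cancel)
  then have "(cnorm A r)\<^sup>2 \<le> 1" by (rule sum_squares_norm[OF r(1,2) a(1,2) ra]) simp
  then show ?thesis using cnorm_sq[OF r(1,2)] r(3) by simp
qed

lemma pos_smult:
  assumes "pos x" "0 \<le> c" shows "pos (complex_of_real c \<odot> x)"
proof -
  obtain s where s: "s \<in> carrier A" "star A s = s" "x = s \<otimes> s" using assms(1) by (auto simp: pos_def)
  have "complex_of_real c = complex_of_real (sqrt c) * complex_of_real (sqrt c)"
    using assms(2) by (simp flip: of_real_mult)
  then have "complex_of_real c \<odot> x = (complex_of_real (sqrt c) \<odot> s) \<otimes> (complex_of_real (sqrt c) \<odot> s)"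
    using s by (simp add: smult_mult_left smult_mult_right smult_smult)
  then show ?thesis using s by (simp add: posI)
qed

text \<open>Together with \<open>pos_root_of_bound\<close> this replaces positivity by the norm condition that \<open>1 - x / t\<close> lies in the
  unit ball. That condition is convex in \<open>x\<close>, whence \<open>pos_add\<close>.\<close>

lemma pos_bound:
  assumes "pos x" "cnorm A x \<le> t" "0 < t"
  shows "cnorm A (\<one> \<ominus> complex_of_real (1/t) \<odot> x) \<le> 1"
proof -
  obtain s where s: "s \<in> carrier A" "star A s = s" "complex_of_real (1/t) \<odot> x = s \<otimes> s"
    using pos_smult[OF assms(1), of "1/t"] assms(3) by (auto simp: pos_def)
  have "(cnorm A s)\<^sup>2 = cnorm A (complex_of_real (1/t) \<odot> x)" using s cnorm_sq by simp
  also have "\<dots> \<le> 1" using assms by (simp add: cnorm_smult norm_divide)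
  finally have "cnorm A s \<le> 1" using s by (simp add: power_le_one_iff)
  then show ?thesis using one_minus_square_norm[of s] s by simp
qed

text \<open>The root \<open>r = 1 - g\<close> from \<open>root_one_minus\<close> has \<open>g\<close> in the unit ball, so that \<open>root_one_minus\<close> applies once more
  and shows that \<open>r\<close> itself is positive.\<close>

lemma pos_root_of_bound:
  assumes x: "x \<in> carrier A" "star A x = x" and t: "0 < t"
    and bd: "cnorm A (\<one> \<ominus> complex_of_real (1/t) \<odot> x) \<le> 1"
  shows "\<exists>r. pos r \<and> r \<otimes> r = x \<and> (\<forall>y\<in>carrier A. x \<otimes> y = y \<otimes> x \<longrightarrow> r \<otimes> y = y \<otimes> r)"
proof -
  define y where "y = \<one> \<ominus> complex_of_real (1/t) \<odot> x"
  have y: "y \<in> carrier A" "star A y = y" using x by (simp_all add: y_def)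
  obtain r where r: "r \<in> carrier A" "star A r = r" "r \<otimes> r = \<one> \<ominus> y" "cnorm A (\<one> \<ominus> r) \<le> 1"
    and comm: "\<forall>z\<in>carrier A. y \<otimes> z = z \<otimes> y \<longrightarrow> r \<otimes> z = z \<otimes> r"
    using root_one_minus[OF y bd[folded y_def]] by (elim bexE exE conjE) (rule that, assumption+)
  have s: "\<one> \<ominus> r \<in> carrier A" "star A (\<one> \<ominus> r) = \<one> \<ominus> r" using r(1,2) by simp_all
  obtain q where q: "q \<in> carrier A" "star A q = q" "q \<otimes> q = \<one> \<ominus> (\<one> \<ominus> r)"
    using root_one_minus[OF s r(4)] by (elim bexE exE conjE) (rule that, assumption+)
  have "q \<otimes> q = r" unfolding q(3) using r(1) by (simp add: ring_normalize)
  then have "pos r" using q posI by blast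
  define p where "p = complex_of_real (sqrt t) \<odot> r"
  have "pos p" unfolding p_def using \<open>pos r\<close> t by (intro pos_smult) auto
  moreover have "p \<otimes> p = x"
  proof -
    have "p \<otimes> p = complex_of_real t \<odot> (r \<otimes> r)"
      unfolding p_def using r(1) t by (simp add: smult_mult_left smult_mult_right smult_smult flip: of_real_mult)
    also have "r \<otimes> r = complex_of_real (1/t) \<odot> x" unfolding r(3) y_def using x by (simp add: ring_normalize)
    finally show ?thesis using x t by (simp add: smult_smult)
  qed
  moreover have "p \<otimes> z = z \<otimes> p" if "z \<in> carrier A" "x \<otimes> z = z \<otimes> x" for z
  proof -
    have "y \<otimes> z = z \<otimes> y" unfolding y_def using that x by (simp add: mult_diff smult_mult_left smult_mult_right)
    with comm that(1) have "r \<otimes> z = z \<otimes> r" by blast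
    then show ?thesis
      unfolding p_def using r(1) that(1) by (simp add: smult_mult_left smult_mult_right)
  qed
  ultimately show ?thesis by blast
qed

lemma pos_root:
  assumes "pos x"
  shows "\<exists>r. pos r \<and> r \<otimes> r = x \<and> (\<forall>y\<in>carrier A. x \<otimes> y = y \<otimes> x \<longrightarrow> r \<otimes> y = y \<otimes> r)"
proof -
  have "0 < cnorm A x + 1" using cnorm_nonneg[OF pos_closed[OF assms]] by linarith
  then show ?thesis
    by (rule pos_root_of_bound[OF pos_closed[OF assms] pos_sa[OF assms]]) (rule pos_bound[OF assms], use \<open>0 < cnorm A x + 1\<close> in auto)
qed

lemma pos_add:
  assumes "pos x" "pos y" shows "pos (x \<oplus> y)"
proof -
  define t where "t = cnorm A x + cnorm A y + 1"
  have xy: "x \<in> carrier A" "y \<in> carrier A" "star A x = x" "star A y = y" using assms pos_sa by auto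
  have t: "0 < t" "cnorm A x \<le> t" "cnorm A y \<le> t"
    using cnorm_nonneg[OF xy(1)] cnorm_nonneg[OF xy(2)] unfolding t_def by linarith+
  define p q where "p = \<one> \<ominus> complex_of_real (1/t) \<odot> x" and "q = \<one> \<ominus> complex_of_real (1/t) \<odot> y"
  have pq: "p \<in> carrier A" "q \<in> carrier A" "cnorm A p \<le> 1" "cnorm A q \<le> 1"
    unfolding p_def q_def using pos_bound[OF assms(1)] pos_bound[OF assms(2)] t xy by auto
  have "2 \<odot> (\<one> \<ominus> complex_of_real (1/(2*t)) \<odot> (x \<oplus> y)) = p \<oplus> q"
    unfolding p_def q_def using xy t(1) by (simp add: smult_diff smult_2[of \<one>] smult_add_right smult_smult ring_normalize)
  then have "2 * cnorm A (\<one> \<ominus> complex_of_real (1/(2*t)) \<odot> (x \<oplus> y)) = cnorm A (p \<oplus> q)"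
    using cnorm_smult[of "\<one> \<ominus> complex_of_real (1/(2*t)) \<odot> (x \<oplus> y)" 2] xy by simp
  also have "\<dots> \<le> 2" using cnorm_add[of p q] pq by linarith
  finally have "cnorm A (\<one> \<ominus> complex_of_real (1/(2*t)) \<odot> (x \<oplus> y)) \<le> 1" by simp
  then obtain r where "pos r" "r \<otimes> r = x \<oplus> y"
    using pos_root_of_bound[of "x \<oplus> y" "2*t"] xy t(1) by auto
  then show ?thesis using posI[of r] pos_sa by fastforce
qed

text \<open>Self-adjoint elements of the bicommutant of \<open>h\<close>. They commute with each other and are closed under
  taking roots, so this is the commutative algebra in which absolute values and negative parts of \<open>h\<close> live.\<close>

definition bic :: "'a \<Rightarrow> 'a \<Rightarrow> bool" where
  "bic h z \<longleftrightarrow> z \<in> carrier A \<and> star A z = z \<and> (\<forall>y\<in>carrier A. h \<otimes> y = y \<otimes> h \<longrightarrow> z \<otimes> y = y \<otimes> z)"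

lemma bic_closed: "bic h z \<Longrightarrow> z \<in> carrier A" "bic h z \<Longrightarrow> star A z = z"
  by (auto simp: bic_def)

lemma bic_comm: assumes "h \<in> carrier A" "bic h z" "bic h y" shows "z \<otimes> y = y \<otimes> z"
proof -
  have "y \<otimes> h = h \<otimes> y" using assms(1,3) unfolding bic_def by blast
  then show ?thesis using assms(2,3) unfolding bic_def by metis
qed

lemma bic_self: "h \<in> carrier A \<Longrightarrow> star A h = h \<Longrightarrow> bic h h"
  by (simp add: bic_def)

lemma bic_add: "bic h z \<Longrightarrow> bic h y \<Longrightarrow> bic h (z \<oplus> y)"
  by (simp add: bic_def l_distr r_distr)

lemma bic_diff: "bic h z \<Longrightarrow> bic h y \<Longrightarrow> bic h (z \<ominus> y)"
  by (simp add: bic_def mult_diff)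

lemma bic_mult: assumes "h \<in> carrier A" "bic h z" "bic h y" shows "bic h (z \<otimes> y)"
proof -
  note cl = bic_closed[OF assms(2)] bic_closed[OF assms(3)]
  have *: "z \<otimes> y \<otimes> x = x \<otimes> (z \<otimes> y)" if "x \<in> carrier A" "h \<otimes> x = x \<otimes> h" for x
  proof -
    have zx: "z \<otimes> x = x \<otimes> z" and yx: "y \<otimes> x = x \<otimes> y" using assms that unfolding bic_def by blast+
    have "z \<otimes> y \<otimes> x = z \<otimes> (x \<otimes> y)" using m_assoc[OF cl(1,3) that(1)] yx by simp
    also have "\<dots> = x \<otimes> (z \<otimes> y)" by (rule comm_left[OF zx cl(1) that(1) cl(3)])
    finally show ?thesis .
  qed
  have "star A (z \<otimes> y) = z \<otimes> y" using cl bic_comm[OF assms] by simp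
  then show ?thesis unfolding bic_def using cl * by (intro conjI ballI impI) simp_all
qed

lemma bic_root:
  assumes "bic h z" "pos z" obtains r where "pos r" "bic h r" "r \<otimes> r = z"
proof -
  obtain r where r: "pos r" "r \<otimes> r = z" "\<forall>y\<in>carrier A. z \<otimes> y = y \<otimes> z \<longrightarrow> r \<otimes> y = y \<otimes> r"
    using pos_root[OF assms(2)] by (elim bexE exE conjE) (rule that, assumption+)
  have "bic h r" unfolding bic_def using r pos_sa[OF r(1)] pos_closed[OF r(1)] assms(1)[unfolded bic_def] by blast
  then show ?thesis using that r(1,2) by blast
qed

lemma bic_abs:
  assumes "h \<in> carrier A" "bic h z" obtains w where "pos w" "bic h w" "w \<otimes> w = z \<otimes> z"
  using bic_root[OF bic_mult[OF assms(1,2,2)]] posI[of z] bic_closed[OF assms(2)] by metis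

lemma bic_square_mult:
  assumes "h \<in> carrier A" "bic h z" "bic h y" shows "(z \<otimes> y) \<otimes> (z \<otimes> y) = (z \<otimes> z) \<otimes> (y \<otimes> y)"
  using assms comm_left[OF bic_comm[OF assms(1,3,2)], of y] by (simp add: bic_closed m_assoc)

text \<open>For \<open>d = x - y\<close> the product \<open>d (x + y)\<close> is 0. With roots \<open>a\<close> of \<open>x\<close> and \<open>b\<close> of \<open>y\<close> this makes
  \<open>(d a)\<^sup>2 + (d b)\<^sup>2 = d (d (x + y))\<close> vanish, hence both summands, hence \<open>d\<^sup>2\<close>.\<close>

lemma bic_pos_unique:
  assumes h: "h \<in> carrier A" and x: "bic h x" "pos x" and y: "bic h y" "pos y" and eq: "x \<otimes> x = y \<otimes> y"
  shows "x = y"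
proof -
  obtain a where a: "bic h a" "a \<otimes> a = x" using bic_root[OF x] by blast
  obtain b where b: "bic h b" "b \<otimes> b = y" using bic_root[OF y] by blast
  define d where "d = x \<ominus> y"
  have d: "bic h d" using x y by (simp add: d_def bic_diff)
  note cl = bic_closed(1)[OF x(1)] bic_closed(1)[OF y(1)] bic_closed(1)[OF a(1)] bic_closed(1)[OF b(1)] bic_closed(1)[OF d]
  have dx: "d \<otimes> (x \<oplus> y) = \<zero>"
    using cl eq bic_comm[OF h x(1) y(1)] by (simp add: d_def ring_normalize)
  define p q where "p = d \<otimes> a" and "q = d \<otimes> b"
  have p: "bic h p" and q: "bic h q" using a b d h by (simp_all add: p_def q_def bic_mult)
  have "p \<otimes> p \<oplus> q \<otimes> q = d \<otimes> (d \<otimes> (x \<oplus> y))"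
    using cl unfolding p_def q_def bic_square_mult[OF h d a(1)] bic_square_mult[OF h d b(1)] a b by (simp add: ring_normalize)
  then have "p \<otimes> p \<oplus> q \<otimes> q = complex_of_real 0 \<odot> \<one>" using dx cl by simp
  moreover have "q \<otimes> q \<oplus> p \<otimes> p = p \<otimes> p \<oplus> q \<otimes> q" using bic_closed(1)[OF p] bic_closed(1)[OF q] by (simp add: a_comm)
  ultimately have "(cnorm A p)\<^sup>2 \<le> 0" "(cnorm A q)\<^sup>2 \<le> 0"
    using sum_squares_norm[of p q 0] sum_squares_norm[of q p 0] bic_comm[OF h p q] bic_closed[OF p] bic_closed[OF q] by simp_all
  then have "p = \<zero>" "q = \<zero>" using cnorm_eq_0 bic_closed[OF p] bic_closed[OF q] by auto
  have "d \<otimes> x = p \<otimes> a" "d \<otimes> y = q \<otimes> b" unfolding p_def q_def a(2)[symmetric] b(2)[symmetric] using cl by (simp_all add: m_assoc)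
  then have "d \<otimes> x = \<zero>" "d \<otimes> y = \<zero>" using \<open>p = \<zero>\<close> \<open>q = \<zero>\<close> cl by simp_all
  then have "d \<otimes> d = \<zero>" using cl by (subst (2) d_def) (simp add: mult_diff)
  then have "d = \<zero>" using sq_eq_zero bic_closed[OF d] by blast
  then show ?thesis using diff_eq_zero cl unfolding d_def by blast
qed

lemma bic_square_zero: "h \<in> carrier A \<Longrightarrow> bic h z \<Longrightarrow> z \<otimes> z = \<zero> \<Longrightarrow> z = \<zero>"
  using sq_eq_zero bic_closed by blast

text \<open>Here \<open>w = \<bar>h\<bar>\<close>, and \<open>v = \<bar>h\<bar> - h\<close> is twice the negative part of \<open>h\<close>. Put \<open>u = \<bar>h\<bar> + h\<close>, so that \<open>u v = 0\<close>. Then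
  \<open>\<bar>u\<bar> + \<bar>v\<bar>\<close> and \<open>u + v = 2 \<bar>h\<bar>\<close> are positive roots of the same element and agree by \<open>bic_pos_unique\<close>; multiplying by \<open>v\<close>
  gives \<open>\<bar>v\<bar> v = v\<^sup>2\<close>, and therefore \<open>\<bar>v\<bar> = v\<close>.\<close>

lemma negative_part:
  assumes h: "h \<in> carrier A" "star A h = h"
  obtains w v where "pos w" "pos v" "bic h w" "bic h v" "v = w \<ominus> h" "(w \<oplus> h) \<otimes> v = \<zero>"
proof -
  have hh: "bic h h" by (rule bic_self[OF h])
  obtain w where w: "pos w" "bic h w" "w \<otimes> w = h \<otimes> h" using bic_abs[OF h(1) hh] by blast
  define u v where "u = w \<oplus> h" and "v = w \<ominus> h"
  have u: "bic h u" and v: "bic h v" using w hh by (simp_all add: u_def v_def bic_add bic_diff)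
  obtain r where r: "pos r" "bic h r" "r \<otimes> r = u \<otimes> u" using bic_abs[OF h(1) u] by blast
  obtain s where s: "pos s" "bic h s" "s \<otimes> s = v \<otimes> v" using bic_abs[OF h(1) v] by blast
  note cl = bic_closed(1)[OF hh] bic_closed(1)[OF w(2)] bic_closed(1)[OF u] bic_closed(1)[OF v] bic_closed(1)[OF r(2)] bic_closed(1)[OF s(2)]
  have uv: "u \<otimes> v = \<zero>"
    using cl w(3) bic_comm[OF h(1) w(2) hh] by (simp add: u_def v_def ring_normalize)
  then have vu: "v \<otimes> u = \<zero>" using bic_comm[OF h(1) u v] by simp
  have uuvv: "(u \<otimes> u) \<otimes> (v \<otimes> v) = \<zero>"
    using cl uv m_assoc[of u v v, symmetric] by (simp add: m_assoc)
  have rs: "r \<otimes> s = \<zero>"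
    by (rule bic_square_zero[OF h(1) bic_mult[OF h(1) r(2) s(2)]])
       (simp add: bic_square_mult[OF h(1) r(2) s(2)] r s uuvv)
  have rv: "r \<otimes> v = \<zero>"
    by (rule bic_square_zero[OF h(1) bic_mult[OF h(1) r(2) v]])
       (simp add: bic_square_mult[OF h(1) r(2) v] r uuvv)
  have sr: "s \<otimes> r = \<zero>" using bic_comm[OF h(1) r(2) s(2)] rs by simp
  have "(r \<oplus> s) \<otimes> (r \<oplus> s) = (u \<oplus> v) \<otimes> (u \<oplus> v)"
    using cl rs sr uv vu r(3) s(3) by (simp add: l_distr r_distr)
  moreover have "u \<oplus> v = complex_of_real 2 \<odot> w"
    using cl by (simp add: u_def v_def smult_2 ring_normalize)
  then have "pos (u \<oplus> v)" using pos_smult[OF w(1), of 2] by simp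
  ultimately have sum: "r \<oplus> s = u \<oplus> v"
    using bic_pos_unique[OF h(1) bic_add[OF r(2) s(2)] pos_add[OF r(1) s(1)] bic_add[OF u v]] by blast
  have "(r \<oplus> s) \<otimes> v = (u \<oplus> v) \<otimes> v" by (simp add: sum)
  then have sv: "s \<otimes> v = v \<otimes> v" using cl rv uv by (simp add: l_distr)
  have vs: "v \<otimes> s = v \<otimes> v" using bic_comm[OF h(1) s(2) v] sv by simp
  have "(s \<ominus> v) \<otimes> (s \<ominus> v) = \<zero>"
    using cl sv vs s(3) by (simp add: mult_diff)
  then have "s \<ominus> v = \<zero>" by (rule bic_square_zero[OF h(1) bic_diff[OF s(2) v]])
  then have "s = v" using diff_eq_zero cl by blast
  then show ?thesis using that[OF w(1) _ w(2) v v_def] s(1) uv by (simp add: u_def)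
qed

end

section \<open>Positivity of x* x\<close>

context cstar_algebra
begin

definition re_part :: "'a \<Rightarrow> 'a" where "re_part x = (1/2) \<odot> (x \<oplus> star A x)"
definition im_part :: "'a \<Rightarrow> 'a" where "im_part x = (- \<i>/2) \<odot> (x \<ominus> star A x)"

lemma re_im_parts:
  assumes x: "x \<in> carrier A"
  shows "re_part x \<in> carrier A" "star A (re_part x) = re_part x"
    "im_part x \<in> carrier A" "star A (im_part x) = im_part x"
    "x = re_part x \<oplus> \<i> \<odot> im_part x"
proof -
  show cl: "re_part x \<in> carrier A" "im_part x \<in> carrier A" using x by (simp_all add: re_part_def im_part_def)
  show "star A (re_part x) = re_part x" using x by (simp add: re_part_def a_comm)
  have "x \<ominus> star A x = \<ominus> (star A x \<ominus> x)" using x by (simp add: a_minus_def minus_add minus_minus a_comm)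
  then show "star A (im_part x) = im_part x" using x
    by (simp add: im_part_def smult_uminus smult_minus_left minus_minus)
  have "2 \<odot> (re_part x \<oplus> \<i> \<odot> im_part x) = (x \<oplus> star A x) \<oplus> (x \<ominus> star A x)"
    using x unfolding re_part_def im_part_def by (simp add: smult_smult smult_add_right[of "(1/2) \<odot> (x \<oplus> star A x)"])
  also have "\<dots> = 2 \<odot> x" using x by (simp add: smult_2 ring_normalize)
  finally have "2 \<odot> (re_part x \<oplus> \<i> \<odot> im_part x) = 2 \<odot> x" .
  then show "x = re_part x \<oplus> \<i> \<odot> im_part x"
    by (intro smult_cancel[of 2 x]) (use cl x in simp_all)
qed

lemma star_mult_add_mult_star:
  assumes x: "x \<in> carrier A"
  shows "star A x \<otimes> x \<oplus> x \<otimes> star A x =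
    2 \<odot> (re_part x \<otimes> re_part x) \<oplus> 2 \<odot> (im_part x \<otimes> im_part x)"
proof -
  define a b where "a = re_part x" and "b = im_part x"
  note ab = re_im_parts(1-4)[OF x, folded a_def b_def]
  have xx: "x = a \<oplus> \<i> \<odot> b" using re_im_parts(5)[OF x] by (simp add: a_def b_def)
  have sx: "star A x = a \<ominus> \<i> \<odot> b" unfolding xx using ab by (simp add: smult_minus_left a_minus_def)
  show ?thesis unfolding a_def[symmetric] b_def[symmetric] sx unfolding xx using ab
    by (simp add: smult_2 calg smult_minus_left uminus_diff)
qed

text \<open>Put \<open>P = y y\<^sup>*\<close> and \<open>N = - y\<^sup>* y\<close>. Both are positive, \<open>P\<close> because \<open>P - N\<close> is a sum of squares. The element
  \<open>y (1 - N) = (1 + P) y\<close> has norm at most 1, while its product with its adjoint is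
  \<open>P (1 + P)\<^sup>2 = P + 2 P\<^sup>2 + P\<^sup>3\<close>. This forces \<open>1 - 2 P\<^sup>2\<close> to be positive, although \<open>P\<close> has norm 1.\<close>

lemma negative_star_mult_unit:
  assumes y: "y \<in> carrier A" "cnorm A y = 1" and neg: "pos (\<ominus> (star A y \<otimes> y))"
  shows False
proof -
  define P where "P = y \<otimes> star A y"
  define N where "N = \<ominus> (star A y \<otimes> y)"
  have cl: "P \<in> carrier A" "N \<in> carrier A" using y by (simp_all add: P_def N_def)
  have yy: "star A y \<otimes> y = \<ominus> N" using y by (simp add: N_def minus_minus)
  have nP: "cnorm A P = 1" using cnorm_cstar[of "star A y"] y by (simp add: P_def)
  have nN: "cnorm A N = 1" using cnorm_cstar[of y] y by (simp add: N_def)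
  define a b where "a = re_part y" and "b = im_part y"
  note ab = re_im_parts(1-4)[OF y(1), folded a_def b_def]
  have "\<ominus> N \<oplus> P = 2 \<odot> (a \<otimes> a) \<oplus> 2 \<odot> (b \<otimes> b)"
    using star_mult_add_mult_star[OF y(1)] unfolding yy P_def a_def b_def .
  then have "P \<ominus> N = 2 \<odot> (a \<otimes> a) \<oplus> 2 \<odot> (b \<otimes> b)"
    using cl by (simp add: a_minus_def a_comm)
  then have "P = (2 \<odot> (a \<otimes> a) \<oplus> 2 \<odot> (b \<otimes> b)) \<oplus> N"
    using diff_eq_eq(1)[of P N] cl ab by simp
  moreover have "pos (2 \<odot> (a \<otimes> a))" "pos (2 \<odot> (b \<otimes> b))"
    using pos_smult[OF posI[OF ab(1,2)], of 2] pos_smult[OF posI[OF ab(3,4)], of 2] by simp_all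
  ultimately have "pos P" using neg pos_add by (simp add: N_def)
  then obtain d where d: "d \<in> carrier A" "star A d = d" "P = d \<otimes> d" by (auto simp: pos_def)
  obtain c where c: "c \<in> carrier A" "star A c = c" "N = c \<otimes> c" using neg by (auto simp: pos_def N_def)
  have "(cnorm A c)\<^sup>2 = 1" using cnorm_sq[OF c(1,2)] nN c(3) by simp
  then have "cnorm A (\<one> \<ominus> N) \<le> 1"
    using one_minus_square_norm[OF c(1,2)] c(3) unfolding power2_eq_1_iff by auto
  \<comment> \<open>The norm of \<open>z\<close> is bounded through \<open>y (1 - N)\<close> and evaluated through \<open>z z\<^sup>* = m\<^sup>2\<close>.\<close>
  define z where "z = (\<one> \<oplus> P) \<otimes> y"
  have z: "z \<in> carrier A" using cl y by (simp add: z_def)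
  have "y \<otimes> (\<one> \<ominus> N) = y \<oplus> y \<otimes> (star A y \<otimes> y)" unfolding yy using cl y by (simp add: a_minus_def r_distr)
  also have "\<dots> = z" using y by (simp add: z_def P_def l_distr m_assoc)
  finally have "z = y \<otimes> (\<one> \<ominus> N)" by simp
  then have "cnorm A z \<le> 1"
    using cnorm_mult[of y "\<one> \<ominus> N"] y cl \<open>cnorm A (\<one> \<ominus> N) \<le> 1\<close> by simp
  define m where "m = d \<oplus> d \<otimes> P"
  have m: "m \<in> carrier A" "star A m = m" using d by (simp_all add: m_def m_assoc)
  have mm: "m \<otimes> m = P \<oplus> (2 \<odot> (P \<otimes> P) \<oplus> P \<otimes> P \<otimes> P)"
    unfolding m_def d(3) using d(1) by (simp add: smult_2 ring_normalize)
  have sP: "star A P = P" using y by (simp add: P_def)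
  have "z \<otimes> star A z = (\<one> \<oplus> P) \<otimes> (y \<otimes> star A y) \<otimes> (\<one> \<oplus> P)"
    unfolding z_def using y cl sP by (simp add: m_assoc)
  also have "\<dots> = m \<otimes> m" unfolding mm P_def[symmetric] using cl by (simp add: smult_2 ring_normalize)
  finally have "(cnorm A z)\<^sup>2 = (cnorm A m)\<^sup>2"
    using cnorm_cstar[of "star A z"] z cnorm_sq[OF m] by simp
  then have "cnorm A z = cnorm A m" using z m by simp
  then have "cnorm A m \<le> 1" using \<open>cnorm A z \<le> 1\<close> by simp
  then have m1: "cnorm A (m \<otimes> m) \<le> 1" using cnorm_sq[OF m] m by (simp add: power_le_one)
  have m2: "m \<otimes> m \<in> carrier A" "star A (m \<otimes> m) = m \<otimes> m" using m by simp_all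
  obtain k where k: "k \<in> carrier A" "star A k = k" "k \<otimes> k = \<one> \<ominus> m \<otimes> m"
    using root_one_minus[OF m2 m1] by (elim bexE conjE) (rule that, assumption+)
  \<comment> \<open>Adding the positive element \<open>P + P\<^sup>3\<close> to \<open>1 - m\<^sup>2\<close> leaves \<open>1 - 2 P\<^sup>2\<close>.\<close>
  have "pos (P \<otimes> P \<otimes> P)" using posI[of "d \<otimes> (d \<otimes> d)"] d by (simp add: m_assoc)
  then have "pos ((\<one> \<ominus> m \<otimes> m) \<oplus> (P \<oplus> P \<otimes> P \<otimes> P))"
    using posI[OF k(1,2)] k(3) \<open>pos P\<close> pos_add by simp
  also have "(\<one> \<ominus> m \<otimes> m) \<oplus> (P \<oplus> P \<otimes> P \<otimes> P) = \<one> \<ominus> 2 \<odot> (P \<otimes> P)"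
    unfolding mm using cl by (simp add: ring_normalize)
  finally have p1: "pos (\<one> \<ominus> 2 \<odot> (P \<otimes> P))" .
  define Q where "Q = complex_of_real (sqrt 2) \<odot> P"
  have Q: "Q \<in> carrier A" "star A Q = Q" using cl sP by (simp_all add: Q_def)
  have QQ: "Q \<otimes> Q = 2 \<odot> (P \<otimes> P)"
    using cl by (simp add: Q_def smult_mult_left smult_mult_right smult_smult flip: of_real_mult)
  obtain r where r: "pos r" "r \<otimes> r = \<one> \<ominus> Q \<otimes> Q"
    and comm: "\<forall>x\<in>carrier A. (\<one> \<ominus> Q \<otimes> Q) \<otimes> x = x \<otimes> (\<one> \<ominus> Q \<otimes> Q) \<longrightarrow> r \<otimes> x = x \<otimes> r"
    using pos_root[OF p1[folded QQ]] by (elim bexE exE conjE) (rule that, assumption+)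
  have "(\<one> \<ominus> Q \<otimes> Q) \<otimes> Q = Q \<otimes> (\<one> \<ominus> Q \<otimes> Q)" using Q(1) by (simp add: mult_diff m_assoc)
  then have "Q \<otimes> r = r \<otimes> Q" using comm Q(1) by simp
  moreover have "Q \<otimes> Q \<oplus> r \<otimes> r = complex_of_real 1 \<odot> \<one>" unfolding r(2) using Q(1) by (simp add: ring_normalize)
  ultimately have "(cnorm A Q)\<^sup>2 \<le> 1" using sum_squares_norm[of Q r 1] Q r(1) pos_sa[OF r(1)] by simp
  then show False using cnorm_smult[OF cl(1), of "complex_of_real (sqrt 2)"] nP by (simp add: Q_def)
qed

lemma negative_star_mult:
  assumes y: "y \<in> carrier A" and neg: "pos (\<ominus> (star A y \<otimes> y))"
  shows "y = \<zero>"
proof (rule ccontr)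
  assume "y \<noteq> \<zero>"
  define t where "t = cnorm A y"
  have t: "0 < t" using \<open>y \<noteq> \<zero>\<close> cnorm_nonneg[OF y] cnorm_eq_0[OF y] by (simp add: t_def)
  define y' where "y' = complex_of_real (1/t) \<odot> y"
  have y': "y' \<in> carrier A" "cnorm A y' = 1" using y t by (auto simp: y'_def cnorm_smult norm_divide t_def)
  have "\<ominus> (star A y' \<otimes> y') = complex_of_real (1/t * (1/t)) \<odot> (\<ominus> (star A y \<otimes> y))"
    using y by (simp add: y'_def smult_mult_left smult_mult_right smult_smult smult_uminus)
  then have "pos (\<ominus> (star A y' \<otimes> y'))" using pos_smult[OF neg, of "1/t * (1/t)"] t by simp
  then show False using negative_star_mult_unit[OF y'] by blast
qed

text \<open>Kaplansky's theorem. For \<open>h = x\<^sup>* x\<close> and \<open>v = \<bar>h\<bar> - h\<close> the element \<open>y = x v\<close> satisfies \<open>2 y\<^sup>* y = 2 v h v = - v\<^sup>3\<close>, so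
  \<open>y = 0\<close> by \<open>negative_star_mult\<close>. Hence \<open>v = 0\<close>, and \<open>h\<close> is its own absolute value.\<close>

lemma pos_star_mult:
  assumes x: "x \<in> carrier A" shows "pos (star A x \<otimes> x)"
proof -
  define h where "h = star A x \<otimes> x"
  have h: "h \<in> carrier A" "star A h = h" using x by (simp_all add: h_def)
  obtain w v where w: "pos w" "bic h w" and v: "pos v" "bic h v" "v = w \<ominus> h" "(w \<oplus> h) \<otimes> v = \<zero>"
    using negative_part[OF h] .
  obtain r where r: "pos r" "bic h r" "r \<otimes> r = v" using bic_root[OF v(2,1)] .
  note cl = h(1) bic_closed(1)[OF w(2)] bic_closed(1)[OF v(2)] bic_closed(1)[OF r(2)]
  have vvv: "v \<otimes> v \<otimes> v = (v \<otimes> r) \<otimes> (v \<otimes> r)"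
    using bic_square_mult[OF h(1) v(2) r(2)] r(3) by simp
  have "bic h (v \<otimes> r)" by (rule bic_mult[OF h(1) v(2) r(2)])
  then have "pos (v \<otimes> v \<otimes> v)" unfolding vvv using posI bic_closed by blast
  define y where "y = x \<otimes> v"
  have y: "y \<in> carrier A" using x cl by (simp add: y_def)
  have yy: "star A y \<otimes> y = v \<otimes> (h \<otimes> v)"
    using x cl bic_closed(2)[OF v(2)] by (simp add: y_def h_def m_assoc)
  have "h \<otimes> v \<oplus> h \<otimes> v = (w \<oplus> h) \<otimes> v \<ominus> v \<otimes> v"
    using cl by (subst (4) v(3)) (simp add: ring_normalize)
  then have "h \<otimes> v \<oplus> h \<otimes> v = \<ominus> (v \<otimes> v)" using v(4) cl by (simp add: a_minus_def)
  then have "v \<otimes> (h \<otimes> v \<oplus> h \<otimes> v) = \<ominus> (v \<otimes> v \<otimes> v)" using cl by (simp add: r_minus m_assoc)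
  then have "2 \<odot> (star A y \<otimes> y) = \<ominus> (v \<otimes> v \<otimes> v)" unfolding yy using cl by (simp add: smult_2 r_distr)
  then have vy: "v \<otimes> v \<otimes> v = 2 \<odot> (\<ominus> (star A y \<otimes> y))" using cl y by (simp add: smult_uminus minus_minus)
  then have "\<ominus> (star A y \<otimes> y) = complex_of_real (1/2) \<odot> (v \<otimes> v \<otimes> v)" using y by (simp add: smult_smult)
  then have "pos (\<ominus> (star A y \<otimes> y))" using pos_smult[OF \<open>pos (v \<otimes> v \<otimes> v)\<close>, of "1/2"] by simp
  then have "y = \<zero>" using negative_star_mult[OF y] by blast
  then have "v \<otimes> v \<otimes> v = \<zero>" using vy by simp
  then have "(v \<otimes> v) \<otimes> (v \<otimes> v) = \<zero>" using cl m_assoc[of "v \<otimes> v" v v] by simp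
  then have "v \<otimes> v = \<zero>" by (rule bic_square_zero[OF h(1) bic_mult[OF h(1) v(2) v(2)]])
  then have "v = \<zero>" by (rule bic_square_zero[OF h(1) v(2)])
  then have "w = h" using v(3) diff_eq_zero cl by simp
  then show ?thesis using w(1) by (simp add: h_def)
qed

text \<open>The form in which the order controls the norm: from \<open>0 \<le> y\<^sup>* y \<le> c\<close> one gets the bound \<open>c\<close> for the square of the
  norm, by \<open>sum_squares_norm\<close> applied to the roots of \<open>y\<^sup>* y\<close> and of the difference \<open>k\<close>.\<close>

lemma norm_le_of_sum_star_mult:
  assumes y: "y \<in> carrier A" and k: "pos k" and sum: "star A y \<otimes> y \<oplus> k = complex_of_real c \<odot> \<one>" and c: "0 \<le> c"
  shows "(cnorm A y)\<^sup>2 \<le> c"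
proof -
  define h where "h = star A y \<otimes> y"
  have h: "h \<in> carrier A" "star A h = h" and ph: "pos h" using y pos_star_mult by (simp_all add: h_def)
  have kk: "k = complex_of_real c \<odot> \<one> \<ominus> h" using sum[folded h_def] h(1) k by (simp add: diff_eq_eq a_comm)
  have bk: "bic h k" unfolding kk
    by (rule bic_diff[OF _ bic_self[OF h]]) (simp add: bic_def smult_mult_left smult_mult_right)
  obtain r where r: "pos r" "bic h r" "r \<otimes> r = h" using bic_root[OF bic_self[OF h] ph] .
  obtain s where s: "pos s" "bic h s" "s \<otimes> s = k" using bic_root[OF bk k] .
  have "(cnorm A r)\<^sup>2 \<le> c"
    using sum_squares_norm[OF bic_closed[OF r(2)] bic_closed[OF s(2)] bic_comm[OF h(1) r(2) s(2)]] r(3) s(3) sum c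
    by (simp add: h_def)
  moreover have "(cnorm A r)\<^sup>2 = cnorm A h" using cnorm_sq[OF bic_closed[OF r(2)]] r(3) by simp
  ultimately show ?thesis using cnorm_cstar[OF y] by (simp add: h_def)
qed

end

section \<open>Completely positive maps and *-homomorphisms\<close>

context cstar_algebra
begin

text \<open>Positive roots \<open>x\<close> and \<open>y\<close> need not a priori commute with each other. Both commute with the root \<open>r\<close> supplied by
  \<open>pos_root\<close>, which commutes with everything that commutes with \<open>x\<^sup>2\<close>, so each equals \<open>r\<close> by \<open>bic_pos_unique\<close>.\<close>

lemma pos_root_unique:
  assumes x: "pos x" and y: "pos y" and eq: "x \<otimes> x = y \<otimes> y" shows "x = y"
proof -
  note cl = pos_closed[OF x] pos_closed[OF y]
  have "pos (x \<otimes> x)" by (rule posI[OF cl(1) pos_sa[OF x]])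
  then obtain r where r: "pos r" "r \<otimes> r = x \<otimes> x"
    and comm: "\<forall>z\<in>carrier A. (x \<otimes> x) \<otimes> z = z \<otimes> (x \<otimes> x) \<longrightarrow> r \<otimes> z = z \<otimes> r"
    using pos_root by blast
  have "u = r" if u: "pos u" "u \<otimes> u = x \<otimes> x" for u
  proof (rule bic_pos_unique[of u])
    note ucl = pos_closed[OF u(1)]
    show "u \<in> carrier A" by (rule ucl)
    show "bic u u" by (rule bic_self[OF ucl pos_sa[OF u(1)]])
    show "u \<otimes> u = r \<otimes> r" using u(2) r(2) by simp
    have "r \<otimes> z = z \<otimes> r" if z: "z \<in> carrier A" "u \<otimes> z = z \<otimes> u" for z
    proof -
      have "(u \<otimes> u) \<otimes> z = u \<otimes> (z \<otimes> u)" using m_assoc[OF ucl ucl z(1)] z(2) by simp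
      also have "\<dots> = z \<otimes> (u \<otimes> u)" by (rule comm_left[OF z(2) ucl z(1) ucl])
      finally show ?thesis using comm z(1) u(2) by simp
    qed
    then show "bic u r" unfolding bic_def using pos_closed[OF r(1)] pos_sa[OF r(1)] by blast
  qed (use u r in auto)
  from this[OF x] this[OF y] eq show ?thesis by simp
qed

lemma norm_scale_unit:
  assumes x: "x \<in> carrier A" "x \<noteq> \<zero>"
  obtains t y where "0 < t" "y \<in> carrier A" "cnorm A y = 1" "x = complex_of_real t \<odot> y" "t = cnorm A x"
    "y = complex_of_real (1/t) \<odot> x"
proof -
  have t: "0 < cnorm A x" using cnorm_nonneg[OF x(1)] cnorm_eq_0[OF x(1)] x(2) by simp
  show ?thesis
    by (rule that[OF t, of "complex_of_real (1 / cnorm A x) \<odot> x"])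
       (use t x in \<open>simp_all add: cnorm_smult norm_divide smult_smult\<close>)
qed

lemma finsum_lessThan_1: "f 0 \<in> carrier A \<Longrightarrow> finsum A f {..<1::nat} = f 0"
  using finsum_insert[of "{}" "0::nat" f] by (simp add: lessThan_Suc finsum_empty)

text \<open>Bounds and the positivity of functionals exploit complete positivity through \<open>1 \<times> 1\<close> matrices.\<close>

lemma matrix_pos_1: "matrix_pos A 1 X \<longleftrightarrow> (\<exists>y\<in>carrier A. X 0 0 = star A y \<otimes> y)"
proof
  assume "matrix_pos A 1 X"
  then obtain Y where Y: "Y 0 0 \<in> carrier A" "X 0 0 = (\<Oplus>k\<in>{..<1::nat}. star A (Y k 0) \<otimes> Y k 0)"
    unfolding matrix_pos_def by auto
  then have "X 0 0 = star A (Y 0 0) \<otimes> Y 0 0"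
    using finsum_lessThan_1[of "\<lambda>k. star A (Y k 0) \<otimes> Y k 0"] by simp
  then show "\<exists>y\<in>carrier A. X 0 0 = star A y \<otimes> y" using Y(1) by blast
next
  assume "\<exists>y\<in>carrier A. X 0 0 = star A y \<otimes> y"
  then obtain y where y: "y \<in> carrier A" "X 0 0 = star A y \<otimes> y" by blast
  then have "X 0 0 = (\<Oplus>k\<in>{..<1::nat}. star A y \<otimes> y)"
    using finsum_lessThan_1[of "\<lambda>k. star A y \<otimes> y"] by simp
  then show "matrix_pos A 1 X" unfolding matrix_pos_def using y(1) by (intro exI[of _ "\<lambda>_ _. y"]) auto
qed

end

lemma cp_on_star_mult:
  assumes "cstar_algebra A" "cstar_algebra B" "cp_on A E B f" "x \<in> carrier A" "star A x \<otimes>\<^bsub>A\<^esub> x \<in> E"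
  shows "\<exists>z\<in>carrier B. f (star A x \<otimes>\<^bsub>A\<^esub> x) = star B z \<otimes>\<^bsub>B\<^esub> z"
proof -
  have "matrix_pos A 1 (\<lambda>i j. star A x \<otimes>\<^bsub>A\<^esub> x)" using cstar_algebra.matrix_pos_1[OF assms(1)] assms(4) by blast
  then have "matrix_pos B 1 (\<lambda>i j. f (star A x \<otimes>\<^bsub>A\<^esub> x))"
    using assms(3)[unfolded cp_on_def, THEN conjunct2, rule_format, of 1 "\<lambda>i j. star A x \<otimes>\<^bsub>A\<^esub> x"] assms(5) by blast
  then show ?thesis unfolding cstar_algebra.matrix_pos_1[OF assms(2)] .
qed

locale cp_map = A: cstar_algebra A + B: cstar_algebra B for A (structure) and B (structure) +
  fixes f assumes cp: "cp_on A (carrier A) B f"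
begin

lemma lin: "x \<in> carrier A \<Longrightarrow> f x \<in> carrier B"
  "x \<in> carrier A \<Longrightarrow> y \<in> carrier A \<Longrightarrow> f (x \<oplus>\<^bsub>A\<^esub> y) = f x \<oplus>\<^bsub>B\<^esub> f y"
  "x \<in> carrier A \<Longrightarrow> f (c \<odot>\<^bsub>A\<^esub> x) = c \<odot>\<^bsub>B\<^esub> f x"
  using cp unfolding cp_on_def clinear_on_def by auto

lemma lin_diff: "x \<in> carrier A \<Longrightarrow> y \<in> carrier A \<Longrightarrow> f (x \<ominus>\<^bsub>A\<^esub> y) = f x \<ominus>\<^bsub>B\<^esub> f y"
  by (simp add: A.diff_smult B.diff_smult lin)

lemma star_mult_image:
  "x \<in> carrier A \<Longrightarrow> \<exists>z\<in>carrier B. f (star A x \<otimes>\<^bsub>A\<^esub> x) = star B z \<otimes>\<^bsub>B\<^esub> z"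
  using cp_on_star_mult[OF A.cstar_algebra_axioms B.cstar_algebra_axioms cp] by simp

lemma sa:
  assumes x: "x \<in> carrier A" "star A x = x" shows "star B (f x) = f x"
proof -
  let ?p = "x \<oplus>\<^bsub>A\<^esub> \<one>\<^bsub>A\<^esub>" and ?q = "x \<ominus>\<^bsub>A\<^esub> \<one>\<^bsub>A\<^esub>"
  have p: "star A ?p = ?p" "star A ?q = ?q" using x by simp_all
  have sa: "star B (f (y \<otimes>\<^bsub>A\<^esub> y)) = f (y \<otimes>\<^bsub>A\<^esub> y)" if "y \<in> carrier A" "star A y = y" for y
    using star_mult_image[OF that(1)] that(2) by auto
  \<comment> \<open>Every self-adjoint element is a difference of squares: \<open>4 x = (x + 1)\<^sup>2 - (x - 1)\<^sup>2\<close>.\<close>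
  have "?p \<otimes>\<^bsub>A\<^esub> ?p \<ominus>\<^bsub>A\<^esub> ?q \<otimes>\<^bsub>A\<^esub> ?q = (x \<oplus>\<^bsub>A\<^esub> x) \<oplus>\<^bsub>A\<^esub> (x \<oplus>\<^bsub>A\<^esub> x)"
    using x(1) by (simp add: A.ring_normalize)
  also have "\<dots> = 4 \<odot>\<^bsub>A\<^esub> x" using x(1) A.smult_add_left[of x 2 2] by (simp add: A.smult_2)
  finally have "f (?p \<otimes>\<^bsub>A\<^esub> ?p \<ominus>\<^bsub>A\<^esub> ?q \<otimes>\<^bsub>A\<^esub> ?q) = f (4 \<odot>\<^bsub>A\<^esub> x)" by (rule arg_cong)
  moreover have "f (?p \<otimes>\<^bsub>A\<^esub> ?p \<ominus>\<^bsub>A\<^esub> ?q \<otimes>\<^bsub>A\<^esub> ?q) = f (?p \<otimes>\<^bsub>A\<^esub> ?p) \<ominus>\<^bsub>B\<^esub> f (?q \<otimes>\<^bsub>A\<^esub> ?q)"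
    using x(1) by (intro lin_diff) simp_all
  ultimately have "4 \<odot>\<^bsub>B\<^esub> f x = f (?p \<otimes>\<^bsub>A\<^esub> ?p) \<ominus>\<^bsub>B\<^esub> f (?q \<otimes>\<^bsub>A\<^esub> ?q)"
    using x(1) by (simp only: lin(3))
  then have "star B (4 \<odot>\<^bsub>B\<^esub> f x) = 4 \<odot>\<^bsub>B\<^esub> f x"
    using sa[OF _ p(1)] sa[OF _ p(2)] x(1) lin(1) by simp
  then have "4 \<odot>\<^bsub>B\<^esub> star B (f x) = 4 \<odot>\<^bsub>B\<^esub> f x" using x(1) lin(1) by simp
  then show ?thesis using B.smult_cancel[of 4] x(1) lin(1) by simp
qed

text \<open>Both \<open>1 + a\<close> and \<open>1 - a\<close> are squares, so their images are of the form \<open>y\<^sup>* y\<close> and \<open>z\<^sup>* z\<close> with sum 2. Hence \<open>y\<^sup>* y\<close> has norm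
  at most 2, and \<open>f a = y\<^sup>* y - 1\<close>.\<close>

lemma sa_bound:
  assumes unit: "f \<one>\<^bsub>A\<^esub> = \<one>\<^bsub>B\<^esub>" and a: "a \<in> carrier A" "star A a = a" "cnorm A a \<le> 1"
  shows "cnorm B (f a) \<le> 3"
proof -
  have na: "\<ominus>\<^bsub>A\<^esub> a \<in> carrier A" "star A (\<ominus>\<^bsub>A\<^esub> a) = \<ominus>\<^bsub>A\<^esub> a" "cnorm A (\<ominus>\<^bsub>A\<^esub> a) \<le> 1"
    using a by simp_all
  obtain r where r: "r \<in> carrier A" "star A r = r" "r \<otimes>\<^bsub>A\<^esub> r = \<one>\<^bsub>A\<^esub> \<ominus>\<^bsub>A\<^esub> a"
    using A.root_one_minus[OF a] by (elim bexE conjE) (rule that, assumption+)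
  obtain s where s: "s \<in> carrier A" "star A s = s" "s \<otimes>\<^bsub>A\<^esub> s = \<one>\<^bsub>A\<^esub> \<ominus>\<^bsub>A\<^esub> (\<ominus>\<^bsub>A\<^esub> a)"
    using A.root_one_minus[OF na] by (elim bexE conjE) (rule that, assumption+)
  have s3: "s \<otimes>\<^bsub>A\<^esub> s = \<one>\<^bsub>A\<^esub> \<oplus>\<^bsub>A\<^esub> a" unfolding s(3) using a(1) by (simp add: a_minus_def A.minus_minus)
  obtain y where y: "y \<in> carrier B" "f (\<one>\<^bsub>A\<^esub> \<oplus>\<^bsub>A\<^esub> a) = star B y \<otimes>\<^bsub>B\<^esub> y"
    using star_mult_image[OF s(1)] unfolding s(2) s3 by blast
  obtain z where z: "z \<in> carrier B" "f (\<one>\<^bsub>A\<^esub> \<ominus>\<^bsub>A\<^esub> a) = star B z \<otimes>\<^bsub>B\<^esub> z"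
    using star_mult_image[OF r(1)] unfolding r(2,3) by blast
  have fy: "star B y \<otimes>\<^bsub>B\<^esub> y = \<one>\<^bsub>B\<^esub> \<oplus>\<^bsub>B\<^esub> f a" using y(2) a(1) unit by (simp add: lin)
  have fz: "star B z \<otimes>\<^bsub>B\<^esub> z = \<one>\<^bsub>B\<^esub> \<ominus>\<^bsub>B\<^esub> f a" using z(2) a(1) unit by (simp add: lin_diff)
  have "star B y \<otimes>\<^bsub>B\<^esub> y \<oplus>\<^bsub>B\<^esub> star B z \<otimes>\<^bsub>B\<^esub> z = complex_of_real 2 \<odot>\<^bsub>B\<^esub> \<one>\<^bsub>B\<^esub>"
    unfolding fy fz using lin(1)[OF a(1)] by (simp add: B.smult_2 B.ring_normalize)
  then have "(cnorm B y)\<^sup>2 \<le> 2" by (rule B.norm_le_of_sum_star_mult[OF y(1) B.pos_star_mult[OF z(1)]]) simp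
  then have *: "cnorm B (star B y \<otimes>\<^bsub>B\<^esub> y) \<le> 2" using B.cnorm_cstar[OF y(1)] by simp
  have "f a = star B y \<otimes>\<^bsub>B\<^esub> y \<ominus>\<^bsub>B\<^esub> \<one>\<^bsub>B\<^esub>" unfolding fy using lin(1)[OF a(1)] by (simp add: B.ring_normalize)
  then have "cnorm B (f a) \<le> cnorm B (star B y \<otimes>\<^bsub>B\<^esub> y) + cnorm B \<one>\<^bsub>B\<^esub>"
    using B.cnorm_diff[of "star B y \<otimes>\<^bsub>B\<^esub> y" "\<one>\<^bsub>B\<^esub>"] y(1) by simp
  then show ?thesis using * B.cnorm_one_le by linarith
qed

text \<open>Real and imaginary parts are treated separately, which costs a factor 2 on top of \<open>sa_bound\<close>. The sharp constant
  is 1; any constant independent of \<open>f\<close> serves to transport a tolerance.\<close>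

lemma bound:
  assumes unit: "f \<one>\<^bsub>A\<^esub> = \<one>\<^bsub>B\<^esub>" and x: "x \<in> carrier A" shows "cnorm B (f x) \<le> 6 * cnorm A x"
proof (cases "x = \<zero>\<^bsub>A\<^esub>")
  case True
  have "f \<zero>\<^bsub>A\<^esub> = \<zero>\<^bsub>B\<^esub>" using lin(3)[of "\<zero>\<^bsub>A\<^esub>" 0] lin(1)[of "\<zero>\<^bsub>A\<^esub>"] by simp
  then show ?thesis using True by simp
next
  case False
  obtain t y where y: "0 < t" "y \<in> carrier A" "cnorm A y = 1" "x = complex_of_real t \<odot>\<^bsub>A\<^esub> y" "t = cnorm A x"
    by (rule A.norm_scale_unit[OF x False])
  note ab = A.re_im_parts[OF y(2)]
  have "cnorm A (A.re_part y) \<le> 1"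
    unfolding A.re_part_def using A.cnorm_add[of y "star A y"] y(2,3) by (simp add: A.cnorm_smult norm_divide)
  then have 1: "cnorm B (f (A.re_part y)) \<le> 3" by (rule sa_bound[OF unit ab(1,2)])
  have "cnorm A (A.im_part y) \<le> 1"
    unfolding A.im_part_def using A.cnorm_diff[of y "star A y"] y(2,3) by (simp add: A.cnorm_smult norm_divide)
  then have 2: "cnorm B (f (A.im_part y)) \<le> 3" by (rule sa_bound[OF unit ab(3,4)])
  have "f y = f (A.re_part y) \<oplus>\<^bsub>B\<^esub> \<i> \<odot>\<^bsub>B\<^esub> f (A.im_part y)"
    using arg_cong[OF ab(5), of f] ab(1,3) by (simp add: lin)
  then have "cnorm B (f y) \<le> 6"
    using B.cnorm_add[of "f (A.re_part y)" "\<i> \<odot>\<^bsub>B\<^esub> f (A.im_part y)"] 1 2 lin(1)[OF ab(1)] lin(1)[OF ab(3)]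
    by (simp add: B.cnorm_smult)
  then have "t * cnorm B (f y) \<le> t * 6" using y(1) by (intro mult_left_mono) auto
  then show ?thesis using y(1,2) unfolding y(5)[symmetric] unfolding y(4) by (simp add: lin B.cnorm_smult)
qed

end

locale star_hom = A: cstar_algebra A + B: cstar_algebra B for A (structure) and B (structure) +
  fixes f assumes hom: "unital_star_hom A B f"
begin

lemma hom_simps [simp]:
  "x \<in> carrier A \<Longrightarrow> f x \<in> carrier B"
  "x \<in> carrier A \<Longrightarrow> y \<in> carrier A \<Longrightarrow> f (x \<oplus>\<^bsub>A\<^esub> y) = f x \<oplus>\<^bsub>B\<^esub> f y"
  "x \<in> carrier A \<Longrightarrow> y \<in> carrier A \<Longrightarrow> f (x \<otimes>\<^bsub>A\<^esub> y) = f x \<otimes>\<^bsub>B\<^esub> f y"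
  "x \<in> carrier A \<Longrightarrow> f (c \<odot>\<^bsub>A\<^esub> x) = c \<odot>\<^bsub>B\<^esub> f x"
  "x \<in> carrier A \<Longrightarrow> f (star A x) = star B (f x)"
  "f \<one>\<^bsub>A\<^esub> = \<one>\<^bsub>B\<^esub>"
  using hom unfolding unital_star_hom_def ring_hom_def by auto

lemma hom_diff [simp]: "x \<in> carrier A \<Longrightarrow> y \<in> carrier A \<Longrightarrow> f (x \<ominus>\<^bsub>A\<^esub> y) = f x \<ominus>\<^bsub>B\<^esub> f y"
  by (simp add: A.diff_smult B.diff_smult)

lemma hom_zero [simp]: "f \<zero>\<^bsub>A\<^esub> = \<zero>\<^bsub>B\<^esub>"
  using hom_simps(4)[of "\<zero>\<^bsub>A\<^esub>" 0] by simp

lemma hom_pos: assumes "A.pos x" shows "B.pos (f x)"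
proof -
  obtain s where s: "s \<in> carrier A" "star A s = s" "x = s \<otimes>\<^bsub>A\<^esub> s" using assms unfolding A.pos_def by blast
  have "star B (f s) = f s" using hom_simps(5)[OF s(1)] s(2) by simp
  then show ?thesis using B.posI[of "f s"] s(1,3) by simp
qed

text \<open>For \<open>y\<close> of norm 1 the element \<open>1 - y\<^sup>* y\<close> is a square, and so is its image.\<close>

lemma contractive: assumes x: "x \<in> carrier A" shows "cnorm B (f x) \<le> cnorm A x"
proof (cases "x = \<zero>\<^bsub>A\<^esub>")
  case False
  obtain t y where y: "0 < t" "y \<in> carrier A" "cnorm A y = 1" "x = complex_of_real t \<odot>\<^bsub>A\<^esub> y" "t = cnorm A x"
    by (rule A.norm_scale_unit[OF x False])
  have h: "star A y \<otimes>\<^bsub>A\<^esub> y \<in> carrier A" "star A (star A y \<otimes>\<^bsub>A\<^esub> y) = star A y \<otimes>\<^bsub>A\<^esub> y"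
    "cnorm A (star A y \<otimes>\<^bsub>A\<^esub> y) \<le> 1" using y(2,3) A.cnorm_cstar by simp_all
  obtain r where r: "r \<in> carrier A" "star A r = r" "r \<otimes>\<^bsub>A\<^esub> r = \<one>\<^bsub>A\<^esub> \<ominus>\<^bsub>A\<^esub> star A y \<otimes>\<^bsub>A\<^esub> y"
    using A.root_one_minus[OF h] by (elim bexE conjE) (rule that, assumption+)
  have "B.pos (f (r \<otimes>\<^bsub>A\<^esub> r))" by (rule hom_pos[OF A.posI[OF r(1,2)]])
  moreover have "star B (f y) \<otimes>\<^bsub>B\<^esub> f y \<oplus>\<^bsub>B\<^esub> f (r \<otimes>\<^bsub>A\<^esub> r) = complex_of_real 1 \<odot>\<^bsub>B\<^esub> \<one>\<^bsub>B\<^esub>"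
    unfolding r(3) using y(2) by (simp add: B.ring_normalize)
  ultimately have "(cnorm B (f y))\<^sup>2 \<le> 1"
    using B.norm_le_of_sum_star_mult[of "f y" "f (r \<otimes>\<^bsub>A\<^esub> r)" 1] y(2) by simp
  then have "cnorm B (f y) \<le> 1" using y(2) by (simp add: power_le_one_iff)
  then have "t * cnorm B (f y) \<le> t * 1" using y(1) by (intro mult_left_mono) auto
  then show ?thesis using y(1,2) unfolding y(5)[symmetric] unfolding y(4) by (simp add: B.cnorm_smult)
qed simp

text \<open>If the image of a self-adjoint \<open>h\<close> lies in the unit ball, then \<open>k = 1 - h\<^sup>2\<close> has a positive image. The homomorphism maps
  \<open>\<bar>k\<bar>\<close> and \<open>k\<close> to positive roots of the same element, so by \<open>pos_root_unique\<close> and injectivity \<open>k = \<bar>k\<bar>\<close> is positive,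
  and \<open>h\<close> lies in the unit ball.\<close>

lemma isometric:
  assumes inj: "inj_on f (carrier A)" and x: "x \<in> carrier A" shows "cnorm B (f x) = cnorm A x"
proof -
  have unit: "cnorm A h \<le> 1" if h: "h \<in> carrier A" "star A h = h" "cnorm B (f h) \<le> 1" for h
  proof -
    have fh: "star B (f h) = f h" using hom_simps(5)[OF h(1)] h(2) by simp
    define k where "k = \<one>\<^bsub>A\<^esub> \<ominus>\<^bsub>A\<^esub> h \<otimes>\<^bsub>A\<^esub> h"
    have k: "k \<in> carrier A" "star A k = k" using h by (simp_all add: k_def)
    obtain w where w: "A.pos w" "w \<otimes>\<^bsub>A\<^esub> w = k \<otimes>\<^bsub>A\<^esub> k" using A.bic_abs[OF k(1) A.bic_self[OF k]] by blast
    have fhh: "f h \<otimes>\<^bsub>B\<^esub> f h \<in> carrier B" "star B (f h \<otimes>\<^bsub>B\<^esub> f h) = f h \<otimes>\<^bsub>B\<^esub> f h" "cnorm B (f h \<otimes>\<^bsub>B\<^esub> f h) \<le> 1"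
      using h(1,3) fh B.cnorm_sq[of "f h"] by (simp_all add: power_le_one)
    obtain r where r: "r \<in> carrier B" "star B r = r" "r \<otimes>\<^bsub>B\<^esub> r = \<one>\<^bsub>B\<^esub> \<ominus>\<^bsub>B\<^esub> f h \<otimes>\<^bsub>B\<^esub> f h"
      using B.root_one_minus[OF fhh] by (elim bexE conjE) (rule that, assumption+)
    have "f k = r \<otimes>\<^bsub>B\<^esub> r" unfolding r(3) using h(1) by (simp add: k_def)
    then have pk: "B.pos (f k)" using B.posI[OF r(1,2)] by simp
    have "f w \<otimes>\<^bsub>B\<^esub> f w = f k \<otimes>\<^bsub>B\<^esub> f k"
      using hom_simps(3)[OF A.pos_closed A.pos_closed, OF w(1) w(1)] hom_simps(3)[OF k(1) k(1)] w(2) by simp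
    then have "f w = f k" by (rule B.pos_root_unique[OF hom_pos[OF w(1)] pk])
    then have "w = k" using inj A.pos_closed[OF w(1)] k(1) by (simp add: inj_on_def)
    then have "A.pos k" using w(1) by simp
    moreover have "star A h \<otimes>\<^bsub>A\<^esub> h \<oplus>\<^bsub>A\<^esub> k = complex_of_real 1 \<odot>\<^bsub>A\<^esub> \<one>\<^bsub>A\<^esub>"
      unfolding k_def h(2) using h(1) by (simp add: A.ring_normalize)
    ultimately have "(cnorm A h)\<^sup>2 \<le> 1" using A.norm_le_of_sum_star_mult[OF h(1)] by simp
    then show ?thesis using h(1) by (simp add: power_le_one_iff)
  qed
  define h where "h = star A x \<otimes>\<^bsub>A\<^esub> x"
  have h: "h \<in> carrier A" "star A h = h" using x by (simp_all add: h_def)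
  have "cnorm A h \<le> cnorm B (f h)"
  proof (cases "f h = \<zero>\<^bsub>B\<^esub>")
    case True
    then have "h = \<zero>\<^bsub>A\<^esub>" using inj_onD[OF inj, of h "\<zero>\<^bsub>A\<^esub>"] h(1) by simp
    then show ?thesis by simp
  next
    case False
    obtain t where t: "0 < t" "t = cnorm B (f h)"
      by (rule B.norm_scale_unit[OF hom_simps(1)[OF h(1)] False])
    have "cnorm A (complex_of_real (1/t) \<odot>\<^bsub>A\<^esub> h) \<le> 1"
      using unit[of "complex_of_real (1/t) \<odot>\<^bsub>A\<^esub> h"] h t by (simp add: B.cnorm_smult norm_divide)
    then show ?thesis using t h by (simp add: A.cnorm_smult norm_divide)
  qed
  also have "\<dots> = (cnorm B (f x))\<^sup>2" using B.cnorm_cstar[of "f x"] x by (simp add: h_def)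
  finally have "(cnorm A x)\<^sup>2 \<le> (cnorm B (f x))\<^sup>2" using A.cnorm_cstar[OF x] by (simp add: h_def)
  then have "cnorm A x \<le> cnorm B (f x)" using x by (simp add: power2_le_iff_abs_le)
  then show ?thesis using contractive[OF x] by simp
qed

end

section \<open>C*-algebras of operators\<close>

lemma cring_complex_ring: "cring complex_ring"
proof (rule cringI)
  show "abelian_group complex_ring"
    by (rule abelian_groupI) (auto simp: complex_ring_def algebra_simps intro: exI[of _ "- x" for x :: complex])
  show "comm_monoid complex_ring"
    by (rule comm_monoidI) (auto simp: complex_ring_def algebra_simps)
qed (auto simp: complex_ring_def algebra_simps)

text \<open>A common frame for bounded operators and for matrices of them. The inner product may be degenerate: matrices
  act below on sequences of vectors of which only the first \<open>n\<close> entries count. For the same reason the unit is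
  not assumed to be the identity map. Completeness is stated through pointwise bounds, which can be verified
  without evaluating the supremum in the definition of the norm.\<close>

locale operator_algebra =
  fixes R :: "('v::ab_group_add \<Rightarrow> 'v) cstar" (structure)
    and sc :: "complex \<Rightarrow> 'v \<Rightarrow> 'v" and ip :: "'v \<Rightarrow> 'v \<Rightarrow> complex" and N :: "'v \<Rightarrow> real"
  assumes mult_R: "mult R = (\<circ>)" and zero_R: "zero R = (\<lambda>x. 0)"
    and add_R: "add R = (\<lambda>S T x. S x + T x)" and smult_R: "smult R = (\<lambda>c T x. sc c (T x))"
    and cnorm_R: "cnorm R = (\<lambda>T. SUP x. N (T x) / N x)"
    and N_def: "N x = sqrt (Re (ip x x))"
    and sc_add_right: "sc c (x + y) = sc c x + sc c y" and sc_add_left: "sc (c + d) x = sc c x + sc d x"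
    and sc_sc: "sc c (sc d x) = sc (c * d) x" and sc_1: "sc 1 x = x"
    and ip_commute: "ip x y = cnj (ip y x)" and ip_add_left: "ip (x + y) z = ip x z + ip y z"
    and ip_sc_left: "ip (sc c x) y = c * ip x y" and ip_nonneg: "0 \<le> Re (ip x x)"
    and op_add: "T \<in> carrier R \<Longrightarrow> T (x + y) = T x + T y"
    and op_sc: "T \<in> carrier R \<Longrightarrow> T (sc c x) = sc c (T x)"
    and op_bounded: "T \<in> carrier R \<Longrightarrow> \<exists>K. \<forall>x. N (T x) \<le> K * N x"
    and op_comp_closed: "S \<in> carrier R \<Longrightarrow> T \<in> carrier R \<Longrightarrow> S \<circ> T \<in> carrier R"
    and op_add_closed: "S \<in> carrier R \<Longrightarrow> T \<in> carrier R \<Longrightarrow> (\<lambda>x. S x + T x) \<in> carrier R"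
    and op_sc_closed: "T \<in> carrier R \<Longrightarrow> (\<lambda>x. sc c (T x)) \<in> carrier R"
    and one_carrier: "\<one> \<in> carrier R" and one_comp: "T \<in> carrier R \<Longrightarrow> \<one> \<circ> T = T" and comp_one: "T \<in> carrier R \<Longrightarrow> T \<circ> \<one> = T"
    and star_carrier: "T \<in> carrier R \<Longrightarrow> star R T \<in> carrier R"
    and star_adjoint: "T \<in> carrier R \<Longrightarrow> ip (T x) y = ip x (star R T y)"
    and definite: "T \<in> carrier R \<Longrightarrow> (\<And>x. N (T x) = 0) \<Longrightarrow> T = (\<lambda>x. 0)"
    and complete: "\<And>X :: nat \<Rightarrow> 'v \<Rightarrow> 'v. (\<And>n. X n \<in> carrier R) \<Longrightarrow>
      (\<And>e. e > 0 \<Longrightarrow> \<exists>M. \<forall>m\<ge>M. \<forall>n\<ge>M. \<forall>x. N (X m x - X n x) \<le> e * N x) \<Longrightarrow>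
      \<exists>T\<in>carrier R. \<forall>e>0. \<exists>M. \<forall>n\<ge>M. \<forall>x. N (X n x - T x) \<le> e * N x"
begin

lemma sc_0: "sc 0 x = 0"
  using sc_add_left[of 0 0 x] by simp

lemma sc_minus: "sc (-1) x = - x"
  using sc_add_left[of "-1" 1 x] by (simp add: sc_0 sc_1 eq_neg_iff_add_eq_0)

lemma ip_add_right: "ip x (y + z) = ip x y + ip x z"
  using ip_commute[of x "y + z"] ip_commute[of x y] ip_commute[of x z] by (simp add: ip_add_left)

lemma ip_sc_right: "ip x (sc c y) = cnj c * ip x y"
  using ip_commute[of x "sc c y"] ip_commute[of x y] by (simp add: ip_sc_left)

lemma N_nonneg: "0 \<le> N x" by (simp add: N_def ip_nonneg)

lemma N_sq: "(N x)\<^sup>2 = Re (ip x x)" by (simp add: N_def ip_nonneg)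

lemma ip_zero: "ip 0 x = 0" using ip_sc_left[of 0 0 x] by (simp add: sc_0)

lemma N_zero [simp]: "N 0 = 0" by (simp add: N_def ip_zero)

lemma N_sc: "N (sc c x) = cmod c * N x"
proof -
  have "ip (sc c x) (sc c x) = (c * cnj c) * ip x x" by (simp add: ip_sc_left ip_sc_right)
  also have "\<dots> = complex_of_real ((cmod c)\<^sup>2) * ip x x" by (simp only: complex_norm_square)
  finally have *: "ip (sc c x) (sc c x) = complex_of_real ((cmod c)\<^sup>2) * ip x x" .
  have "Re (complex_of_real a * w) = a * Re w" for a w by simp
  then have "Re (ip (sc c x) (sc c x)) = (cmod c)\<^sup>2 * Re (ip x x)" unfolding * .
  then show ?thesis by (simp add: N_def real_sqrt_mult)
qed

lemma Cauchy_Schwarz: "Re (ip x y) \<le> N x * N y"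
proof -
  have expand: "0 \<le> (N x)\<^sup>2 - 2 * t * Re (ip x y) + t\<^sup>2 * (N y)\<^sup>2" for t :: real
  proof -
    have "Re (ip y x) = Re (ip x y)" using ip_commute[of x y] by simp
    then show ?thesis
      using ip_nonneg[of "x + sc (of_real (-t)) y"] unfolding N_sq
      by (simp add: ip_add_left ip_add_right ip_sc_left ip_sc_right power2_eq_square algebra_simps)
  qed
  show ?thesis
  proof (cases "N y = 0")
    case True
    have "Re (ip x y) \<le> 0"
    proof (rule ccontr)
      assume "\<not> Re (ip x y) \<le> 0"
      then show False using expand[of "((N x)\<^sup>2 + 1) / (2 * Re (ip x y))"] True by simp
    qed
    then show ?thesis using True by simp
  next
    case False
    let ?r = "Re (ip x y)"
    have "0 \<le> (N x)\<^sup>2 - 2 * (?r / (N y)\<^sup>2) * ?r + (?r / (N y)\<^sup>2)\<^sup>2 * (N y)\<^sup>2" by (rule expand)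
    also have "\<dots> = (N x)\<^sup>2 - ?r\<^sup>2 / (N y)\<^sup>2" using False by (simp add: power2_eq_square field_simps)
    finally have "?r\<^sup>2 \<le> (N x * N y)\<^sup>2" using False by (simp add: field_simps power_mult_distrib)
    then have "\<bar>?r\<bar> \<le> \<bar>N x * N y\<bar>" unfolding abs_le_square_iff .
    then show ?thesis using mult_nonneg_nonneg[OF N_nonneg[of x] N_nonneg[of y]] by linarith
  qed
qed

lemma N_triangle: "N (x + y) \<le> N x + N y"
proof -
  have "(N (x + y))\<^sup>2 \<le> (N x + N y)\<^sup>2"
    using Cauchy_Schwarz[of x y] ip_commute[of y x]
    by (simp add: N_sq power2_sum ip_add_left ip_add_right)
  then show ?thesis using N_nonneg[of x] N_nonneg[of y] by (meson add_nonneg_nonneg power2_le_imp_le)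
qed

lemma op_zero: "T \<in> carrier R \<Longrightarrow> T 0 = 0"
  using op_sc[of T 0 0] by (simp add: sc_0)

lemma cnorm_bound: assumes T: "T \<in> carrier R" shows "N (T x) \<le> cnorm R T * N x" and "0 \<le> cnorm R T"
proof -
  obtain K where K: "\<And>x. N (T x) \<le> K * N x" using op_bounded[OF T] by blast
  have "N (T x) / N x \<le> max K 0" for x
  proof -
    have "N (T x) \<le> max K 0 * N x"
      using K[of x] mult_right_mono[of K "max K 0" "N x"] N_nonneg[of x] by linarith
    then show ?thesis using N_nonneg[of x] by (cases "N x = 0") (auto simp: divide_le_eq)
  qed
  then have bdd: "bdd_above (range (\<lambda>x. N (T x) / N x))" by (auto intro!: bdd_aboveI)
  have *: "N (T x) / N x \<le> cnorm R T" for x unfolding cnorm_R by (rule cSUP_upper[OF _ bdd]) simp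
  show "0 \<le> cnorm R T" using *[of 0] by simp
  show "N (T x) \<le> cnorm R T * N x"
  proof (cases "N x = 0")
    case True then show ?thesis using K[of x] by simp
  next
    case False then show ?thesis using *[of x] N_nonneg[of x] by (simp add: divide_le_eq)
  qed
qed

lemma cnorm_le:
  assumes "\<And>x. N (T x) \<le> c * N x" "0 \<le> c" shows "cnorm R T \<le> c"
  unfolding cnorm_R
proof (rule cSUP_least)
  fix x show "N (T x) / N x \<le> c"
    using assms(1)[of x] assms(2) N_nonneg[of x] by (cases "N x = 0") (auto simp: divide_le_eq)
qed simp

lemma adjoint_unique:
  assumes S: "S \<in> carrier R" "S' \<in> carrier R" and eq: "\<And>x y. ip x (S y) = ip x (S' y)" shows "S = S'"
proof -
  have D: "(\<lambda>x. S x + sc (-1) (S' x)) \<in> carrier R" using S by (intro op_add_closed op_sc_closed)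
  have "N (S x + sc (-1) (S' x)) = 0" for x
    using eq[of "S x + sc (-1) (S' x)" x] by (simp add: N_def[of "S x + sc (-1) (S' x)"] ip_add_right ip_sc_right)
  then have "(\<lambda>x. S x + sc (-1) (S' x)) = (\<lambda>x. 0)" using definite[OF D] by blast
  then have "S x + sc (-1) (S' x) = 0" for x by metis
  then show ?thesis by (intro ext) (simp add: sc_minus)
qed

lemma star_unique:
  assumes "T \<in> carrier R" "S \<in> carrier R" "\<And>x y. ip (T x) y = ip x (S y)" shows "star R T = S"
  by (rule adjoint_unique) (use assms star_carrier star_adjoint in auto)

lemma star_adjoint2: assumes "T \<in> carrier R" shows "ip (star R T x) y = ip x (T y)"
  using ip_commute[of "star R T x" y] ip_commute[of x "T y"] star_adjoint[OF assms, of y x] by simp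

lemma N_star: assumes T: "T \<in> carrier R" shows "N (star R T y) \<le> cnorm R T * N y"
proof (cases "N (star R T y) = 0")
  case True
  then show ?thesis using cnorm_bound(2)[OF T] N_nonneg by simp
next
  case False
  let ?s = "star R T y"
  have "(N ?s)\<^sup>2 = Re (ip (T ?s) y)" using star_adjoint[OF T, of ?s y] by (simp add: N_sq)
  also have "\<dots> \<le> N (T ?s) * N y" by (rule Cauchy_Schwarz)
  also have "\<dots> \<le> (cnorm R T * N ?s) * N y" by (intro mult_right_mono cnorm_bound T N_nonneg)
  finally have "N ?s * N ?s \<le> N ?s * (cnorm R T * N y)" by (simp add: power2_eq_square mult_ac)
  then show ?thesis using False N_nonneg[of ?s] by (simp add: mult_le_cancel_left)
qed

lemma zero_closed_R: "(\<lambda>x. 0) \<in> carrier R"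
  using op_sc_closed[OF one_carrier, of 0] by (simp add: sc_0)

lemma ring_R: "ring R"
proof (rule ringI)
  show "abelian_group R"
  proof (rule abelian_groupI)
    fix T assume T: "T \<in> carrier R"
    show "\<exists>S\<in>carrier R. S \<oplus> T = \<zero>"
      by (rule bexI[OF _ op_sc_closed[OF T, of "-1"]]) (simp add: add_R zero_R sc_minus)
  qed (auto simp: add_R zero_R op_add_closed zero_closed_R algebra_simps)
  show "monoid R"
    by (rule monoidI) (auto simp: mult_R op_comp_closed one_carrier one_comp comp_one comp_assoc)
qed (auto simp: add_R mult_R op_add)

lemma diff_R: assumes "S \<in> carrier R" "T \<in> carrier R" shows "S \<ominus> T = (\<lambda>x. S x - T x)"
proof -
  interpret ring R by (rule ring_R)
  have cl: "(\<lambda>x. - T x) \<in> carrier R" using op_sc_closed[OF assms(2), of "-1"] by (simp add: sc_minus)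
  have "\<ominus> T = (\<lambda>x. - T x)"
    by (rule minus_equality) (use assms cl in \<open>auto simp: add_R zero_R\<close>)
  then show ?thesis by (simp add: a_minus_def add_R)
qed

text \<open>The C*-identity comes from \<open>\<parallel>T x\<parallel>\<^sup>2 = \<langle>x, T\<^sup>* T x\<rangle>\<close> and the Cauchy-Schwarz inequality.\<close>

lemma cstar_algebra_R: "cstar_algebra R"
proof -
  interpret R: ring R by (rule ring_R)
  have mod: "module complex_ring R"
    by (rule moduleI[OF cring_complex_ring R.is_abelian_group])
       (auto simp: complex_ring_def smult_R add_R op_sc_closed sc_add_left sc_add_right sc_sc sc_1)
  have norm_comp: "cnorm R (S \<circ> T) \<le> cnorm R S * cnorm R T" if "S \<in> carrier R" "T \<in> carrier R" for S T
  proof (rule cnorm_le)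
    fix x
    have "N (S (T x)) \<le> cnorm R S * N (T x)" by (rule cnorm_bound[OF that(1)])
    also have "\<dots> \<le> cnorm R S * (cnorm R T * N x)" by (intro mult_left_mono cnorm_bound that)
    finally show "N ((S \<circ> T) x) \<le> cnorm R S * cnorm R T * N x" by (simp add: mult.assoc)
  qed (use cnorm_bound that in auto)
  have norm_sc: "cnorm R (\<lambda>x. sc c (T x)) \<le> cmod c * cnorm R T" if "T \<in> carrier R" for c T
    by (rule cnorm_le) (use cnorm_bound[OF that] in \<open>auto simp: N_sc mult.assoc intro!: mult_left_mono\<close>)
  have axs: "cstar_algebra_axioms R"
  proof
    fix S T c assume S: "S \<in> carrier R" and T: "T \<in> carrier R"
    show "(c \<odot> S) \<otimes> T = c \<odot> (S \<otimes> T)" "S \<otimes> (c \<odot> T) = c \<odot> (S \<otimes> T)"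
      using S by (auto simp: mult_R smult_R op_sc)
    show "star R (S \<oplus> T) = star R S \<oplus> star R T"
      unfolding add_R by (rule star_unique) (use S T star_carrier in \<open>auto intro: op_add_closed simp: ip_add_left ip_add_right star_adjoint\<close>)
    show "star R (S \<otimes> T) = star R T \<otimes> star R S"
      unfolding mult_R by (rule star_unique) (use S T star_carrier in \<open>auto intro: op_comp_closed simp: star_adjoint\<close>)
    show "cnorm R (S \<oplus> T) \<le> cnorm R S + cnorm R T"
      unfolding add_R
    proof (rule cnorm_le)
      fix x show "N (S x + T x) \<le> (cnorm R S + cnorm R T) * N x"
        using N_triangle[of "S x" "T x"] cnorm_bound(1)[OF S, of x] cnorm_bound(1)[OF T, of x] by (simp add: distrib_right)
    qed (use cnorm_bound S T in auto)
    show "cnorm R (S \<otimes> T) \<le> cnorm R S * cnorm R T" unfolding mult_R by (rule norm_comp[OF S T])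
  next
    fix T c assume T: "T \<in> carrier R"
    show "star R T \<in> carrier R" by (rule star_carrier[OF T])
    show "star R (star R T) = T" by (rule star_unique) (use T star_carrier star_adjoint2 in auto)
    show "star R (c \<odot> T) = cnj c \<odot> star R T"
      unfolding smult_R by (rule star_unique) (use T star_carrier in \<open>auto intro: op_sc_closed simp: ip_sc_left ip_sc_right star_adjoint\<close>)
    show "(cnorm R T = 0) = (T = \<zero>)"
    proof
      assume "cnorm R T = 0"
      then have "N (T x) = 0" for x using cnorm_bound(1)[OF T, of x] N_nonneg[of "T x"] by simp
      then show "T = \<zero>" unfolding zero_R by (rule definite[OF T])
    next
      assume "T = \<zero>"
      then show "cnorm R T = 0" by (simp add: cnorm_R zero_R)
    qed
    show "cnorm R (c \<odot> T) = cmod c * cnorm R T"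
    proof (cases "c = 0")
      case True
      then show ?thesis by (simp add: cnorm_R smult_R sc_0)
    next
      case False
      have "cnorm R T = cnorm R (\<lambda>x. sc (inverse c) (sc c (T x)))" using False by (simp add: sc_sc sc_1)
      also have "\<dots> \<le> cmod (inverse c) * cnorm R (\<lambda>x. sc c (T x))"
        by (rule norm_sc[OF op_sc_closed[OF T]])
      finally have "cmod c * cnorm R T \<le> cnorm R (\<lambda>x. sc c (T x))"
        using False by (simp add: norm_inverse norm_divide field_simps)
      then show ?thesis using norm_sc[OF T, of c] by (simp add: smult_R)
    qed
    show "cnorm R (star R T \<otimes> T) = (cnorm R T)\<^sup>2"
    proof (rule antisym)
      have "cnorm R (star R T) \<le> cnorm R T" by (rule cnorm_le) (use N_star[OF T] cnorm_bound[OF T] in auto)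
      then have "cnorm R (star R T) * cnorm R T \<le> cnorm R T * cnorm R T"
        by (rule mult_right_mono[OF _ cnorm_bound(2)[OF T]])
      then show "cnorm R (star R T \<otimes> T) \<le> (cnorm R T)\<^sup>2"
        using norm_comp[OF star_carrier[OF T] T] unfolding mult_R power2_eq_square by linarith
      let ?c = "cnorm R (star R T \<circ> T)"
      have ST: "star R T \<circ> T \<in> carrier R" by (intro op_comp_closed star_carrier T)
      have c: "0 \<le> ?c" using cnorm_bound(2)[OF ST] .
      have "cnorm R T \<le> sqrt ?c"
      proof (rule cnorm_le)
        fix x
        have "(N (T x))\<^sup>2 = Re (ip x ((star R T \<circ> T) x))" using star_adjoint[OF T, of x "T x"] by (simp add: N_sq)
        also have "\<dots> \<le> N x * N ((star R T \<circ> T) x)" by (rule Cauchy_Schwarz)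
        also have "\<dots> \<le> N x * (?c * N x)" by (intro mult_left_mono cnorm_bound ST N_nonneg)
        also have "\<dots> = (sqrt ?c * N x)\<^sup>2" using c by (simp add: power_mult_distrib power2_eq_square)
        finally show "N (T x) \<le> sqrt ?c * N x" using N_nonneg c by (meson mult_nonneg_nonneg power2_le_imp_le real_sqrt_ge_zero)
      qed (use c in simp)
      then have "(cnorm R T)\<^sup>2 \<le> (sqrt ?c)\<^sup>2" by (intro power_mono cnorm_bound T)
      then show "(cnorm R T)\<^sup>2 \<le> cnorm R (star R T \<otimes> T)" using c by (simp add: mult_R)
    qed
  next
    fix X :: "nat \<Rightarrow> 'v \<Rightarrow> 'v"
    assume X: "\<And>n. X n \<in> carrier R" and C: "\<And>e. 0 < e \<Longrightarrow> \<exists>M. \<forall>m\<ge>M. \<forall>n\<ge>M. cnorm R (X m \<ominus> X n) < e"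
    have "\<exists>T\<in>carrier R. \<forall>e>0. \<exists>M. \<forall>n\<ge>M. \<forall>x. N (X n x - T x) \<le> e * N x"
    proof (rule complete[OF X])
      fix e :: real assume "e > 0"
      then obtain M where M: "\<forall>m\<ge>M. \<forall>n\<ge>M. cnorm R (X m \<ominus> X n) < e" using C by blast
      have "N (X m x - X n x) \<le> e * N x" if "m \<ge> M" "n \<ge> M" for m n x
      proof -
        have "N (X m x - X n x) \<le> cnorm R (X m \<ominus> X n) * N x"
          using cnorm_bound(1)[of "X m \<ominus> X n" x] R.minus_closed[OF X X, of m n] diff_R[OF X X, of m n] by simp
        also have "\<dots> \<le> e * N x" using M that N_nonneg by (intro mult_right_mono) (auto simp: less_imp_le)
        finally show ?thesis .
      qed
      then show "\<exists>M. \<forall>m\<ge>M. \<forall>n\<ge>M. \<forall>x. N (X m x - X n x) \<le> e * N x" by blast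
    qed
    then obtain T where T: "T \<in> carrier R" and L: "\<And>e. e > 0 \<Longrightarrow> \<exists>M. \<forall>n\<ge>M. \<forall>x. N (X n x - T x) \<le> e * N x" by blast
    have "(\<lambda>n. cnorm R (X n \<ominus> T)) \<longlonglongrightarrow> 0"
    proof (rule LIMSEQ_I)
      fix r :: real assume r: "0 < r"
      obtain M where M: "\<And>n x. n \<ge> M \<Longrightarrow> N (X n x - T x) \<le> r/2 * N x" using L[of "r/2"] r by auto
      have "norm (cnorm R (X n \<ominus> T) - 0) < r" if "n \<ge> M" for n
      proof -
        have "cnorm R (X n \<ominus> T) \<le> r/2" unfolding diff_R[OF X T] by (rule cnorm_le) (use M that r in auto)
        moreover have "0 \<le> cnorm R (X n \<ominus> T)" by (rule cnorm_bound(2)[OF R.minus_closed[OF X T]])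
        ultimately show ?thesis using r by simp
      qed
      then show "\<exists>M. \<forall>n\<ge>M. norm (cnorm R (X n \<ominus> T) - 0) < r" by blast
    qed
    then show "\<exists>T\<in>carrier R. (\<lambda>n. cnorm R (X n \<ominus> T)) \<longlonglongrightarrow> 0" using T by blast
  qed
  show ?thesis by (rule cstar_algebra.intro[OF ring_R mod axs])
qed

end

section \<open>Bounded operators on a Hilbert space\<close>

lemma scaleC_zero_right: "scaleC c (0::'h::complex_hilbert_space) = 0"
  using scaleC_add_right[of c "0::'h" 0] by simp

lemma scaleC_diff_right: "scaleC c (x - y) = scaleC c x - scaleC c (y::'h::complex_hilbert_space)"
proof -
  have "scaleC c (x - y) + scaleC c y = scaleC c x"
    unfolding scaleC_add_right[symmetric] by simp
  then show ?thesis by (simp add: eq_diff_eq)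
qed

lemma scaleC_1: "scaleC 1 (x::'h::complex_hilbert_space) = x"
  using scaleR_scaleC[of 1 x] by simp

lemma norm_scaleC: "norm (scaleC c (x::'h::complex_hilbert_space)) = cmod c * norm x"
proof -
  have "cinner x (scaleC c x) = cnj c * cinner x x"
    using cinner_commute[of x "scaleC c x"] by (simp add: cinner_scaleC_left cinner_self)
  then have "complex_of_real ((norm (scaleC c x))\<^sup>2) = c * (cnj c * complex_of_real ((norm x)\<^sup>2))"
    by (simp only: cinner_self[symmetric] cinner_scaleC_left)
  also have "\<dots> = c * cnj c * complex_of_real ((norm x)\<^sup>2)" by (simp only: mult.assoc)
  also have "\<dots> = complex_of_real ((cmod c * norm x)\<^sup>2)"
    by (simp only: complex_norm_square[symmetric] of_real_mult[symmetric] power_mult_distrib)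
  finally have "(norm (scaleC c x))\<^sup>2 = (cmod c * norm x)\<^sup>2" by (simp only: of_real_eq_iff)
  then show ?thesis by simp
qed

lemma cinner_add_right: "cinner (x::'h::complex_hilbert_space) (y + z) = cinner x y + cinner x z"
  using cinner_commute[of x "y + z"] cinner_commute[of x y] cinner_commute[of x z] by (simp add: cinner_add_left)

lemma cinner_scaleC_right: "cinner (x::'h::complex_hilbert_space) (scaleC c y) = cnj c * cinner x y"
  using cinner_commute[of x "scaleC c y"] cinner_commute[of x y] by (simp add: cinner_scaleC_left)

lemma norm_add_sq: "(norm (x + y::'h::complex_hilbert_space))\<^sup>2 = (norm x)\<^sup>2 + 2 * Re (cinner x y) + (norm y)\<^sup>2"
proof -
  have "Re (cinner (x + y) (x + y)) = Re (cinner x x) + 2 * Re (cinner x y) + Re (cinner y y)"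
    using cinner_commute[of y x] by (simp add: cinner_add_left cinner_add_right)
  then show ?thesis by (simp add: cinner_self)
qed

lemma cinner_scaleR_right: "cinner (x::'h::complex_hilbert_space) (r *\<^sub>R y) = of_real r * cinner x y"
  by (simp add: scaleR_scaleC cinner_scaleC_right)

lemma cinner_minus_right: "cinner (x::'h::complex_hilbert_space) (- y) = - cinner x y"
  using cinner_scaleR_right[of x "-1" y] by simp

text \<open>Riesz representation: the representing vector minimises \<open>\<parallel>x\<parallel>\<^sup>2 - 2 Re (f x)\<close>. The parallelogram
  law makes every minimising sequence Cauchy.\<close>

lemma Riesz_representation:
  fixes f :: "'h::complex_hilbert_space \<Rightarrow> complex"
  assumes add: "\<And>x y. f (x + y) = f x + f y" and sc: "\<And>c x. f (scaleC c x) = c * f x"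
    and bd: "\<And>x. cmod (f x) \<le> K * norm x"
  shows "\<exists>z. \<forall>x. f x = cinner x z"
proof -
  have scR: "f (r *\<^sub>R x) = of_real r * f x" for r x by (simp add: scaleR_scaleC sc)
  define J where "J x = (norm x)\<^sup>2 - 2 * Re (f x)" for x
  have lower: "- K\<^sup>2 \<le> J x" for x
  proof -
    have "Re (f x) \<le> K * norm x" using bd[of x] complex_Re_le_cmod[of "f x"] by linarith
    moreover have "0 \<le> (norm x - K)\<^sup>2" by simp
    ultimately show ?thesis unfolding J_def by (simp add: power2_eq_square algebra_simps)
  qed
  define m where "m = (INF x. J x)"
  have bdd: "bdd_below (range J)" using lower by (auto intro!: bdd_belowI)
  have m_le: "m \<le> J x" for x unfolding m_def by (rule cINF_lower[OF bdd]) simp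
  have "\<exists>x. J x < m + 1 / real (Suc n)" for n
    using cINF_less_iff[OF _ bdd, of "m + 1 / real (Suc n)"] unfolding m_def by simp
  then obtain u where u: "\<And>n. J (u n) < m + 1 / real (Suc n)" by metis
  have para: "(norm (x - y))\<^sup>2 / 2 \<le> (J x - m) + (J y - m)" for x y
  proof -
    define z where "z = (1/2) *\<^sub>R (x + y)"
    have half: "(norm z)\<^sup>2 = (norm (x + y))\<^sup>2 / 4"
      unfolding z_def norm_scaleR by (simp add: power_divide)
    have "f z = (f x + f y) / 2" unfolding z_def scR add by simp
    then have "Re (f z) = Re ((f x + f y) / 2)" by (rule arg_cong)
    then have "Re (f z) = (Re (f x) + Re (f y)) / 2" by (simp only: Re_divide_numeral plus_complex.sel)
    then have "J x + J y - 2 * J z = (norm x)\<^sup>2 + (norm y)\<^sup>2 - (norm (x + y))\<^sup>2 / 2"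
      unfolding J_def half by (simp add: field_simps)
    also have "\<dots> = (norm (x - y))\<^sup>2 / 2"
      using norm_add_sq[of x y] norm_add_sq[of x "- y"] by (simp add: cinner_minus_right field_simps)
    finally have "J x + J y - 2 * J z = (norm (x - y))\<^sup>2 / 2" .
    then show ?thesis using m_le[of z] by linarith
  qed
  have "Cauchy u"
  proof (rule CauchyI)
    fix e :: real assume e: "0 < e"
    obtain M where M: "4 / e\<^sup>2 < real M" using reals_Archimedean2 by blast
    have "norm (u i - u j) < e" if ij: "i \<ge> M" "j \<ge> M" for i j
    proof -
      have le: "1 / real (Suc k) \<le> 1 / real (Suc M)" if "k \<ge> M" for k
        using that by (intro divide_left_mono) auto
      have "(norm (u i - u j))\<^sup>2 / 2 < 2 / real (Suc M)"
        using para[of "u i" "u j"] u[of i] u[of j] le[OF ij(1)] le[OF ij(2)] by linarith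
      moreover have "4 / e\<^sup>2 < real (Suc M)" using M by simp
      then have "4 < e\<^sup>2 * real (Suc M)" using e by (simp add: divide_less_eq mult.commute)
      then have "4 / real (Suc M) < e\<^sup>2" by (simp add: divide_less_eq)
      ultimately have "(norm (u i - u j))\<^sup>2 < e\<^sup>2" by simp
      then show ?thesis using e by (simp add: power2_less_imp_less)
    qed
    then show "\<exists>M. \<forall>m\<ge>M. \<forall>n\<ge>M. norm (u m - u n) < e" by blast
  qed
  then obtain z where z: "u \<longlonglongrightarrow> z" using Cauchy_convergent_iff convergent_def by blast
  have "(\<lambda>n. f (u n)) \<longlonglongrightarrow> f z"
  proof -
    have "(\<lambda>n. f (u n) - f z) \<longlonglongrightarrow> 0"
    proof (rule Lim_null_comparison)
      have diff: "f (u n) - f z = f (u n - z)" for n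
        using add[of "u n" "(-1) *\<^sub>R z"] scR[of "-1" z] by simp
      show "\<forall>\<^sub>F n in sequentially. norm (f (u n) - f z) \<le> K * norm (u n - z)" by (simp add: diff bd)
      show "(\<lambda>n. K * norm (u n - z)) \<longlonglongrightarrow> 0"
        using tendsto_mult_right_zero[OF tendsto_norm_zero[OF LIM_zero[OF z]], of K] by simp
    qed
    then show ?thesis by (rule LIM_zero_cancel)
  qed
  then have "(\<lambda>n. J (u n)) \<longlonglongrightarrow> J z" unfolding J_def by (intro tendsto_intros z tendsto_Re)
  moreover have "(\<lambda>n. m + 1 / real (Suc n)) \<longlonglongrightarrow> m + 0"
    by (intro tendsto_intros) (rule LIMSEQ_inverse_real_of_nat[unfolded inverse_eq_divide])
  ultimately have "J z \<le> m" using u by (intro LIMSEQ_le[of "\<lambda>n. J (u n)" "J z" _ m]) (auto intro: less_imp_le)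
  then have min: "J z \<le> J x" for x using m_le[of x] by linarith
  have Re_eq: "Re (f x) = Re (cinner x z)" for x
  proof -
    define d where "d = Re (cinner z x) - Re (f x)"
    have q: "0 \<le> 2 * t * d + t\<^sup>2 * (norm x)\<^sup>2" for t :: real
      using min[of "z + t *\<^sub>R x"] unfolding J_def d_def
      by (simp add: norm_add_sq add scR cinner_scaleR_right power_mult_distrib algebra_simps)
    have "d = 0"
    proof (cases "x = 0")
      case True
      then show ?thesis using q[of 1] q[of "-1"] by simp
    next
      case False
      have "0 \<le> 2 * (- d / (norm x)\<^sup>2) * d + (- d / (norm x)\<^sup>2)\<^sup>2 * (norm x)\<^sup>2" by (rule q)
      also have "\<dots> = - (d\<^sup>2 / (norm x)\<^sup>2)" using False by (simp add: power2_eq_square field_simps)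
      finally have "d\<^sup>2 / (norm x)\<^sup>2 \<le> 0" by simp
      then show ?thesis using False by (simp add: divide_le_0_iff)
    qed
    then show ?thesis using cinner_commute[of z x] by (simp add: d_def)
  qed
  have "f x = cinner x z" for x
  proof (rule complex_eqI)
    show "Re (f x) = Re (cinner x z)" by (rule Re_eq)
    show "Im (f x) = Im (cinner x z)" using Re_eq[of "scaleC \<i> x"] by (simp add: sc cinner_scaleC_left)
  qed
  then show ?thesis by blast
qed

lemma bounded_ops_simps:
  "carrier bounded_ops = {T. bounded_linear T \<and> (\<forall>c x. T (scaleC c x) = scaleC c (T x))}"
  "mult bounded_ops = (\<circ>)" "one bounded_ops = id" "zero bounded_ops = (\<lambda>x. 0)"
  "add bounded_ops = (\<lambda>S T x. S x + T x)" "smult bounded_ops = (\<lambda>c T x. scaleC c (T x))"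
  "star bounded_ops = (\<lambda>T. THE S. \<forall>x y. cinner (T x) y = cinner x (S y))" "cnorm bounded_ops = onorm"
  by (simp_all add: bounded_ops_def)

lemma cinner_cmod_le: "cmod (cinner (x::'h::complex_hilbert_space) y) \<le> norm x * norm y"
proof -
  have re: "Re (cinner x y) \<le> norm x * norm y" for x y :: 'h
  proof -
    have "0 \<le> (norm (norm y *\<^sub>R x + (- norm x) *\<^sub>R y))\<^sup>2" by simp
    also have "\<dots> = 2 * (norm x)\<^sup>2 * (norm y)\<^sup>2 - 2 * (norm x * norm y) * Re (cinner x y)"
      unfolding norm_add_sq by (simp add: scaleR_scaleC cinner_scaleC_left cinner_scaleC_right power2_eq_square norm_scaleC algebra_simps)
    finally have *: "(norm x * norm y) * Re (cinner x y) \<le> (norm x * norm y) * (norm x * norm y)"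
      by (simp add: power2_eq_square algebra_simps)
    show ?thesis
    proof (cases "norm x * norm y = 0")
      case True
      then have "x = 0 \<or> y = 0" by simp
      moreover have "cinner 0 y = 0" "cinner x 0 = 0"
        using cinner_add_left[of 0 0 y] cinner_add_right[of x 0 0] by simp_all
      ultimately show ?thesis by auto
    next
      case False
      then have "0 < norm x * norm y" using mult_nonneg_nonneg[of "norm x" "norm y"] by (simp add: order_less_le)
      then show ?thesis using * mult_le_cancel_left_pos by blast
    qed
  qed
  define c where "c = (if cinner x y = 0 then 1 else cnj (cinner x y) / of_real (cmod (cinner x y)))"
  have "cmod c = 1" by (simp add: c_def norm_divide)
  have "c * cinner x y = of_real (cmod (cinner x y))"
  proof (cases "cinner x y = 0")
    case False
    have "cnj (cinner x y) * cinner x y = complex_of_real (cmod (cinner x y)) * complex_of_real (cmod (cinner x y))"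
      using complex_norm_square[of "cinner x y"] by (simp add: power2_eq_square mult.commute)
    then show ?thesis using False by (simp add: c_def)
  qed (simp add: c_def)
  then have "cmod (cinner x y) = Re (cinner (scaleC c x) y)" by (simp add: cinner_scaleC_left)
  also have "\<dots> \<le> norm (scaleC c x) * norm y" by (rule re)
  finally show ?thesis by (simp add: norm_scaleC \<open>cmod c = 1\<close>)
qed

lemma cinner_right_eqI: assumes "\<And>x. cinner x y = cinner (x::'h::complex_hilbert_space) z" shows "y = z"
proof -
  have "cinner (y - z) (y - z) = cinner (y - z) y - cinner (y - z) z"
    using cinner_add_right[of "y - z" y "- z"] by (simp add: cinner_minus_right)
  then have "cinner (y - z) (y - z) = 0" using assms by simp
  then show ?thesis by (simp add: cinner_self)
qed

text \<open>The value of the adjoint at \<open>y\<close> represents the bounded functional that sends \<open>x\<close> to the inner product of \<open>T x\<close> and \<open>y\<close>.\<close>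

lemma bounded_ops_adjoint:
  assumes T: "T \<in> carrier (bounded_ops :: ('h::complex_hilbert_space \<Rightarrow> 'h) cstar)"
  shows "star bounded_ops T \<in> carrier bounded_ops" and "cinner (T x) y = cinner x (star bounded_ops T y)"
proof -
  have bl: "bounded_linear T" and sc: "\<And>c x. T (scaleC c x) = scaleC c (T x)"
    using T by (auto simp: bounded_ops_simps)
  have "\<exists>z. \<forall>x. cinner (T x) y = cinner x z" for y
  proof (rule Riesz_representation)
    show "cinner (T (u + v)) y = cinner (T u) y + cinner (T v) y" for u v
      by (simp add: linear_add[OF bounded_linear.linear[OF bl]] cinner_add_left)
    show "cinner (T (scaleC c u)) y = c * cinner (T u) y" for c u by (simp add: sc cinner_scaleC_left)
    show "cmod (cinner (T u) y) \<le> onorm T * norm y * norm u" for u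
      using cinner_cmod_le[of "T u" y] mult_right_mono[OF onorm[OF bl, of u], of "norm y"]
      by (simp add: mult_ac)
  qed
  then obtain S where S: "\<And>x y. cinner (T x) y = cinner x (S y)" by metis
  have star: "star bounded_ops T = S"
    unfolding bounded_ops_simps
  proof (rule the_equality)
    show "\<forall>x y. cinner (T x) y = cinner x (S y)" using S by blast
    fix S' assume "\<forall>x y. cinner (T x) y = cinner x (S' y)"
    then show "S' = S" using S by (intro ext cinner_right_eqI) metis
  qed
  then show "cinner (T x) y = cinner x (star bounded_ops T y)" using S by simp
  have Ssc: "S (scaleC c y) = scaleC c (S y)" for c y
    by (rule cinner_right_eqI) (simp add: S[symmetric] cinner_scaleC_right)
  have "bounded_linear S"
  proof (rule bounded_linear_intro)
    show "S (u + v) = S u + S v" for u v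
      by (rule cinner_right_eqI) (simp add: S[symmetric] cinner_add_right)
    show "S (r *\<^sub>R u) = r *\<^sub>R S u" for r u by (simp add: scaleR_scaleC Ssc)
    show "norm (S y) \<le> norm y * onorm T" for y
    proof (cases "S y = 0")
      case True then show ?thesis using onorm_pos_le[OF bl] by simp
    next
      case False
      have "complex_of_real ((norm (S y))\<^sup>2) = cinner (T (S y)) y" by (simp add: S cinner_self)
      then have "(norm (S y))\<^sup>2 \<le> norm (T (S y)) * norm y"
        using cinner_cmod_le[of "T (S y)" y] by (metis norm_of_real abs_power2)
      also have "\<dots> \<le> onorm T * norm (S y) * norm y" by (intro mult_right_mono onorm[OF bl]) simp
      finally have "norm (S y) * norm (S y) \<le> norm (S y) * (norm y * onorm T)" by (simp add: power2_eq_square mult_ac)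
      then show ?thesis using False by simp
    qed
  qed
  then show "star bounded_ops T \<in> carrier bounded_ops" unfolding star by (simp add: bounded_ops_simps Ssc)
qed

lemma bounded_ops_complete:
  fixes X :: "nat \<Rightarrow> 'h::complex_hilbert_space \<Rightarrow> 'h"
  assumes X: "\<And>n. X n \<in> carrier bounded_ops"
    and C: "\<And>e. e > 0 \<Longrightarrow> \<exists>M. \<forall>m\<ge>M. \<forall>n\<ge>M. \<forall>x. norm (X m x - X n x) \<le> e * norm x"
  shows "\<exists>T\<in>carrier bounded_ops. \<forall>e>0. \<exists>M. \<forall>n\<ge>M. \<forall>x. norm (X n x - T x) \<le> e * norm x"
proof -
  have bl: "bounded_linear (X n)" and sc: "X n (scaleC c x) = scaleC c (X n x)" for n c x
    using X[of n] by (auto simp: bounded_ops_simps)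
  have "Cauchy (\<lambda>n. X n x)" for x
  proof (rule CauchyI)
    fix e :: real assume e: "0 < e"
    have "0 < e / (norm x + 1)" using e by (simp add: add_nonneg_pos)
    from C[OF this] obtain M where
      M: "\<forall>m\<ge>M. \<forall>n\<ge>M. \<forall>x'. norm (X m x' - X n x') \<le> e / (norm x + 1) * norm x'" by blast
    have "0 < norm x + 1" by (simp add: add_nonneg_pos)
    then have "e / (norm x + 1) * norm x < e" using e by (simp add: field_simps)
    have "norm (X m x - X n x) < e" if mn: "m \<ge> M" "n \<ge> M" for m n
    proof -
      have "norm (X m x - X n x) \<le> e / (norm x + 1) * norm x" using M mn by blast
      also have "\<dots> < e" by fact
      finally show ?thesis .
    qed
    then show "\<exists>M. \<forall>m\<ge>M. \<forall>n\<ge>M. norm (X m x - X n x) < e" by blast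
  qed
  then have conv: "convergent (\<lambda>n. X n x)" for x by (simp add: Cauchy_convergent_iff)
  define T where "T x = lim (\<lambda>n. X n x)" for x
  have T: "(\<lambda>n. X n x) \<longlonglongrightarrow> T x" for x
    using conv[of x] unfolding T_def convergent_LIMSEQ_iff .
  have lim: "\<exists>M. \<forall>n\<ge>M. \<forall>x. norm (X n x - T x) \<le> e * norm x" if e: "e > 0" for e
  proof -
    obtain M where M: "\<And>m n x. m \<ge> M \<Longrightarrow> n \<ge> M \<Longrightarrow> norm (X m x - X n x) \<le> e * norm x" using C[OF e] by blast
    have "norm (X n x - T x) \<le> e * norm x" if "n \<ge> M" for n x
    proof (rule LIMSEQ_le_const2)
      show "(\<lambda>k. norm (X n x - X k x)) \<longlonglongrightarrow> norm (X n x - T x)" by (intro tendsto_intros T)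
      show "\<exists>N. \<forall>k\<ge>N. norm (X n x - X k x) \<le> e * norm x" using M that by blast
    qed
    then show ?thesis by blast
  qed
  have Tsc: "T (scaleC c x) = scaleC c (T x)" for c x
  proof (rule LIMSEQ_unique[OF T])
    have "(\<lambda>n. scaleC c (X n x) - scaleC c (T x)) \<longlonglongrightarrow> 0"
    proof (rule Lim_null_comparison)
      show "\<forall>\<^sub>F n in sequentially. norm (scaleC c (X n x) - scaleC c (T x)) \<le> cmod c * norm (X n x - T x)"
        unfolding scaleC_diff_right[symmetric] norm_scaleC by simp
      show "(\<lambda>n. cmod c * norm (X n x - T x)) \<longlonglongrightarrow> 0"
        using tendsto_mult_right_zero[OF tendsto_norm_zero[OF LIM_zero[OF T]], of "cmod c" x] by simp
    qed
    then show "(\<lambda>n. X n (scaleC c x)) \<longlonglongrightarrow> scaleC c (T x)" unfolding sc by (rule LIM_zero_cancel)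
  qed
  from lim[OF zero_less_one] obtain M where M: "\<forall>n\<ge>M. \<forall>x. norm (X n x - T x) \<le> 1 * norm x" by blast
  have "bounded_linear T"
  proof (rule bounded_linear_intro)
    show "T (u + v) = T u + T v" for u v
      by (rule LIMSEQ_unique[OF T]) (simp add: linear_add[OF bounded_linear.linear[OF bl]] tendsto_add T)
    show "T (r *\<^sub>R u) = r *\<^sub>R T u" for r u by (simp add: scaleR_scaleC Tsc)
    show "norm (T x) \<le> norm x * (onorm (X M) + 1)" for x
    proof -
      have "norm (T x) \<le> norm (X M x) + norm (X M x - T x)"
        using norm_triangle_ineq4[of "X M x" "X M x - T x"] by simp
      also have "\<dots> \<le> onorm (X M) * norm x + 1 * norm x" using M by (intro add_mono onorm[OF bl]) simp
      finally show ?thesis by (simp add: algebra_simps)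
    qed
  qed
  then have "T \<in> carrier bounded_ops" by (simp add: bounded_ops_simps Tsc)
  then show ?thesis using lim by blast
qed

interpretation bounded_ops: operator_algebra "bounded_ops :: ('h::complex_hilbert_space \<Rightarrow> 'h) cstar" scaleC cinner norm
proof
  fix T :: "'h \<Rightarrow> 'h"
  assume T: "T \<in> carrier bounded_ops"
  then have bl: "bounded_linear T" by (simp add: bounded_ops_simps)
  show "T (x + y) = T x + T y" for x y by (rule linear_add[OF bounded_linear.linear[OF bl]])
  show "\<exists>K. \<forall>x. norm (T x) \<le> K * norm x" using onorm[OF bl] by blast
  show "(\<And>x. norm (T x) = 0) \<Longrightarrow> T = (\<lambda>x. 0)" by auto
  show "(\<lambda>x. scaleC c (T x)) \<in> carrier bounded_ops" for c
  proof -
    have "bounded_linear (\<lambda>x. scaleC c (T x))"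
    proof (rule bounded_linear_intro)
      show "scaleC c (T (u + v)) = scaleC c (T u) + scaleC c (T v)" for u v
        by (simp add: linear_add[OF bounded_linear.linear[OF bl]] scaleC_add_right)
      show "scaleC c (T (r *\<^sub>R u)) = r *\<^sub>R scaleC c (T u)" for r u
        using T by (simp add: bounded_ops_simps scaleR_scaleC scaleC_scaleC mult.commute)
      show "norm (scaleC c (T u)) \<le> norm u * (cmod c * onorm T)" for u
        using mult_left_mono[OF onorm[OF bl, of u], of "cmod c"] by (simp add: norm_scaleC mult_ac)
    qed
    then show ?thesis using T by (simp add: bounded_ops_simps scaleC_scaleC mult.commute)
  qed
  show "(cinner (T x) y) = cinner x (star bounded_ops T y)" for x y by (rule bounded_ops_adjoint(2)[OF T])
  show "star bounded_ops T \<in> carrier bounded_ops" by (rule bounded_ops_adjoint(1)[OF T])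
next
  fix S T :: "'h \<Rightarrow> 'h"
  assume "S \<in> carrier bounded_ops" "T \<in> carrier bounded_ops"
  then show "S \<circ> T \<in> carrier bounded_ops" "(\<lambda>x. S x + T x) \<in> carrier bounded_ops"
    by (auto simp: bounded_ops_simps scaleC_add_right intro: bounded_linear_add bounded_linear_compose[unfolded comp_def[symmetric]])
next
  show "cnorm bounded_ops = (\<lambda>T :: 'h \<Rightarrow> 'h. SUP x. norm (T x) / norm x)" by (simp add: bounded_ops_simps onorm_def fun_eq_iff)
next
  fix X :: "nat \<Rightarrow> 'h \<Rightarrow> 'h"
  assume "\<And>n. X n \<in> carrier bounded_ops"
    "\<And>e. e > 0 \<Longrightarrow> \<exists>M. \<forall>m\<ge>M. \<forall>n\<ge>M. \<forall>x. norm (X m x - X n x) \<le> e * norm x"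
  then show "\<exists>T\<in>carrier bounded_ops. \<forall>e>0. \<exists>M. \<forall>n\<ge>M. \<forall>x. norm (X n x - T x) \<le> e * norm x"
    by (rule bounded_ops_complete)
next
  show "\<one>\<^bsub>bounded_ops\<^esub> \<in> carrier (bounded_ops :: ('h \<Rightarrow> 'h) cstar)"
    by (simp add: bounded_ops_simps id_def bounded_linear_ident)
next
  fix x y :: 'h
  show "cinner x y = cnj (cinner y x)" by (rule cinner_commute)
qed (auto simp: bounded_ops_simps scaleC_add_right scaleC_add_left scaleC_scaleC scaleC_1
      cinner_add_left cinner_scaleC_left cinner_self)

section \<open>Matrices of bounded operators\<close>

text \<open>Sequences indexed by all of \<open>nat\<close> stand for vectors of length \<open>n\<close>, so that one type serves every matrix size. Output
  coordinates from \<open>n\<close> on are set to 0, which makes matrices with equal entries equal as maps.\<close>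

definition mat_op :: "nat \<Rightarrow> (nat \<Rightarrow> nat \<Rightarrow> 'h \<Rightarrow> 'h) \<Rightarrow> (nat \<Rightarrow> 'h) \<Rightarrow> nat \<Rightarrow> 'h::complex_hilbert_space" where
  "mat_op n X \<xi> = (\<lambda>i. if i < n then \<Sum>j<n. X i j (\<xi> j) else 0)"

text \<open>The \<open>i\<close>th coordinate of \<open>T\<close> applied to \<open>v\<close> in position \<open>j\<close>: the inverse of \<open>mat_op\<close> on indices below \<open>n\<close>
  (\<open>entry_mat_op\<close>).\<close>

definition entry :: "((nat \<Rightarrow> 'h) \<Rightarrow> nat \<Rightarrow> 'h) \<Rightarrow> nat \<Rightarrow> nat \<Rightarrow> 'h \<Rightarrow> 'h::complex_hilbert_space" where
  "entry T i j v = T (\<lambda>k. if k = j then v else 0) i"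

definition vec_ip :: "nat \<Rightarrow> (nat \<Rightarrow> 'h) \<Rightarrow> (nat \<Rightarrow> 'h::complex_hilbert_space) \<Rightarrow> complex" where
  "vec_ip n \<xi> \<eta> = (\<Sum>i<n. cinner (\<xi> i) (\<eta> i))"

definition vec_norm :: "nat \<Rightarrow> (nat \<Rightarrow> 'h::complex_hilbert_space) \<Rightarrow> real" where
  "vec_norm n \<xi> = sqrt (Re (vec_ip n \<xi> \<xi>))"

definition matrix_ops :: "nat \<Rightarrow> ((nat \<Rightarrow> 'h) \<Rightarrow> nat \<Rightarrow> 'h::complex_hilbert_space) cstar" where
  "matrix_ops n =
     \<lparr>carrier = {mat_op n X |X. \<forall>i<n. \<forall>j<n. X i j \<in> carrier bounded_ops},
      mult = (\<circ>), one = mat_op n (\<lambda>i j. if i = j then id else (\<lambda>v. 0)), zero = (\<lambda>\<xi>. 0),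
      add = (\<lambda>S T \<xi>. S \<xi> + T \<xi>), smult = (\<lambda>c T \<xi> i. scaleC c (T \<xi> i)),
      star = (\<lambda>T. mat_op n (\<lambda>i j. star bounded_ops (entry T j i))),
      cnorm = (\<lambda>T. SUP \<xi>. vec_norm n (T \<xi>) / vec_norm n \<xi>)\<rparr>"

lemma vec_norm_L2: "vec_norm n \<xi> = L2_set (\<lambda>i. norm (\<xi> i)) {..<n}"
  by (simp add: vec_norm_def vec_ip_def L2_set_def cinner_self)

lemma norm_le_vec_norm: "i < n \<Longrightarrow> norm (\<xi> i) \<le> vec_norm n \<xi>"
  unfolding vec_norm_L2 by (rule member_le_L2_set) auto

lemma vec_norm_le_sum: "vec_norm n \<xi> \<le> (\<Sum>i<n. norm (\<xi> i))"
  unfolding vec_norm_L2 by (rule L2_set_le_sum) auto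

lemma bounded_ops_zero: "(\<lambda>v::'h::complex_hilbert_space. 0::'h) \<in> carrier bounded_ops"
  by (rule bounded_ops.zero_closed_R)

lemma op0: "T \<in> carrier bounded_ops \<Longrightarrow> T (0::'h::complex_hilbert_space) = 0"
  by (rule bounded_ops.op_zero)

lemma op_sum: "T \<in> carrier bounded_ops \<Longrightarrow> T (\<Sum>i\<in>I. f i) = (\<Sum>i\<in>I. T (f i :: 'h::complex_hilbert_space))"
  by (induction I rule: infinite_finite_induct) (simp_all add: op0 bounded_ops.op_add)

lemma entry_mat_op:
  assumes "\<And>i j. i < n \<Longrightarrow> j < n \<Longrightarrow> X i j \<in> carrier bounded_ops" "i < n" "j < n"
  shows "entry (mat_op n X) i j = X i j"
proof
  fix v
  have "(\<Sum>k<n. X i k (if k = j then v else 0)) = (\<Sum>k<n. if k = j then X i j v else 0)"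
    using assms op0 by (intro sum.cong) auto
  then show "entry (mat_op n X) i j v = X i j v" using assms(2,3) by (simp add: entry_def mat_op_def)
qed

lemma mat_op_cong:
  "(\<And>i j. i < n \<Longrightarrow> j < n \<Longrightarrow> X i j = Y i j) \<Longrightarrow> mat_op n X = mat_op n Y"
  by (intro ext) (simp add: mat_op_def)

lemma matrix_ops_simps:
  "carrier (matrix_ops n) = {mat_op n X |X. \<forall>i<n. \<forall>j<n. X i j \<in> carrier bounded_ops}"
  "mult (matrix_ops n) = (\<circ>)" "one (matrix_ops n) = mat_op n (\<lambda>i j. if i = j then id else (\<lambda>v. 0))"
  "zero (matrix_ops n) = (\<lambda>\<xi>. 0)" "add (matrix_ops n) = (\<lambda>S T \<xi>. S \<xi> + T \<xi>)"
  "smult (matrix_ops n) = (\<lambda>c T \<xi> i. scaleC c (T \<xi> i))"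
  "star (matrix_ops n) = (\<lambda>T. mat_op n (\<lambda>i j. star bounded_ops (entry T j i)))"
  "cnorm (matrix_ops n) = (\<lambda>T. SUP \<xi>. vec_norm n (T \<xi>) / vec_norm n \<xi>)"
  by (simp_all add: matrix_ops_def)

lemma matrix_opsE:
  assumes "T \<in> carrier (matrix_ops n)"
  obtains X where "\<And>i j. i < n \<Longrightarrow> j < n \<Longrightarrow> X i j \<in> carrier bounded_ops" "T = mat_op n X"
  using assms by (auto simp: matrix_ops_simps)

lemma matrix_opsI:
  "(\<And>i j. i < n \<Longrightarrow> j < n \<Longrightarrow> X i j \<in> carrier bounded_ops) \<Longrightarrow> mat_op n X \<in> carrier (matrix_ops n)"
  by (auto simp: matrix_ops_simps)

lemma mat_op_add:
  "(\<lambda>\<xi>. mat_op n X \<xi> + mat_op n Y \<xi>) = mat_op n (\<lambda>i j. add bounded_ops (X i j) (Y i j))"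
  by (intro ext) (simp add: mat_op_def bounded_ops_simps sum.distrib)

lemma scaleC_sum: "scaleC c (\<Sum>i\<in>I. f i) = (\<Sum>i\<in>I. scaleC c (f i :: 'h::complex_hilbert_space))"
  by (induction I rule: infinite_finite_induct) (simp_all add: scaleC_zero_right scaleC_add_right)

lemma mat_op_smult: "(\<lambda>\<xi> i. scaleC c (mat_op n X \<xi> i)) = mat_op n (\<lambda>i j. smult bounded_ops c (X i j))"
  by (intro ext) (simp add: mat_op_def bounded_ops_simps scaleC_sum scaleC_zero_right)

lemma finsum_bounded_ops:
  fixes m :: nat
  assumes "\<And>k. k < m \<Longrightarrow> f k \<in> carrier bounded_ops"
  shows "finsum bounded_ops f {..<m} = (\<lambda>v::'h::complex_hilbert_space. \<Sum>k<m. f k v)"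
proof -
  interpret B: cstar_algebra "bounded_ops :: ('h \<Rightarrow> 'h) cstar" by (rule bounded_ops.cstar_algebra_R)
  show ?thesis using assms
  proof (induction m)
    case 0
    then show ?case using B.finsum_empty[of f] by (simp add: bounded_ops_simps(4))
  next
    case (Suc m)
    have "finsum bounded_ops f (insert m {..<m}) = f m \<oplus>\<^bsub>bounded_ops\<^esub> finsum bounded_ops f {..<m}"
      by (rule B.finsum_insert) (use Suc.prems in auto)
    then show ?case using Suc by (simp add: lessThan_Suc bounded_ops_simps(5) add.commute)
  qed
qed

lemma mat_op_mult:
  assumes X: "\<And>i j. i < n \<Longrightarrow> j < n \<Longrightarrow> X i j \<in> carrier bounded_ops"
    and Y: "\<And>i j. i < n \<Longrightarrow> j < n \<Longrightarrow> Y i j \<in> carrier bounded_ops"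
  shows "mat_op n X \<circ> mat_op n Y = mat_op n (\<lambda>i j. \<Oplus>\<^bsub>bounded_ops\<^esub>k\<in>{..<n}. X i k \<otimes>\<^bsub>bounded_ops\<^esub> Y k j)"
proof (intro ext)
  fix \<xi> i
  show "(mat_op n X \<circ> mat_op n Y) \<xi> i = mat_op n (\<lambda>i j. \<Oplus>\<^bsub>bounded_ops\<^esub>k\<in>{..<n}. X i k \<otimes>\<^bsub>bounded_ops\<^esub> Y k j) \<xi> i"
  proof (cases "i < n")
    case True
    have fs: "(\<Oplus>\<^bsub>bounded_ops\<^esub>k\<in>{..<n}. X i k \<otimes>\<^bsub>bounded_ops\<^esub> Y k j) v = (\<Sum>k<n. X i k (Y k j v))" if "j < n" for j v
    proof -
      have "X i k \<circ> Y k j \<in> carrier bounded_ops" if "k < n" for k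
        by (rule bounded_ops.op_comp_closed[OF X Y]) (use True \<open>j < n\<close> that in auto)
      then show ?thesis using finsum_bounded_ops[of n "\<lambda>k. X i k \<circ> Y k j"] by (simp add: bounded_ops_simps(2))
    qed
    have "(mat_op n X \<circ> mat_op n Y) \<xi> i = (\<Sum>k<n. X i k (\<Sum>j<n. Y k j (\<xi> j)))"
      using True by (simp add: mat_op_def)
    also have "\<dots> = (\<Sum>k<n. \<Sum>j<n. X i k (Y k j (\<xi> j)))" using True by (intro sum.cong refl op_sum X) auto
    also have "\<dots> = (\<Sum>j<n. \<Sum>k<n. X i k (Y k j (\<xi> j)))" by (rule sum.swap)
    also have "\<dots> = mat_op n (\<lambda>i j. \<Oplus>\<^bsub>bounded_ops\<^esub>k\<in>{..<n}. X i k \<otimes>\<^bsub>bounded_ops\<^esub> Y k j) \<xi> i"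
      using True by (simp add: mat_op_def fs)
    finally show ?thesis .
  qed (simp add: mat_op_def)
qed

lemma star_mat_op:
  assumes X: "\<And>i j. i < n \<Longrightarrow> j < n \<Longrightarrow> X i j \<in> carrier bounded_ops"
  shows "star (matrix_ops n) (mat_op n X) = mat_op n (\<lambda>i j. star bounded_ops (X j i))"
  unfolding matrix_ops_simps by (rule mat_op_cong) (simp add: entry_mat_op[OF X])

text \<open>This estimate and its converse \<open>entry_bound\<close> make convergence in the operator norm equivalent to convergence
  of every entry.\<close>

lemma vec_norm_entry_bound:
  assumes "\<And>i j v. i < n \<Longrightarrow> j < n \<Longrightarrow> norm (X i j v) \<le> e * norm v" "0 \<le> e"
  shows "vec_norm n (mat_op n X \<xi>) \<le> (real n * real n * e) * vec_norm n \<xi>"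
proof -
  have "vec_norm n (mat_op n X \<xi>) \<le> (\<Sum>i<n. norm (mat_op n X \<xi> i))" by (rule vec_norm_le_sum)
  also have "\<dots> \<le> (\<Sum>i<n. \<Sum>j<n. e * vec_norm n \<xi>)"
  proof (rule sum_mono)
    fix i assume i: "i \<in> {..<n}"
    have "norm (mat_op n X \<xi> i) \<le> (\<Sum>j<n. norm (X i j (\<xi> j)))" using i by (simp add: mat_op_def norm_sum)
    also have "\<dots> \<le> (\<Sum>j<n. e * vec_norm n \<xi>)"
    proof (rule sum_mono)
      fix j assume j: "j \<in> {..<n}"
      have "norm (X i j (\<xi> j)) \<le> e * norm (\<xi> j)" using assms(1) i j by simp
      also have "\<dots> \<le> e * vec_norm n \<xi>" using assms(2) j by (intro mult_left_mono norm_le_vec_norm) auto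
      finally show "norm (X i j (\<xi> j)) \<le> e * vec_norm n \<xi>" .
    qed
    finally show "norm (mat_op n X \<xi> i) \<le> (\<Sum>j<n. e * vec_norm n \<xi>)" .
  qed
  also have "\<dots> = (real n * real n * e) * vec_norm n \<xi>" by simp
  finally show ?thesis .
qed

lemma vec_norm_single: "j < n \<Longrightarrow> vec_norm n (\<lambda>k. if k = j then v else 0) = norm v"
proof -
  assume j: "j < n"
  have "(\<Sum>i<n. (norm (if i = j then v else 0))\<^sup>2) = (\<Sum>i<n. if i = j then (norm v)\<^sup>2 else 0)"
    by (intro sum.cong) auto
  then show ?thesis using j by (simp add: vec_norm_L2 L2_set_def)
qed

lemma entry_bound:
  assumes "\<And>\<xi>. vec_norm n (S \<xi> - T \<xi>) \<le> e * vec_norm n \<xi>" "i < n" "j < n"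
  shows "norm (entry S i j v - entry T i j v) \<le> e * norm v"
proof -
  let ?\<xi> = "\<lambda>k. if k = j then v else 0"
  have "norm (entry S i j v - entry T i j v) \<le> vec_norm n (S ?\<xi> - T ?\<xi>)"
    unfolding entry_def using norm_le_vec_norm[OF assms(2), of "S ?\<xi> - T ?\<xi>"] by simp
  also have "\<dots> \<le> e * norm v" using assms(1)[of ?\<xi>] vec_norm_single[OF assms(3), of v] by simp
  finally show ?thesis .
qed

lemma matrix_ops_complete:
  fixes X :: "nat \<Rightarrow> (nat \<Rightarrow> 'h::complex_hilbert_space) \<Rightarrow> nat \<Rightarrow> 'h"
  assumes X: "\<And>m. X m \<in> carrier (matrix_ops n)"
    and C: "\<And>e. e > 0 \<Longrightarrow> \<exists>M. \<forall>m\<ge>M. \<forall>k\<ge>M. \<forall>\<xi>. vec_norm n (X m \<xi> - X k \<xi>) \<le> e * vec_norm n \<xi>"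
  shows "\<exists>T\<in>carrier (matrix_ops n). \<forall>e>0. \<exists>M. \<forall>m\<ge>M. \<forall>\<xi>. vec_norm n (X m \<xi> - T \<xi>) \<le> e * vec_norm n \<xi>"
proof -
  have Xe: "X m = mat_op n (entry (X m))" "\<And>i j. i < n \<Longrightarrow> j < n \<Longrightarrow> entry (X m) i j \<in> carrier bounded_ops" for m
  proof -
    obtain Y where Y: "\<And>i j. i < n \<Longrightarrow> j < n \<Longrightarrow> Y i j \<in> carrier bounded_ops" "X m = mat_op n Y"
      using matrix_opsE[OF X] by blast
    show "entry (X m) i j \<in> carrier bounded_ops" if "i < n" "j < n" for i j
      using Y that by (simp add: entry_mat_op)
    show "X m = mat_op n (entry (X m))" unfolding Y(2) by (rule mat_op_cong) (simp add: entry_mat_op Y(1))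
  qed
  have "\<exists>S\<in>carrier bounded_ops. \<forall>e>0. \<exists>M. \<forall>m\<ge>M. \<forall>v. norm (entry (X m) i j v - S v) \<le> e * norm v"
    if ij: "i < n" "j < n" for i j
  proof (rule bounded_ops_complete)
    show "entry (X m) i j \<in> carrier bounded_ops" for m using Xe(2) ij by blast
    fix e :: real assume "e > 0"
    from C[OF this] obtain M where "\<forall>m\<ge>M. \<forall>k\<ge>M. \<forall>\<xi>. vec_norm n (X m \<xi> - X k \<xi>) \<le> e * vec_norm n \<xi>" by blast
    then show "\<exists>M. \<forall>m\<ge>M. \<forall>k\<ge>M. \<forall>v. norm (entry (X m) i j v - entry (X k) i j v) \<le> e * norm v"
      using entry_bound[OF _ ij] by meson
  qed
  then obtain S where S: "\<And>i j. i < n \<Longrightarrow> j < n \<Longrightarrow> S i j \<in> carrier bounded_ops"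
    and L: "\<And>i j e. i < n \<Longrightarrow> j < n \<Longrightarrow> e > 0 \<Longrightarrow> \<exists>M. \<forall>m\<ge>M. \<forall>v. norm (entry (X m) i j v - S i j v) \<le> e * norm v"
    by metis
  have "\<exists>M. \<forall>m\<ge>M. \<forall>\<xi>. vec_norm n (X m \<xi> - mat_op n S \<xi>) \<le> e * vec_norm n \<xi>" if e: "e > 0" for e
  proof -
    define d where "d = e / (real n * real n + 1)"
    have np: "0 < real n * real n + 1" by (simp add: add_nonneg_pos)
    have d: "d > 0" unfolding d_def using e np by (rule divide_pos_pos)
    have "\<exists>M. \<forall>i<n. \<forall>j<n. \<forall>m\<ge>M. \<forall>v. norm (entry (X m) i j v - S i j v) \<le> d * norm v"
    proof -
      obtain M where M: "\<And>i j m v. i < n \<Longrightarrow> j < n \<Longrightarrow> m \<ge> M i j \<Longrightarrow> norm (entry (X m) i j v - S i j v) \<le> d * norm v"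
        using L[OF _ _ d] by metis
      have "M i j \<le> (\<Sum>i<n. \<Sum>j<n. M i j)" if "i < n" "j < n" for i j
      proof -
        have "M i j \<le> (\<Sum>j<n. M i j)" using that by (intro member_le_sum) auto
        also have "\<dots> \<le> (\<Sum>i<n. \<Sum>j<n. M i j)" using that by (intro member_le_sum) auto
        finally show ?thesis .
      qed
      then show ?thesis using M by (meson order_trans)
    qed
    then obtain M where M: "\<And>i j m v. i < n \<Longrightarrow> j < n \<Longrightarrow> m \<ge> M \<Longrightarrow> norm (entry (X m) i j v - S i j v) \<le> d * norm v" by blast
    have "vec_norm n (X m \<xi> - mat_op n S \<xi>) \<le> e * vec_norm n \<xi>" if m: "m \<ge> M" for m \<xi>
    proof -
      have "X m \<xi> - mat_op n S \<xi> = mat_op n (\<lambda>i j v. entry (X m) i j v - S i j v) \<xi>"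
        by (subst Xe(1)) (auto simp: mat_op_def fun_eq_iff sum_subtractf)
      then have "vec_norm n (X m \<xi> - mat_op n S \<xi>) \<le> (real n * real n * d) * vec_norm n \<xi>"
        using vec_norm_entry_bound[of n "\<lambda>i j v. entry (X m) i j v - S i j v" d \<xi>] M[OF _ _ m] d by simp
      also have "real n * real n * d \<le> e"
        unfolding d_def using e np by (simp add: field_simps)
      then have "(real n * real n * d) * vec_norm n \<xi> \<le> e * vec_norm n \<xi>"
        by (intro mult_right_mono) (auto simp: vec_norm_L2)
      finally show ?thesis .
    qed
    then show ?thesis by blast
  qed
  then show ?thesis using matrix_opsI[of n S] S by blast
qed

lemma operator_algebra_matrix_ops:
  "operator_algebra (matrix_ops n :: ((nat \<Rightarrow> 'h) \<Rightarrow> nat \<Rightarrow> 'h::complex_hilbert_space) cstar)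
     (\<lambda>c \<xi> i. scaleC c (\<xi> i)) (vec_ip n) (vec_norm n)"
proof
  show "vec_norm n \<xi> = sqrt (Re (vec_ip n \<xi> \<xi>))" for \<xi> :: "nat \<Rightarrow> 'h" by (rule vec_norm_def)
  show "vec_ip n \<xi> \<eta> = cnj (vec_ip n \<eta> \<xi>)" for \<xi> \<eta> :: "nat \<Rightarrow> 'h"
    unfolding vec_ip_def cnj_sum by (intro sum.cong refl cinner_commute)
  show "0 \<le> Re (vec_ip n \<xi> \<xi>)" for \<xi> :: "nat \<Rightarrow> 'h" by (simp add: vec_ip_def cinner_self sum_nonneg)
  show "\<one>\<^bsub>matrix_ops n\<^esub> \<in> carrier (matrix_ops n :: ((nat \<Rightarrow> 'h) \<Rightarrow> nat \<Rightarrow> 'h) cstar)"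
    unfolding matrix_ops_simps(3) by (rule matrix_opsI) (simp add: bounded_ops_zero bounded_ops.one_carrier[unfolded bounded_ops_simps(3)])
next
  fix T :: "(nat \<Rightarrow> 'h) \<Rightarrow> nat \<Rightarrow> 'h" assume "T \<in> carrier (matrix_ops n)"
  then obtain X where X: "\<And>i j. i < n \<Longrightarrow> j < n \<Longrightarrow> X i j \<in> carrier bounded_ops" and T: "T = mat_op n X"
    using matrix_opsE by blast
  show "T (\<xi> + \<eta>) = T \<xi> + T \<eta>" for \<xi> \<eta>
    unfolding T by (intro ext) (simp add: mat_op_def X bounded_ops.op_add flip: sum.distrib)
  show "T (\<lambda>i. scaleC c (\<xi> i)) = (\<lambda>i. scaleC c (T \<xi> i))" for c \<xi>
    unfolding T by (intro ext) (simp add: mat_op_def X bounded_ops.op_sc scaleC_sum scaleC_zero_right)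
  show "\<exists>K. \<forall>\<xi>. vec_norm n (T \<xi>) \<le> K * vec_norm n \<xi>"
  proof -
    define K where "K = (\<Sum>i<n. \<Sum>j<n. cnorm bounded_ops (X i j))"
    have "norm (X i j v) \<le> K * norm v" if "i < n" "j < n" for i j v
    proof -
      have nn: "0 \<le> cnorm bounded_ops (X i j)" if "i < n" "j < n" for i j using bounded_ops.cnorm_bound(2)[OF X[OF that]] .
      have "cnorm bounded_ops (X i j) \<le> (\<Sum>j<n. cnorm bounded_ops (X i j))"
        using that nn by (intro member_le_sum) auto
      also have "\<dots> \<le> K" unfolding K_def using that nn by (intro member_le_sum) (auto intro!: sum_nonneg)
      finally show ?thesis
        using bounded_ops.cnorm_bound(1)[OF X[OF that], of v] mult_right_mono[of _ K "norm v"] by (meson norm_ge_zero order_trans)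
    qed
    moreover have "0 \<le> K" unfolding K_def by (intro sum_nonneg bounded_ops.cnorm_bound(2) X) auto
    ultimately show ?thesis unfolding T using vec_norm_entry_bound by metis
  qed
  show "(\<lambda>\<xi> i. scaleC c (T \<xi> i)) \<in> carrier (matrix_ops n)" for c
    unfolding T mat_op_smult by (rule matrix_opsI) (simp add: X bounded_ops.op_sc_closed bounded_ops_simps(6))
  show "\<one>\<^bsub>matrix_ops n\<^esub> \<circ> T = T"
    unfolding T matrix_ops_simps(3)
  proof (intro ext)
    fix \<xi> :: "nat \<Rightarrow> 'h" and i
    have "(\<Sum>j<n. (if i = j then id else (\<lambda>v. 0)) (mat_op n X \<xi> j)) = (\<Sum>j<n. if i = j then mat_op n X \<xi> j else 0)"
      by (intro sum.cong) auto
    also have "\<dots> = (if i < n then mat_op n X \<xi> i else 0)" by simp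
    finally show "(mat_op n (\<lambda>i j. if i = j then id else (\<lambda>v. 0)) \<circ> mat_op n X) \<xi> i = mat_op n X \<xi> i"
      unfolding comp_def mat_op_def[of n "\<lambda>i j. if i = j then id else (\<lambda>v. 0)"] by (auto simp: mat_op_def)
  qed
  show "T \<circ> \<one>\<^bsub>matrix_ops n\<^esub> = T"
    unfolding T matrix_ops_simps(3)
  proof (intro ext)
    fix \<xi> :: "nat \<Rightarrow> 'h" and i
    have "mat_op n (\<lambda>i j. if i = j then id else (\<lambda>v. 0)) \<xi> k = \<xi> k" if "k < n" for k
    proof -
      have "(\<Sum>j<n. (if k = j then id else (\<lambda>v. 0)) (\<xi> j)) = (\<Sum>j<n. if k = j then \<xi> j else 0)"
        by (intro sum.cong) auto
      then show ?thesis using that by (simp add: mat_op_def)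
    qed
    then show "(mat_op n X \<circ> mat_op n (\<lambda>i j. if i = j then id else (\<lambda>v. 0))) \<xi> i = mat_op n X \<xi> i"
      unfolding comp_def mat_op_def[of n X] by simp
  qed
  have star: "star (matrix_ops n) T = mat_op n (\<lambda>i j. star bounded_ops (X j i))" unfolding T by (rule star_mat_op[OF X])
  show "star (matrix_ops n) T \<in> carrier (matrix_ops n)"
    unfolding star by (rule matrix_opsI) (simp add: X bounded_ops.star_carrier)
  show "vec_ip n (T \<xi>) \<eta> = vec_ip n \<xi> (star (matrix_ops n) T \<eta>)" for \<xi> \<eta>
  proof -
    have suml: "cinner (\<Sum>i\<in>I. f i) y = (\<Sum>i\<in>I. cinner (f i) y)" for f :: "nat \<Rightarrow> 'h" and I y
      using cinner_scaleC_left[of 0 0 y]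
      by (induction I rule: infinite_finite_induct) (simp_all add: cinner_add_left scaleC_zero_right)
    have sumr: "cinner y (\<Sum>i\<in>I. f i) = (\<Sum>i\<in>I. cinner y (f i))" for f :: "nat \<Rightarrow> 'h" and I y
      using cinner_scaleC_right[of y 0 0]
      by (induction I rule: infinite_finite_induct) (simp_all add: cinner_add_right scaleC_zero_right)
    have "vec_ip n (T \<xi>) \<eta> = (\<Sum>i<n. \<Sum>j<n. cinner (X i j (\<xi> j)) (\<eta> i))"
      by (simp add: T vec_ip_def mat_op_def suml)
    also have "\<dots> = (\<Sum>i<n. \<Sum>j<n. cinner (\<xi> j) (star bounded_ops (X i j) (\<eta> i)))"
      using X by (intro sum.cong refl bounded_ops.star_adjoint) auto
    also have "\<dots> = (\<Sum>j<n. \<Sum>i<n. cinner (\<xi> j) (star bounded_ops (X i j) (\<eta> i)))" by (rule sum.swap)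
    also have "\<dots> = vec_ip n \<xi> (star (matrix_ops n) T \<eta>)"
      unfolding star by (simp add: vec_ip_def mat_op_def sumr)
    finally show ?thesis .
  qed
  show "T = (\<lambda>\<xi>. 0)" if "\<And>\<xi>. vec_norm n (T \<xi>) = 0"
  proof (intro ext)
    fix \<xi> i
    show "T \<xi> i = (0 :: nat \<Rightarrow> 'h) i"
      using norm_le_vec_norm[of i n "T \<xi>"] that[of \<xi>] by (cases "i < n") (simp_all add: T mat_op_def)
  qed
next
  fix S T :: "(nat \<Rightarrow> 'h) \<Rightarrow> nat \<Rightarrow> 'h"
  assume "S \<in> carrier (matrix_ops n)" "T \<in> carrier (matrix_ops n)"
  then obtain X Y where X: "\<And>i j. i < n \<Longrightarrow> j < n \<Longrightarrow> X i j \<in> carrier bounded_ops" "S = mat_op n X"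
    and Y: "\<And>i j. i < n \<Longrightarrow> j < n \<Longrightarrow> Y i j \<in> carrier bounded_ops" "T = mat_op n Y"
    using matrix_opsE by metis
  interpret B: cstar_algebra "bounded_ops :: ('h \<Rightarrow> 'h) cstar" by (rule bounded_ops.cstar_algebra_R)
  have "S \<circ> T = mat_op n (\<lambda>i j. \<Oplus>\<^bsub>bounded_ops\<^esub>k\<in>{..<n}. X i k \<otimes>\<^bsub>bounded_ops\<^esub> Y k j)"
    unfolding X(2) Y(2) by (rule mat_op_mult) (use X(1) Y(1) in auto)
  moreover have "mat_op n (\<lambda>i j. \<Oplus>\<^bsub>bounded_ops\<^esub>k\<in>{..<n}. X i k \<otimes>\<^bsub>bounded_ops\<^esub> Y k j) \<in> carrier (matrix_ops n)"
    by (rule matrix_opsI, rule B.finsum_closed) (use X(1) Y(1) in auto)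
  ultimately show "S \<circ> T \<in> carrier (matrix_ops n)" by simp
  show "(\<lambda>\<xi>. S \<xi> + T \<xi>) \<in> carrier (matrix_ops n)"
    unfolding X(2) Y(2) mat_op_add by (rule matrix_opsI) (use X(1) Y(1) in auto)
next
  fix X :: "nat \<Rightarrow> (nat \<Rightarrow> 'h) \<Rightarrow> nat \<Rightarrow> 'h"
  assume "\<And>m. X m \<in> carrier (matrix_ops n)"
    "\<And>e. e > 0 \<Longrightarrow> \<exists>M. \<forall>m\<ge>M. \<forall>k\<ge>M. \<forall>\<xi>. vec_norm n (X m \<xi> - X k \<xi>) \<le> e * vec_norm n \<xi>"
  then show "\<exists>T\<in>carrier (matrix_ops n). \<forall>e>0. \<exists>M. \<forall>m\<ge>M. \<forall>\<xi>. vec_norm n (X m \<xi> - T \<xi>) \<le> e * vec_norm n \<xi>"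
    by (rule matrix_ops_complete)
qed (auto simp: matrix_ops_simps(2,4,5,6,8) scaleC_add_right scaleC_add_left scaleC_scaleC scaleC_1
      vec_ip_def cinner_add_left cinner_scaleC_left sum.distrib sum_distrib_left)

text \<open>Spectral permanence for matrix algebras. Since \<open>\<pi>\<close> is isometric, the matrices with entries in \<open>\<pi>(A)\<close> form a closed
  subalgebra \<open>P\<close> of the matrices of bounded operators. The root of a positive element produced by \<open>root_one_minus\<close>
  lies in every closed subalgebra that contains the element, and \<open>\<pi>\<close> is injective, so the root can be
  pulled back to \<open>A\<close>.\<close>

lemma matrix_pos_reflect:
  fixes \<pi> :: "'a \<Rightarrow> 'h::complex_hilbert_space \<Rightarrow> 'h"
  assumes A: "cstar_algebra A" and hom: "unital_star_hom A bounded_ops \<pi>" and inj: "inj_on \<pi> (carrier A)"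
    and x: "\<And>i j. i < n \<Longrightarrow> j < n \<Longrightarrow> x i j \<in> carrier A"
    and pos: "matrix_pos bounded_ops n (\<lambda>i j. \<pi> (x i j))"
  shows "matrix_pos A n x"
proof -
  interpret star_hom A "bounded_ops :: ('h \<Rightarrow> 'h) cstar" \<pi>
    by (intro star_hom.intro star_hom_axioms.intro A hom bounded_ops.cstar_algebra_R)
  interpret MO: operator_algebra "matrix_ops n :: ((nat \<Rightarrow> 'h) \<Rightarrow> nat \<Rightarrow> 'h) cstar" "\<lambda>c \<xi> i. scaleC c (\<xi> i)" "vec_ip n" "vec_norm n"
    by (rule operator_algebra_matrix_ops)
  interpret M: cstar_algebra "matrix_ops n :: ((nat \<Rightarrow> 'h) \<Rightarrow> nat \<Rightarrow> 'h) cstar" by (rule MO.cstar_algebra_R)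
  let ?M = "matrix_ops n :: ((nat \<Rightarrow> 'h) \<Rightarrow> nat \<Rightarrow> 'h) cstar"
  define P where "P = {mat_op n (\<lambda>i j. \<pi> (z i j)) |z. \<forall>i<n. \<forall>j<n. z i j \<in> carrier A}"
  have PI: "mat_op n (\<lambda>i j. \<pi> (z i j)) \<in> P" if "\<And>i j. i < n \<Longrightarrow> j < n \<Longrightarrow> z i j \<in> carrier A" for z
    unfolding P_def using that by blast
  have \<pi>_finsum: "\<pi> (\<Oplus>\<^bsub>A\<^esub>k\<in>{..<m}. g k) = (\<Oplus>\<^bsub>bounded_ops\<^esub>k\<in>{..<m}. \<pi> (g k))"
    if "\<And>k. k < m \<Longrightarrow> g k \<in> carrier A" for g and m :: nat
    using that
  proof (induction m)
    case (Suc m)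
    have "g \<in> {..<m} \<rightarrow> carrier A" "g m \<in> carrier A" using Suc.prems by auto
    then show ?case
      using A.finsum_insert[of "{..<m}" m g] B.finsum_insert[of "{..<m}" m "\<lambda>k. \<pi> (g k)"] Suc.IH Suc.prems
        A.finsum_closed[of g "{..<m}"]
      by (simp add: lessThan_Suc Pi_def)
  qed (simp add: A.finsum_empty B.finsum_empty)
  have mult_P: "mat_op n (\<lambda>i j. \<pi> (z i j)) \<circ> mat_op n (\<lambda>i j. \<pi> (w i j)) =
      mat_op n (\<lambda>i j. \<pi> (\<Oplus>\<^bsub>A\<^esub>k\<in>{..<n}. z i k \<otimes>\<^bsub>A\<^esub> w k j))"
    if z: "\<And>i j. i < n \<Longrightarrow> j < n \<Longrightarrow> z i j \<in> carrier A" and w: "\<And>i j. i < n \<Longrightarrow> j < n \<Longrightarrow> w i j \<in> carrier A" for z w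
  proof -
    have "mat_op n (\<lambda>i j. \<pi> (z i j)) \<circ> mat_op n (\<lambda>i j. \<pi> (w i j)) =
        mat_op n (\<lambda>i j. \<Oplus>\<^bsub>bounded_ops\<^esub>k\<in>{..<n}. \<pi> (z i k) \<otimes>\<^bsub>bounded_ops\<^esub> \<pi> (w k j))"
      by (rule mat_op_mult) (use z w in auto)
    also have "\<dots> = mat_op n (\<lambda>i j. \<pi> (\<Oplus>\<^bsub>A\<^esub>k\<in>{..<n}. z i k \<otimes>\<^bsub>A\<^esub> w k j))"
    proof (rule mat_op_cong)
      fix i j assume ij: "i < n" "j < n"
      have "(\<Oplus>\<^bsub>bounded_ops\<^esub>k\<in>{..<n}. \<pi> (z i k) \<otimes>\<^bsub>bounded_ops\<^esub> \<pi> (w k j)) = (\<Oplus>\<^bsub>bounded_ops\<^esub>k\<in>{..<n}. \<pi> (z i k \<otimes>\<^bsub>A\<^esub> w k j))"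
        by (rule B.finsum_cong') (use z w ij in auto)
      then show "(\<Oplus>\<^bsub>bounded_ops\<^esub>k\<in>{..<n}. \<pi> (z i k) \<otimes>\<^bsub>bounded_ops\<^esub> \<pi> (w k j)) = \<pi> (\<Oplus>\<^bsub>A\<^esub>k\<in>{..<n}. z i k \<otimes>\<^bsub>A\<^esub> w k j)"
        using \<pi>_finsum[of n "\<lambda>k. z i k \<otimes>\<^bsub>A\<^esub> w k j"] z w ij by simp
    qed
    finally show ?thesis .
  qed
  have closed: "M.closed_subalgebra P"
  proof (rule M.closed_subalgebraI)
    show "P \<subseteq> carrier ?M" unfolding P_def by (auto intro!: matrix_opsI)
    have "mat_op n (\<lambda>i j. \<pi> \<zero>\<^bsub>A\<^esub>) = (\<lambda>\<xi>. 0)" by (intro ext) (simp add: mat_op_def bounded_ops_simps(4))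
    then show "\<zero>\<^bsub>?M\<^esub> \<in> P" using PI[of "\<lambda>i j. \<zero>\<^bsub>A\<^esub>"] by (simp add: matrix_ops_simps(4))
  next
    fix S T assume "S \<in> P" "T \<in> P"
    then obtain z w where z: "\<And>i j. i < n \<Longrightarrow> j < n \<Longrightarrow> z i j \<in> carrier A" "S = mat_op n (\<lambda>i j. \<pi> (z i j))"
      and w: "\<And>i j. i < n \<Longrightarrow> j < n \<Longrightarrow> w i j \<in> carrier A" "T = mat_op n (\<lambda>i j. \<pi> (w i j))"
      unfolding P_def by blast
    have "S \<oplus>\<^bsub>?M\<^esub> T = mat_op n (\<lambda>i j. \<pi> (z i j \<oplus>\<^bsub>A\<^esub> w i j))"
      unfolding z(2) w(2) matrix_ops_simps mat_op_add by (rule mat_op_cong) (simp add: z(1) w(1))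
    then show "S \<oplus>\<^bsub>?M\<^esub> T \<in> P" using PI[of "\<lambda>i j. z i j \<oplus>\<^bsub>A\<^esub> w i j"] z(1) w(1) by simp
    have "S \<otimes>\<^bsub>?M\<^esub> T = mat_op n (\<lambda>i j. \<pi> (\<Oplus>\<^bsub>A\<^esub>k\<in>{..<n}. z i k \<otimes>\<^bsub>A\<^esub> w k j))"
      unfolding z(2) w(2) matrix_ops_simps by (rule mult_P[OF z(1) w(1)])
    moreover have "(\<Oplus>\<^bsub>A\<^esub>k\<in>{..<n}. z i k \<otimes>\<^bsub>A\<^esub> w k j) \<in> carrier A" if "i < n" "j < n" for i j
      by (rule A.finsum_closed) (use z(1) w(1) that in auto)
    ultimately show "S \<otimes>\<^bsub>?M\<^esub> T \<in> P" using PI[of "\<lambda>i j. \<Oplus>\<^bsub>A\<^esub>k\<in>{..<n}. z i k \<otimes>\<^bsub>A\<^esub> w k j"] by simp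
  next
    fix c S assume "S \<in> P"
    then obtain z where z: "\<And>i j. i < n \<Longrightarrow> j < n \<Longrightarrow> z i j \<in> carrier A" "S = mat_op n (\<lambda>i j. \<pi> (z i j))"
      unfolding P_def by blast
    have "c \<odot>\<^bsub>?M\<^esub> S = mat_op n (\<lambda>i j. \<pi> (c \<odot>\<^bsub>A\<^esub> z i j))"
      unfolding z(2) matrix_ops_simps mat_op_smult by (rule mat_op_cong) (simp add: z(1))
    then show "c \<odot>\<^bsub>?M\<^esub> S \<in> P" using PI[of "\<lambda>i j. c \<odot>\<^bsub>A\<^esub> z i j"] z(1) by simp
  next
    fix X T assume X: "\<And>m. X m \<in> P" and T: "T \<in> carrier ?M" and lim: "M.limit X T"
    have "\<forall>m. \<exists>z. (\<forall>i<n. \<forall>j<n. z i j \<in> carrier A) \<and> X m = mat_op n (\<lambda>i j. \<pi> (z i j))" using X unfolding P_def by blast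
    then obtain z where z: "\<And>m i j. i < n \<Longrightarrow> j < n \<Longrightarrow> z m i j \<in> carrier A" and Xz: "\<And>m. X m = mat_op n (\<lambda>i j. \<pi> (z m i j))" by metis
    obtain Y where Y: "\<And>i j. i < n \<Longrightarrow> j < n \<Longrightarrow> Y i j \<in> carrier bounded_ops" "T = mat_op n Y" using matrix_opsE[OF T] by blast
    have Xcl: "X m \<in> carrier ?M" for m unfolding Xz by (rule matrix_opsI) (simp add: z)
    \<comment> \<open>Entries of a convergent sequence in \<open>P\<close> converge, and isometry makes their preimages Cauchy in \<open>A\<close>.\<close>
    have "\<exists>y\<in>carrier A. Y i j = \<pi> y" if ij: "i < n" "j < n" for i j
    proof -
      have le: "cnorm bounded_ops (\<pi> (z m i j) \<ominus>\<^bsub>bounded_ops\<^esub> Y i j) \<le> cnorm ?M (X m \<ominus>\<^bsub>?M\<^esub> T)" for m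
      proof -
        have "cnorm bounded_ops (\<lambda>v. \<pi> (z m i j) v - Y i j v) \<le> cnorm ?M (X m \<ominus>\<^bsub>?M\<^esub> T)"
        proof (rule bounded_ops.cnorm_le)
          fix v
          have "vec_norm n (X m \<xi> - T \<xi>) \<le> cnorm ?M (X m \<ominus>\<^bsub>?M\<^esub> T) * vec_norm n \<xi>" for \<xi>
            using MO.cnorm_bound(1)[OF M.minus_closed_A[OF Xcl T], of m \<xi>] unfolding MO.diff_R[OF Xcl T] .
          then have "norm (entry (X m) i j v - entry T i j v) \<le> cnorm ?M (X m \<ominus>\<^bsub>?M\<^esub> T) * norm v"
            by (rule entry_bound[OF _ ij])
          moreover have "entry (X m) i j = \<pi> (z m i j)"
            unfolding Xz by (rule entry_mat_op[of n "\<lambda>i j. \<pi> (z m i j)"]) (use z ij in auto)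
          ultimately show "norm (\<pi> (z m i j) v - Y i j v) \<le> cnorm ?M (X m \<ominus>\<^bsub>?M\<^esub> T) * norm v"
            using Y ij by (simp add: entry_mat_op)
        qed (use M.minus_closed_A[OF Xcl T] in simp)
        then show ?thesis using bounded_ops.diff_R[of "\<pi> (z m i j)" "Y i j"] z Y(1) ij by simp
      qed
      have limY: "B.limit (\<lambda>m. \<pi> (z m i j)) (Y i j)"
        by (rule B.limit_squeeze[OF le lim[unfolded M.limit_def]]) (use z Y(1) ij in auto)
      have "\<exists>y\<in>carrier A. (\<lambda>m. cnorm A (z m i j \<ominus>\<^bsub>A\<^esub> y)) \<longlonglongrightarrow> 0"
      proof (rule A.cnorm_complete)
        fix e :: real assume e: "e > 0"
        have "0 < e / 2" using e by simp
        from LIMSEQ_D[OF limY[unfolded B.limit_def] this] obtain N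
          where N0: "\<forall>m\<ge>N. norm (cnorm bounded_ops (\<pi> (z m i j) \<ominus>\<^bsub>bounded_ops\<^esub> Y i j) - 0) < e / 2" by blast
        have N: "cnorm bounded_ops (\<pi> (z m i j) \<ominus>\<^bsub>bounded_ops\<^esub> Y i j) < e / 2" if "m \<ge> N" for m
          using spec[OF N0, of m] that by simp
        have "cnorm A (z k i j \<ominus>\<^bsub>A\<^esub> z l i j) < e" if "k \<ge> N" "l \<ge> N" for k l
        proof -
          have "cnorm A (z k i j \<ominus>\<^bsub>A\<^esub> z l i j) = cnorm bounded_ops (\<pi> (z k i j) \<ominus>\<^bsub>bounded_ops\<^esub> \<pi> (z l i j))"
            using isometric[OF inj, of "z k i j \<ominus>\<^bsub>A\<^esub> z l i j"] z[OF ij] by simp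
          also have "\<dots> \<le> cnorm bounded_ops (\<pi> (z k i j) \<ominus>\<^bsub>bounded_ops\<^esub> Y i j) + cnorm bounded_ops (Y i j \<ominus>\<^bsub>bounded_ops\<^esub> \<pi> (z l i j))"
            by (rule B.cnorm_triangle3) (use z Y(1) ij in auto)
          also have "\<dots> < e" using N[OF that(1)] N[OF that(2)] B.cnorm_diff_commute[of "Y i j" "\<pi> (z l i j)"] z Y(1) ij by simp
          finally show ?thesis .
        qed
        then show "\<exists>N. \<forall>k\<ge>N. \<forall>l\<ge>N. cnorm A (z k i j \<ominus>\<^bsub>A\<^esub> z l i j) < e" by blast
      qed (use z ij in auto)
      then obtain y where y: "y \<in> carrier A" "A.limit (\<lambda>m. z m i j) y" unfolding A.limit_def by blast
      have "B.limit (\<lambda>m. \<pi> (z m i j)) (\<pi> y)"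
      proof (rule B.limit_squeeze[OF _ y(2)[unfolded A.limit_def]])
        show "cnorm bounded_ops (\<pi> (z m i j) \<ominus>\<^bsub>bounded_ops\<^esub> \<pi> y) \<le> cnorm A (z m i j \<ominus>\<^bsub>A\<^esub> y)" for m
          using contractive[of "z m i j \<ominus>\<^bsub>A\<^esub> y"] z[OF ij] y(1) by simp
      qed (use z ij y(1) in auto)
      then have "Y i j = \<pi> y" using B.limit_unique[OF limY] z Y(1) ij y(1) by simp
      then show ?thesis using y(1) by blast
    qed
    then obtain y where y: "\<And>i j. i < n \<Longrightarrow> j < n \<Longrightarrow> y i j \<in> carrier A \<and> Y i j = \<pi> (y i j)" by metis
    have "T = mat_op n (\<lambda>i j. \<pi> (y i j))" unfolding Y(2) by (rule mat_op_cong) (simp add: y)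
    then show "T \<in> P" using PI[of y] y by simp
  qed
  have one_P: "\<one>\<^bsub>?M\<^esub> \<in> P"
  proof -
    have "\<one>\<^bsub>?M\<^esub> = mat_op n (\<lambda>i j. \<pi> (if i = j then \<one>\<^bsub>A\<^esub> else \<zero>\<^bsub>A\<^esub>))"
      unfolding matrix_ops_simps by (rule mat_op_cong) (simp add: bounded_ops_simps(3,4))
    then show ?thesis using PI[of "\<lambda>i j. if i = j then \<one>\<^bsub>A\<^esub> else \<zero>\<^bsub>A\<^esub>"] by simp
  qed
  note clP = closed[unfolded M.closed_subalgebra_def]
  have diff_P: "S \<ominus>\<^bsub>?M\<^esub> T \<in> P" if "S \<in> P" "T \<in> P" for S T
  proof -
    have "S \<oplus>\<^bsub>?M\<^esub> (-1) \<odot>\<^bsub>?M\<^esub> T \<in> P" using that clP by blast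
    moreover have "S \<in> carrier ?M" "T \<in> carrier ?M" using that clP by blast+
    ultimately show ?thesis using M.diff_smult by simp
  qed
  \<comment> \<open>By \<open>pos_star_mult\<close> the matrix \<open>T = S\<^sup>* S\<close> is the square of a self-adjoint operator.\<close>
  define T where "T = mat_op n (\<lambda>i j. \<pi> (x i j))"
  have TP: "T \<in> P" unfolding T_def by (rule PI[OF x])
  have "M.pos T"
  proof -
    obtain Y where Y: "\<forall>i<n. \<forall>j<n. Y i j \<in> carrier bounded_ops"
      and XY: "\<forall>i<n. \<forall>j<n. \<pi> (x i j) = (\<Oplus>\<^bsub>bounded_ops\<^esub>k\<in>{..<n}. star bounded_ops (Y k i) \<otimes>\<^bsub>bounded_ops\<^esub> Y k j)"
      using pos unfolding matrix_pos_def by blast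
    define S where "S = mat_op n Y"
    have S: "S \<in> carrier ?M" unfolding S_def by (rule matrix_opsI) (use Y in blast)
    have "star ?M S \<otimes>\<^bsub>?M\<^esub> S = mat_op n (\<lambda>i j. star bounded_ops (Y j i)) \<circ> mat_op n Y"
      unfolding S_def using star_mat_op[of n Y] Y by (simp add: matrix_ops_simps(2))
    also have "\<dots> = mat_op n (\<lambda>i j. \<Oplus>\<^bsub>bounded_ops\<^esub>k\<in>{..<n}. star bounded_ops (Y k i) \<otimes>\<^bsub>bounded_ops\<^esub> Y k j)"
      by (rule mat_op_mult) (use Y in auto)
    also have "\<dots> = T" unfolding T_def by (rule mat_op_cong) (use XY in auto)
    finally show ?thesis using M.pos_star_mult[OF S] by simp
  qed
  then have T: "T \<in> carrier ?M" "star ?M T = T" using M.pos_sa by simp_all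
  define t where "t = cnorm ?M T + 1"
  have t: "0 < t" "cnorm ?M T \<le> t" unfolding t_def using M.cnorm_nonneg[OF T(1)] by linarith+
  \<comment> \<open>The factor \<open>t\<close> scales \<open>T\<close> into the range where \<open>root_one_minus\<close> applies to \<open>1 - T / t\<close>.\<close>
  define y where "y = \<one>\<^bsub>?M\<^esub> \<ominus>\<^bsub>?M\<^esub> complex_of_real (1/t) \<odot>\<^bsub>?M\<^esub> T"
  have y: "y \<in> carrier ?M" "star ?M y = y" "cnorm ?M y \<le> 1"
    using T M.pos_bound[OF \<open>M.pos T\<close> t(2,1)] by (simp_all add: y_def)
  have yP: "y \<in> P" unfolding y_def by (intro diff_P one_P) (use TP clP in blast)
  obtain r where r: "r \<in> carrier ?M" "star ?M r = r" "r \<otimes>\<^bsub>?M\<^esub> r = \<one>\<^bsub>?M\<^esub> \<ominus>\<^bsub>?M\<^esub> y"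
    and rP: "\<forall>M'. M.closed_subalgebra M' \<longrightarrow> y \<in> M' \<longrightarrow> \<one>\<^bsub>?M\<^esub> \<ominus>\<^bsub>?M\<^esub> r \<in> M'"
    using M.root_one_minus[OF y] by (elim bexE conjE) (rule that, assumption+)
  have "\<one>\<^bsub>?M\<^esub> \<ominus>\<^bsub>?M\<^esub> r \<in> P" using rP closed yP by blast
  from diff_P[OF one_P this] have "\<one>\<^bsub>?M\<^esub> \<ominus>\<^bsub>?M\<^esub> (\<one>\<^bsub>?M\<^esub> \<ominus>\<^bsub>?M\<^esub> r) \<in> P" .
  moreover have "\<one>\<^bsub>?M\<^esub> \<ominus>\<^bsub>?M\<^esub> (\<one>\<^bsub>?M\<^esub> \<ominus>\<^bsub>?M\<^esub> r) = r" using r(1) by (simp add: M.ring_normalize)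
  ultimately have "r \<in> P" by simp
  define R where "R = complex_of_real (sqrt t) \<odot>\<^bsub>?M\<^esub> r"
  have "R \<in> P" unfolding R_def using \<open>r \<in> P\<close> clP by blast
  have "star ?M R \<otimes>\<^bsub>?M\<^esub> R = complex_of_real t \<odot>\<^bsub>?M\<^esub> (r \<otimes>\<^bsub>?M\<^esub> r)"
    unfolding R_def using r(1,2) t(1) by (simp add: M.smult_mult_left M.smult_mult_right M.smult_smult flip: of_real_mult)
  also have "r \<otimes>\<^bsub>?M\<^esub> r = complex_of_real (1/t) \<odot>\<^bsub>?M\<^esub> T" unfolding r(3) y_def using T(1) by (simp add: M.ring_normalize)
  finally have RR: "star ?M R \<otimes>\<^bsub>?M\<^esub> R = T" using t(1) T(1) by (simp add: M.smult_smult)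
  obtain z where z: "\<And>i j. i < n \<Longrightarrow> j < n \<Longrightarrow> z i j \<in> carrier A" and Rz: "R = mat_op n (\<lambda>i j. \<pi> (z i j))"
    using \<open>R \<in> P\<close> unfolding P_def by blast
  have "star ?M R = mat_op n (\<lambda>i j. star bounded_ops (\<pi> (z j i)))" unfolding Rz by (rule star_mat_op) (simp add: z)
  also have "\<dots> = mat_op n (\<lambda>i j. \<pi> (star A (z j i)))" by (rule mat_op_cong) (simp add: z)
  finally have "T = mat_op n (\<lambda>i j. \<pi> (\<Oplus>\<^bsub>A\<^esub>k\<in>{..<n}. star A (z k i) \<otimes>\<^bsub>A\<^esub> z k j))"
    using RR mult_P[of "\<lambda>i j. star A (z j i)" z] z unfolding Rz matrix_ops_simps(2) by simp
  then have eq: "entry (mat_op n (\<lambda>i j. \<pi> (x i j))) = entry (mat_op n (\<lambda>i j. \<pi> (\<Oplus>\<^bsub>A\<^esub>k\<in>{..<n}. star A (z k i) \<otimes>\<^bsub>A\<^esub> z k j)))"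
    unfolding T_def by simp
  have "x i j = (\<Oplus>\<^bsub>A\<^esub>k\<in>{..<n}. star A (z k i) \<otimes>\<^bsub>A\<^esub> z k j)" if ij: "i < n" "j < n" for i j
  proof -
    have cl: "(\<Oplus>\<^bsub>A\<^esub>k\<in>{..<n}. star A (z k i) \<otimes>\<^bsub>A\<^esub> z k j) \<in> carrier A" if "i < n" "j < n" for i j
      by (rule A.finsum_closed) (use z that in auto)
    have "\<pi> (x i j) = \<pi> (\<Oplus>\<^bsub>A\<^esub>k\<in>{..<n}. star A (z k i) \<otimes>\<^bsub>A\<^esub> z k j)"
      using fun_cong[OF fun_cong[OF eq], of i j] entry_mat_op[of n "\<lambda>i j. \<pi> (x i j)" i j] x ij cl
        entry_mat_op[of n "\<lambda>i j. \<pi> (\<Oplus>\<^bsub>A\<^esub>k\<in>{..<n}. star A (z k i) \<otimes>\<^bsub>A\<^esub> z k j)" i j] by simp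
    then show ?thesis by (rule inj_onD[OF inj]) (use x cl ij in auto)
  qed
  then show ?thesis unfolding matrix_pos_def using z by blast
qed

section \<open>Spectral theorem in finite dimensions\<close>

text \<open>Gaussian elimination of one equation: an index \<open>i0\<close> with nonzero coefficient in equation \<open>s\<close> is solved for and
  substituted into the others.\<close>

lemma homogeneous_system:
  fixes M :: "'i \<Rightarrow> 's \<Rightarrow> complex"
  assumes "finite S" "finite I" "card S < card I"
  shows "\<exists>c. (\<exists>i\<in>I. c i \<noteq> 0) \<and> (\<forall>s\<in>S. (\<Sum>i\<in>I. c i * M i s) = 0)"
  using assms
proof (induction S arbitrary: I M rule: finite_induct)
  case empty
  then have "I \<noteq> {}" by auto
  then show ?case by (intro exI[of _ "\<lambda>_. 1"]) auto
next
  case (insert s S)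
  show ?case
  proof (cases "\<forall>i\<in>I. M i s = 0")
    case True
    have "card S < card I" using insert by simp
    then obtain c where "\<exists>i\<in>I. c i \<noteq> 0" "\<forall>t\<in>S. (\<Sum>i\<in>I. c i * M i t) = 0"
      using insert.IH[OF insert.prems(1)] by blast
    then show ?thesis using True by (intro exI[of _ c]) auto
  next
    case False
    then obtain i0 where i0: "i0 \<in> I" "M i0 s \<noteq> 0" by blast
    define I' where "I' = I - {i0}"
    have I': "finite I'" "card S < card I'" "i0 \<notin> I'" "I = insert i0 I'"
      using insert.prems insert.hyps i0 by (auto simp: I'_def)
    define M' where "M' i t = M i t - M i s / M i0 s * M i0 t" for i t
    obtain c' where c': "\<exists>i\<in>I'. c' i \<noteq> 0" "\<forall>t\<in>S. (\<Sum>i\<in>I'. c' i * M' i t) = 0"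
      using insert.IH[OF I'(1,2), of M'] by blast
    define d where "d = - (\<Sum>i\<in>I'. c' i * M i s) / M i0 s"
    define c where "c = c'(i0 := d)"
    have "(\<Sum>i\<in>I. c i * M i t) = (\<Sum>i\<in>I'. c' i * M' i t)" for t
    proof -
      have "(\<Sum>i\<in>I. c i * M i t) = d * M i0 t + (\<Sum>i\<in>I'. c i * M i t)"
        unfolding I'(4) using I'(1,3) by (simp add: c_def)
      also have "(\<Sum>i\<in>I'. c i * M i t) = (\<Sum>i\<in>I'. c' i * M i t)" using I'(3) by (intro sum.cong) (auto simp: c_def)
      also have "d * M i0 t = (\<Sum>i\<in>I'. - (c' i * (M i s / M i0 s * M i0 t)))"
        by (simp add: d_def sum_negf sum_divide_distrib[symmetric] sum_distrib_right[symmetric] mult.assoc[symmetric])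
      finally show ?thesis by (simp add: M'_def sum.distrib[symmetric] algebra_simps)
    qed
    moreover have "M' i s = 0" for i using i0(2) by (simp add: M'_def)
    ultimately have "\<forall>t\<in>insert s S. (\<Sum>i\<in>I. c i * M i t) = 0" using c'(2) by simp
    moreover have "\<exists>i\<in>I. c i \<noteq> 0" using c'(1) I'(3,4) by (auto simp: c_def)
    ultimately show ?thesis by blast
  qed
qed

lemma interpolation:
  fixes h :: "complex \<Rightarrow> complex"
  assumes "finite S" shows "\<exists>p. \<forall>c\<in>S. poly p c = h c"
  using assms
proof (induction S rule: finite_induct)
  case (insert s S)
  then obtain p where p: "\<forall>c\<in>S. poly p c = h c" by blast
  define w where "w = (\<Prod>c\<in>S. [:- c, 1:])"
  have w: "poly w s \<noteq> 0" "\<And>c. c \<in> S \<Longrightarrow> poly w c = 0"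
    using insert.hyps by (auto simp: w_def poly_prod)
  define q where "q = p + Polynomial.smult ((h s - poly p s) / poly w s) w"
  have "\<forall>c\<in>insert s S. poly q c = h c" using p w by (auto simp: q_def)
  then show ?case by blast
qed simp

context cstar_algebra
begin

lemma finsum_singleton_A:
  assumes "finite I" "i \<in> I" "f i \<in> carrier A"
  shows "(\<Oplus>j\<in>I. if j = i then f j else \<zero>) = f i"
proof -
  have "(\<Oplus>j\<in>insert i (I - {i}). if j = i then f j else \<zero>) = f i \<oplus> (\<Oplus>j\<in>I - {i}. if j = i then f j else \<zero>)"
    using finsum_insert[of "I - {i}" i "\<lambda>j. if j = i then f j else \<zero>"] assms by (auto simp: Pi_def)
  also have "(\<Oplus>j\<in>I - {i}. if j = i then f j else \<zero>) = (\<Oplus>j\<in>I - {i}. \<zero>)"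
    by (rule finsum_cong') auto
  also have "\<dots> = \<zero>" by (rule abelian_monoid.finsum_zero[OF abelian_monoid_A])
  finally show ?thesis using assms by (simp add: insert_absorb)
qed

lemma smult_finsum:
  assumes "finite I" "\<And>i. i \<in> I \<Longrightarrow> f i \<in> carrier A"
  shows "c \<odot> (\<Oplus>i\<in>I. f i) = (\<Oplus>i\<in>I. c \<odot> f i)"
  using finsum_smult_ldistr[of I c f] assms by (simp add: complex_ring_def Pi_def)

lemma functional_finsum:
  assumes "linear_functional A \<tau>" "finite I" "\<And>i. i \<in> I \<Longrightarrow> f i \<in> carrier A"
  shows "\<tau> (\<Oplus>i\<in>I. f i) = (\<Sum>i\<in>I. \<tau> (f i))"
  using assms(2,3)
proof (induction I rule: finite_induct)
  case empty
  have "\<tau> (0 \<odot> \<zero>) = 0 * \<tau> \<zero>" using assms(1) unfolding linear_functional_def by blast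
  then show ?case by (simp add: finsum_empty)
next
  case (insert i I)
  have "\<tau> (f i \<oplus> (\<Oplus>i\<in>I. f i)) = \<tau> (f i) + \<tau> (\<Oplus>i\<in>I. f i)"
    using assms(1) insert.prems finsum_closed[of f I] unfolding linear_functional_def by (auto simp: Pi_def)
  then show ?case using insert finsum_insert[of I i f] by (simp add: Pi_def)
qed

lemma finsum_star:
  assumes "finite I" "\<And>i. i \<in> I \<Longrightarrow> f i \<in> carrier A"
  shows "star A (\<Oplus>i\<in>I. f i) = (\<Oplus>i\<in>I. star A (f i))"
  using assms
proof (induction I rule: finite_induct)
  case (insert i I)
  then show ?case using finsum_insert[of I i f] finsum_insert[of I i "\<lambda>i. star A (f i)"] finsum_closed[of f I]
    by (simp add: Pi_def)
qed (simp add: finsum_empty)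

lemma sum_smult:
  assumes "finite I" "x \<in> carrier A" shows "(\<Sum>i\<in>I. c i) \<odot> x = (\<Oplus>i\<in>I. c i \<odot> x)"
  using assms
proof (induction I rule: finite_induct)
  case (insert i I)
  then show ?case using finsum_insert[of I i "\<lambda>i. c i \<odot> x"] by (simp add: smult_add_left)
qed (simp add: finsum_empty)

lemma finsum_zero_A: "(\<And>i. i \<in> I \<Longrightarrow> f i = \<zero>) \<Longrightarrow> (\<Oplus>i\<in>I. f i) = \<zero>"
  using finsum_cong'[of I I "\<lambda>_. \<zero>" f] abelian_monoid.finsum_zero[OF abelian_monoid_A, of I] by simp

text \<open>The bound \<open>N\<close> is the size of a finite spanning set; coordinates with respect to it form a homogeneous system with
  more unknowns than equations.\<close>

lemma linear_dependence:
  assumes "finite_dim A"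
  obtains N where "\<And>v. (\<And>k. k \<le> N \<Longrightarrow> v k \<in> carrier A) \<Longrightarrow>
    \<exists>c. (\<exists>k\<le>N. c k \<noteq> 0) \<and> (\<Oplus>k\<in>{..N::nat}. c k \<odot> v k) = \<zero>"
proof -
  obtain S where S: "finite S" "S \<subseteq> carrier A" and span: "\<And>x. x \<in> carrier A \<Longrightarrow> \<exists>c. x = (\<Oplus>s\<in>S. c s \<odot> s)"
    using assms unfolding finite_dim_def by blast
  have "\<exists>c. (\<exists>k\<le>card S. c k \<noteq> 0) \<and> (\<Oplus>k\<in>{..card S}. c k \<odot> v k) = \<zero>"
    if v: "\<And>k. k \<le> card S \<Longrightarrow> v k \<in> carrier A" for v
  proof -
    have "\<forall>k. \<exists>c. k \<le> card S \<longrightarrow> v k = (\<Oplus>s\<in>S. c s \<odot> s)" using span v by blast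
    from choice[OF this] obtain M where M: "\<And>k. k \<le> card S \<Longrightarrow> v k = (\<Oplus>s\<in>S. M k s \<odot> s)" by blast
    obtain c where c: "\<exists>k\<in>{..card S}. c k \<noteq> 0" "\<forall>s\<in>S. (\<Sum>k\<in>{..card S}. c k * M k s) = 0"
      using homogeneous_system[OF S(1), of "{..card S}" M] by auto
    have "(\<Oplus>k\<in>K. c k \<odot> v k) = (\<Oplus>s\<in>S. (\<Sum>k\<in>K. c k * M k s) \<odot> s)" if "finite K" "K \<subseteq> {..card S}" for K
      using that
    proof (induction K rule: finite_induct)
      case empty
      have "(\<Oplus>s\<in>S. 0 \<odot> s) = \<zero>" by (rule finsum_zero_A) (use S in auto)
      then show ?case by (simp add: finsum_empty)
    next
      case (insert k K)
      have "(\<Oplus>k\<in>insert k K. c k \<odot> v k) = c k \<odot> v k \<oplus> (\<Oplus>k\<in>K. c k \<odot> v k)"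
        using insert v by (intro finsum_insert) auto
      also have "c k \<odot> v k = (\<Oplus>s\<in>S. (c k * M k s) \<odot> s)"
      proof -
        have "c k \<odot> v k = (\<Oplus>s\<in>S. c k \<odot> (M k s \<odot> s))"
          using M[of k] smult_finsum[OF S(1), of "\<lambda>s. M k s \<odot> s" "c k"] insert.prems S(2) by auto
        also have "\<dots> = (\<Oplus>s\<in>S. (c k * M k s) \<odot> s)" by (rule finsum_cong') (use S(2) in \<open>auto simp: smult_smult\<close>)
        finally show ?thesis .
      qed
      also have "(\<Oplus>k\<in>K. c k \<odot> v k) = (\<Oplus>s\<in>S. (\<Sum>k\<in>K. c k * M k s) \<odot> s)" using insert by simp
      also have "(\<Oplus>s\<in>S. (c k * M k s) \<odot> s) \<oplus> (\<Oplus>s\<in>S. (\<Sum>k\<in>K. c k * M k s) \<odot> s)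
          = (\<Oplus>s\<in>S. (c k * M k s) \<odot> s \<oplus> (\<Sum>k\<in>K. c k * M k s) \<odot> s)"
        by (rule finsum_addf[symmetric]) (use S(2) in auto)
      also have "\<dots> = (\<Oplus>s\<in>S. (\<Sum>k\<in>insert k K. c k * M k s) \<odot> s)"
        by (rule finsum_cong') (use S(2) insert.hyps in \<open>auto simp: smult_add_left\<close>)
      finally show ?case .
    qed
    from this[of "{..card S}"] have "(\<Oplus>k\<in>{..card S}. c k \<odot> v k) = (\<Oplus>s\<in>S. (\<Sum>k\<in>{..card S}. c k * M k s) \<odot> s)" by simp
    also have "\<dots> = \<zero>" by (rule finsum_zero_A) (use c(2) S(2) in auto)
    finally show ?thesis using c(1) by auto
  qed
  then show ?thesis using that by blast
qed

lemmas pow_closed [simp] = monoid.nat_pow_closed[OF ring.is_monoid[OF ring_A]]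
lemmas pow_0 = monoid.nat_pow_0[OF ring.is_monoid[OF ring_A]]
lemmas pow_Suc2 = monoid.nat_pow_Suc2[OF ring.is_monoid[OF ring_A]]

lemma poly_cstar_upto:
  assumes x: "x \<in> carrier A" and n: "degree p \<le> n"
  shows "poly_cstar A p x = (\<Oplus>k\<in>{..n}. coeff p k \<odot> (x [^] k))"
  using n
proof (induction n rule: dec_induct)
  case base
  show ?case by (simp add: poly_cstar_def)
next
  case (step n)
  have "(\<Oplus>k\<in>{..Suc n}. coeff p k \<odot> (x [^] k)) = coeff p (Suc n) \<odot> (x [^] Suc n) \<oplus> (\<Oplus>k\<in>{..n}. coeff p k \<odot> (x [^] k))"
    unfolding atMost_Suc by (rule finsum_insert) (use x in auto)
  also have "coeff p (Suc n) = 0" using step.hyps by (simp add: coeff_eq_0)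
  finally show ?case using step.IH x finsum_closed[of "\<lambda>k. coeff p k \<odot> (x [^] k)" "{..n}"] by (simp add: Pi_def)
qed

lemma poly_cstar_closed [simp]: "x \<in> carrier A \<Longrightarrow> poly_cstar A p x \<in> carrier A"
  unfolding poly_cstar_def by (rule finsum_closed) auto

lemma poly_cstar_0 [simp]: "x \<in> carrier A \<Longrightarrow> poly_cstar A 0 x = \<zero>"
  unfolding poly_cstar_def by (rule finsum_zero_A) auto

lemma poly_cstar_pCons:
  assumes x: "x \<in> carrier A"
  shows "poly_cstar A (pCons a p) x = a \<odot> \<one> \<oplus> x \<otimes> poly_cstar A p x"
proof -
  have "degree (pCons a p) \<le> Suc (degree p)" by (rule degree_pCons_le)
  then have "poly_cstar A (pCons a p) x = (\<Oplus>k\<in>{..Suc (degree p)}. coeff (pCons a p) k \<odot> (x [^] k))"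
    by (rule poly_cstar_upto[OF x])
  also have "\<dots> = (\<Oplus>k\<in>{..degree p}. coeff (pCons a p) (Suc k) \<odot> (x [^] Suc k)) \<oplus> coeff (pCons a p) 0 \<odot> (x [^] (0::nat))"
    by (rule abelian_monoid.finsum_Suc2[OF abelian_monoid_A]) (use x in auto)
  also have "(\<Oplus>k\<in>{..degree p}. coeff (pCons a p) (Suc k) \<odot> (x [^] Suc k)) = (\<Oplus>k\<in>{..degree p}. x \<otimes> (coeff p k \<odot> (x [^] k)))"
    by (rule finsum_cong') (use x pow_Suc2 in \<open>auto simp: smult_mult_right\<close>)
  also have "\<dots> = x \<otimes> poly_cstar A p x"
    unfolding poly_cstar_def by (rule finsum_rdistr[symmetric]) (use x in auto)
  finally show ?thesis using x by (simp add: pow_0 a_comm)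
qed

lemma poly_cstar_commute:
  assumes "x \<in> carrier A" "b \<in> carrier A" "b \<otimes> x = x \<otimes> b"
  shows "b \<otimes> poly_cstar A p x = poly_cstar A p x \<otimes> b"
proof (induction p)
  case (pCons a p)
  have "b \<otimes> (x \<otimes> poly_cstar A p x) = x \<otimes> (b \<otimes> poly_cstar A p x)"
    by (rule comm_left[OF assms(3,2,1)]) (use assms in simp)
  also have "\<dots> = (x \<otimes> poly_cstar A p x) \<otimes> b" unfolding pCons.IH using assms(1,2) by (simp add: m_assoc)
  finally show ?case using assms(1,2) by (simp add: poly_cstar_pCons l_distr r_distr smult_mult_left smult_mult_right)
qed (use assms(1,2) in simp)

lemma poly_cstar_eigen:
  assumes "x \<in> carrier A" "e \<in> carrier A" "x \<otimes> e = c \<odot> e"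
  shows "poly_cstar A p x \<otimes> e = poly p c \<odot> e"
proof (induction p)
  case (pCons a p)
  have "(x \<otimes> poly_cstar A p x) \<otimes> e = x \<otimes> (poly p c \<odot> e)" using assms(1,2) pCons.IH by (simp add: m_assoc)
  also have "\<dots> = (c * poly p c) \<odot> e" using assms by (simp add: smult_mult_right smult_smult mult.commute)
  finally show ?case using assms(1,2) by (simp add: poly_cstar_pCons l_distr smult_mult_left smult_add_left)
qed (use assms(1,2) in simp)

text \<open>Evaluation of polynomials at \<open>x\<close> is multiplicative; a linear factor is all that is needed to split off an eigenvalue.\<close>

lemma poly_cstar_root_factor:
  assumes x: "x \<in> carrier A"
  shows "poly_cstar A ([:- c, 1:] * g) x = x \<otimes> poly_cstar A g x \<ominus> c \<odot> poly_cstar A g x"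
proof (induction g)
  case (pCons a g)
  have eq: "[:- c, 1:] * pCons a g = pCons (- c * a) (pCons a 0 + [:- c, 1:] * g)"
    by (simp add: algebra_simps)
  have const: "poly_cstar A (pCons a 0 + p) x = a \<odot> \<one> \<oplus> poly_cstar A p x" for p
  proof (cases p)
    case (pCons b q)
    have "poly_cstar A (pCons (a + b) q) x = (a + b) \<odot> \<one> \<oplus> x \<otimes> poly_cstar A q x" by (rule poly_cstar_pCons[OF x])
    then show ?thesis using x pCons by (simp add: poly_cstar_pCons smult_add_left a_assoc)
  qed
  show ?case unfolding eq poly_cstar_pCons[OF x] const pCons.IH
    using x by (simp add: calg smult_minus_left uminus_diff mult.commute)
qed (use x in simp)

definition orth_family :: "(nat \<Rightarrow> 'a) \<Rightarrow> nat \<Rightarrow> bool" where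
  "orth_family e m \<longleftrightarrow> (\<forall>i<m. projection A (e i) \<and> e i \<noteq> \<zero>) \<and> (\<forall>i<m. \<forall>j<m. i \<noteq> j \<longrightarrow> e i \<otimes> e j = \<zero>)"

lemma projectionD: "projection A p \<Longrightarrow> p \<in> carrier A" "projection A p \<Longrightarrow> star A p = p" "projection A p \<Longrightarrow> p \<otimes> p = p"
  by (auto simp: projection_def)

lemma smult_eq_zero: assumes "x \<in> carrier A" "x \<noteq> \<zero>" "c \<odot> x = \<zero>" shows "c = 0"
  using cnorm_smult[OF assms(1), of c] assms cnorm_eq_0[OF assms(1)] by simp

lemma smult_right_cancel: assumes "x \<in> carrier A" "x \<noteq> \<zero>" "c \<odot> x = d \<odot> x" shows "c = d"
proof -
  have "(c - d) \<odot> x = \<zero>" using assms(1,3) by (simp add: smult_diff_left)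
  then show ?thesis using smult_eq_zero[OF assms(1,2)] by fastforce
qed

text \<open>Eigenprojections come from a polynomial of least degree annihilating \<open>x\<close> on the range of \<open>r\<close>:
  dividing out a root leaves a nonzero eigenvector \<open>y\<close> in the commutative algebra generated
  by \<open>x\<close> and \<open>r\<close>, and \<open>y\<^sup>* y\<close> is a multiple of a projection.\<close>

lemma eigenprojection:
  assumes fd: "finite_dim A" and x: "x \<in> carrier A" "star A x = x"
    and r: "projection A r" "r \<noteq> \<zero>" and xr: "r \<otimes> x = x \<otimes> r"
  obtains q c where "projection A q" "q \<noteq> \<zero>" "r \<otimes> q = q" "x \<otimes> q = complex_of_real c \<odot> q"
proof -
  note rc = projectionD[OF r(1)]
  obtain N where N: "\<And>v. (\<And>k. k \<le> N \<Longrightarrow> v k \<in> carrier A) \<Longrightarrow>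
    \<exists>c. (\<exists>k\<le>N. c k \<noteq> 0) \<and> (\<Oplus>k\<in>{..N::nat}. c k \<odot> v k) = \<zero>"
    using linear_dependence[OF fd] by blast
  have "\<exists>p. p \<noteq> 0 \<and> poly_cstar A p x \<otimes> r = \<zero>"
  proof -
    obtain c where c: "\<exists>k\<le>N. c k \<noteq> 0" "(\<Oplus>k\<in>{..N}. c k \<odot> (x [^] k \<otimes> r)) = \<zero>"
      using N[of "\<lambda>k. x [^] k \<otimes> r"] x(1) rc(1) by auto
    define p where "p = (\<Sum>k\<le>N. monom (c k) k)"
    have cp: "coeff p k = (if k \<le> N then c k else 0)" for k
      by (simp add: p_def coeff_sum)
    have "degree p \<le> N" by (rule degree_le) (simp add: cp)
    then have "poly_cstar A p x = (\<Oplus>k\<in>{..N}. coeff p k \<odot> (x [^] k))" by (rule poly_cstar_upto[OF x(1)])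
    then have "poly_cstar A p x \<otimes> r = (\<Oplus>k\<in>{..N}. coeff p k \<odot> (x [^] k) \<otimes> r)"
      using finsum_ldistr[of "{..N}" r "\<lambda>k. coeff p k \<odot> (x [^] k)"] x(1) rc(1) by (simp add: Pi_def)
    also have "\<dots> = (\<Oplus>k\<in>{..N}. c k \<odot> (x [^] k \<otimes> r))"
      by (rule finsum_cong') (use x(1) rc(1) cp in \<open>auto simp: smult_mult_left\<close>)
    finally have "poly_cstar A p x \<otimes> r = \<zero>" using c(2) by simp
    moreover have "p \<noteq> 0" using c(1) cp by (metis coeff_0)
    ultimately show ?thesis by blast
  qed
  then obtain p where p: "p \<noteq> 0" "poly_cstar A p x \<otimes> r = \<zero>"
    and least: "\<And>g. g \<noteq> 0 \<Longrightarrow> poly_cstar A g x \<otimes> r = \<zero> \<Longrightarrow> degree p \<le> degree g"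
    using ex_has_least_nat[of "\<lambda>p. p \<noteq> 0 \<and> poly_cstar A p x \<otimes> r = \<zero>" _ degree] by metis
  have "degree p \<noteq> 0"
  proof
    assume "degree p = 0"
    then obtain a where a: "p = [:a:]" by (rule degree_eq_zeroE)
    then have "a \<odot> r = \<zero>" using p(2) x(1) rc(1) by (simp add: poly_cstar_pCons smult_mult_left)
    then show False using smult_eq_zero[OF rc(1) r(2)] p(1) a by simp
  qed
  then have "\<not> constant (poly p)" by (simp add: constant_degree)
  then obtain c where "poly p c = 0" using fundamental_theorem_of_algebra by blast
  then obtain g where g: "p = [:- c, 1:] * g" by (auto simp: poly_eq_0_iff_dvd dvd_def)
  have "g \<noteq> 0" using p(1) g by auto
  then have "degree p = Suc (degree g)" unfolding g by (subst degree_mult_eq) auto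
  define G where "G = poly_cstar A g x"
  have G: "G \<in> carrier A" using x(1) by (simp add: G_def)
  define y where "y = G \<otimes> r"
  have y: "y \<in> carrier A" using G rc by (simp add: y_def)
  have "y \<noteq> \<zero>" using least[of g] \<open>g \<noteq> 0\<close> \<open>degree p = Suc (degree g)\<close> by (auto simp: y_def G_def)
  have "(x \<otimes> G \<ominus> c \<odot> G) \<otimes> r = \<zero>" using p(2) unfolding g poly_cstar_root_factor[OF x(1)] G_def .
  then have xy: "x \<otimes> y = c \<odot> y"
    using x(1) G rc(1) diff_eq_zero[of "x \<otimes> y" "c \<odot> y"] by (simp add: y_def mult_diff smult_mult_left m_assoc)
  have Gr: "r \<otimes> G = G \<otimes> r" unfolding G_def by (rule poly_cstar_commute[OF x(1) rc(1) xr])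
  have xG: "x \<otimes> G = G \<otimes> x" unfolding G_def by (rule poly_cstar_commute[OF x(1) x(1) refl])
  have sGr: "star A G \<otimes> r = r \<otimes> star A G" using arg_cong[OF Gr, of "star A"] G rc by simp
  have sGx: "star A G \<otimes> x = x \<otimes> star A G" using arg_cong[OF xG, of "star A"] G x by simp
  have GG: "star A G \<otimes> G = G \<otimes> star A G"
    unfolding G_def by (rule poly_cstar_commute[OF x(1)]) (use G sGx in \<open>simp_all add: G_def\<close>)
  have sy: "star A y = star A G \<otimes> r" using G rc sGr by (simp add: y_def)
  have yy: "star A y \<otimes> y = y \<otimes> star A y"
  proof -
    have "star A y \<otimes> y = star A G \<otimes> (r \<otimes> (G \<otimes> r))" unfolding sy unfolding y_def using G rc by (simp add: m_assoc)
    also have "r \<otimes> (G \<otimes> r) = G \<otimes> r" unfolding comm_left[OF Gr rc(1) G rc(1)] by (simp add: rc(3))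
    also have "star A G \<otimes> (G \<otimes> r) = G \<otimes> (star A G \<otimes> r)" by (rule comm_left[OF GG]) (use G rc in simp_all)
    also have "\<dots> = G \<otimes> (r \<otimes> (star A G \<otimes> r))"
      using comm_left[OF sGr _ rc(1) rc(1)] G rc by simp
    also have "\<dots> = y \<otimes> star A y" unfolding sy unfolding y_def using G rc by (simp add: m_assoc)
    finally show ?thesis .
  qed
  define z where "z = star A y \<otimes> y"
  have z: "z \<in> carrier A" "star A z = z" using y by (simp_all add: z_def)
  have z0: "z \<noteq> \<zero>" using star_mult_eq_zero[OF y] \<open>y \<noteq> \<zero>\<close> unfolding z_def by blast
  have xsy: "x \<otimes> star A y = star A y \<otimes> x"
  proof -
    have "x \<otimes> star A y = star A G \<otimes> (x \<otimes> r)" unfolding sy using comm_left[OF sGx _ x(1) rc(1)] G x(1) rc(1) by simp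
    also have "\<dots> = star A y \<otimes> x" unfolding sy xr[symmetric] using G x(1) rc(1) by (simp add: m_assoc)
    finally show ?thesis .
  qed
  have xz: "x \<otimes> z = c \<odot> z"
    unfolding z_def using comm_left[OF xsy x(1) _ y] y x(1) by (simp add: xy smult_mult_right)
  have rz: "r \<otimes> z = z"
  proof -
    have "r \<otimes> star A y = star A y" unfolding y_def using rc G m_assoc[of r r "star A G"] by simp
    then show ?thesis unfolding z_def using m_assoc[of r "star A y" y] y rc(1) by simp
  qed
  have c_real: "cnj c = c"
  proof -
    have "z \<otimes> x = star A (x \<otimes> z)" using x z by simp
    also have "\<dots> = cnj c \<odot> z" unfolding xz using z by simp
    finally have "z \<otimes> x = cnj c \<odot> z" .
    moreover have "z \<otimes> x = x \<otimes> z"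
    proof -
      have xy': "x \<otimes> y = y \<otimes> x"
        unfolding y_def using m_assoc[of x G r] m_assoc[of G x r] m_assoc[of G r x] G rc(1) x(1) xr xG by simp
      have "z \<otimes> x = star A y \<otimes> (x \<otimes> y)" unfolding z_def xy' using y x(1) by (simp add: m_assoc)
      also have "\<dots> = x \<otimes> z" unfolding z_def by (rule comm_left[OF xsy[symmetric]]) (use y x(1) in simp_all)
      finally show ?thesis .
    qed
    ultimately have "cnj c \<odot> z = c \<odot> z" using xz by simp
    then show ?thesis by (rule smult_right_cancel[OF z(1) z0])
  qed
  \<comment> \<open>On the eigenspace the element \<open>y = g(x) r\<close> acts as the number \<open>g(c)\<close>, so \<open>z\<^sup>2 = \<bar>\<gamma>\<bar>\<^sup>2 z\<close>.\<close>
  define \<gamma> where "\<gamma> = poly g c"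
  have yz: "y \<otimes> z = \<gamma> \<odot> z"
    unfolding y_def \<gamma>_def using poly_cstar_eigen[OF x(1) z(1) xz, of g] G rc(1) z(1) by (simp add: m_assoc rz G_def)
  have syz: "star A y \<otimes> z = cnj \<gamma> \<odot> z"
  proof -
    have "star A y \<otimes> z = z \<otimes> star A y" unfolding z_def using m_assoc[of "star A y" y "star A y"] y by (simp add: yy[symmetric])
    also have "\<dots> = star A (y \<otimes> z)" using y z by simp
    also have "\<dots> = cnj \<gamma> \<odot> z" unfolding yz using z by simp
    finally show ?thesis .
  qed
  have "z \<otimes> z = star A y \<otimes> (y \<otimes> z)" using y z m_assoc[of "star A y" y z] by (simp add: z_def)
  also have "\<dots> = (\<gamma> * cnj \<gamma>) \<odot> z" unfolding yz using y z(1) by (simp add: smult_mult_right syz smult_smult)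
  also have "\<gamma> * cnj \<gamma> = complex_of_real ((cmod \<gamma>)\<^sup>2)" by (rule complex_norm_square[symmetric])
  finally have zz: "z \<otimes> z = complex_of_real ((cmod \<gamma>)\<^sup>2) \<odot> z" .
  have g0: "(cmod \<gamma>)\<^sup>2 \<noteq> 0"
  proof
    assume "(cmod \<gamma>)\<^sup>2 = 0"
    then have "z \<otimes> z = \<zero>" unfolding zz using z by simp
    then show False using sq_eq_zero[OF z] z0 by blast
  qed
  define q where "q = complex_of_real (1 / (cmod \<gamma>)\<^sup>2) \<odot> z"
  have q: "q \<in> carrier A" "star A q = q" using z by (simp_all add: q_def)
  have "q \<otimes> q = q" unfolding q_def using z(1) g0
    by (simp add: smult_mult_left smult_mult_right zz smult_smult)
  then have "projection A q" using q by (simp add: projection_def)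
  moreover have "q \<noteq> \<zero>" using smult_eq_zero[OF z(1) z0] g0 unfolding q_def by force
  moreover have "r \<otimes> q = q" unfolding q_def using rc(1) z(1) by (simp add: smult_mult_right rz)
  moreover have "x \<otimes> q = complex_of_real (Re c) \<odot> q"
  proof -
    have "complex_of_real (Re c) = c" using c_real by (simp add: complex_eq_iff)
    then show ?thesis unfolding q_def using x(1) z(1) by (simp add: smult_mult_right xz smult_smult mult.commute)
  qed
  ultimately show ?thesis using that by blast
qed

lemma orth_familyD:
  assumes "orth_family e m" "i < m"
  shows "e i \<in> carrier A" "star A (e i) = e i" "e i \<otimes> e i = e i" "e i \<noteq> \<zero>" "projection A (e i)"
  using assms unfolding orth_family_def projection_def by auto

lemma orth_familyD2: "orth_family e m \<Longrightarrow> i < m \<Longrightarrow> j < m \<Longrightarrow> i \<noteq> j \<Longrightarrow> e i \<otimes> e j = \<zero>"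
  unfolding orth_family_def by blast

text \<open>Multiplying by \<open>e j\<close> reads off the \<open>j\<close>th coefficient. Applied to a vanishing combination it shows that orthogonal
  families are independent, applied to a resolution of the unit it computes functions of an element.\<close>

lemma orth_finsum_mult:
  assumes "orth_family e m" "j < m"
  shows "(\<Oplus>i\<in>{..<m}. c i \<odot> e i) \<otimes> e j = c j \<odot> e j" "(\<Oplus>i\<in>{..<m}. c i \<odot> e i) \<in> carrier A"
proof -
  note cl = orth_familyD(1)[OF assms(1)]
  show "(\<Oplus>i\<in>{..<m}. c i \<odot> e i) \<in> carrier A" by (rule finsum_closed) (use cl in auto)
  have "(\<Oplus>i\<in>{..<m}. c i \<odot> e i) \<otimes> e j = (\<Oplus>i\<in>{..<m}. (c i \<odot> e i) \<otimes> e j)"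
    by (rule finsum_ldistr) (use cl assms(2) in auto)
  also have "\<dots> = (\<Oplus>i\<in>{..<m}. if i = j then c i \<odot> e i else \<zero>)"
    by (rule finsum_cong') (use cl assms orth_familyD2[OF assms(1)] orth_familyD(3)[OF assms(1)] in \<open>auto simp: smult_mult_left\<close>)
  also have "\<dots> = c j \<odot> e j" by (rule finsum_singleton_A) (use cl assms in auto)
  finally show "(\<Oplus>i\<in>{..<m}. c i \<odot> e i) \<otimes> e j = c j \<odot> e j" .
qed

lemma orth_family_bounded:
  assumes "finite_dim A" obtains N where "\<And>e m. orth_family e m \<Longrightarrow> m \<le> N"
proof -
  obtain N where N: "\<And>v. (\<And>k. k \<le> N \<Longrightarrow> v k \<in> carrier A) \<Longrightarrow>
    \<exists>c. (\<exists>k\<le>N. c k \<noteq> 0) \<and> (\<Oplus>k\<in>{..N::nat}. c k \<odot> v k) = \<zero>"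
    using linear_dependence[OF assms] by blast
  have "m \<le> N" if e: "orth_family e m" for e m
  proof (rule ccontr)
    assume "\<not> m \<le> N"
    then have e': "orth_family e (Suc N)" using e unfolding orth_family_def by auto
    obtain c k where c: "k \<le> N" "c k \<noteq> 0" "(\<Oplus>k\<in>{..N}. c k \<odot> e k) = \<zero>"
      using N[of e] orth_familyD(1)[OF e'] by auto
    have "c k \<odot> e k = \<zero>"
      using orth_finsum_mult(1)[OF e', of k c] c(1,3) orth_familyD(1)[OF e', of k] by (simp add: lessThan_Suc_atMost)
    then show False using smult_eq_zero orth_familyD[OF e', of k] c(1,2) by simp
  qed
  then show ?thesis using that by blast
qed

text \<open>A spectral decomposition of \<open>x\<close> refined to minimal projections; the eigenvalues \<open>lam\<close> may repeat. A refined
  decomposition makes the trace of a function of \<open>x\<close> a plain sum over \<open>i\<close>.\<close>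

definition resolution :: "'a \<Rightarrow> (nat \<Rightarrow> 'a) \<Rightarrow> (nat \<Rightarrow> real) \<Rightarrow> nat \<Rightarrow> bool" where
  "resolution x e lam m \<longleftrightarrow> orth_family e m \<and> (\<forall>i<m. minimal_projection A (e i)) \<and>
     (\<forall>i<m. x \<otimes> e i = complex_of_real (lam i) \<odot> e i) \<and> (\<Oplus>i\<in>{..<m}. e i) = \<one>"

text \<open>Among the orthogonal families of eigenprojections of \<open>x\<close> one of largest size is complete,
  by \<open>eigenprojection\<close> below the remaining projection, and consists of minimal projections, since
  splitting a member would enlarge the family.\<close>

theorem spectral_theorem:
  assumes fd: "finite_dim A" and x: "x \<in> carrier A" "star A x = x"
  obtains e lam m where "resolution x e lam m"
proof -
  define Q where "Q m \<longleftrightarrow> (\<exists>e lam. orth_family e m \<and> (\<forall>i<m. x \<otimes> e i = complex_of_real (lam i) \<odot> e i))" for m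
  obtain N where N: "\<And>e m. orth_family e m \<Longrightarrow> m \<le> N" using orth_family_bounded[OF fd] by blast
  have "Q 0" unfolding Q_def orth_family_def by simp
  moreover have bd: "\<And>m. Q m \<Longrightarrow> m \<le> N" unfolding Q_def using N by blast
  ultimately obtain m where m: "Q m" and max: "\<And>k. Q k \<Longrightarrow> k \<le> m"
    using GreatestI_nat[of Q 0 N] Greatest_le_nat[of Q _ N] by blast
  obtain e lam where e: "orth_family e m" and eig: "\<And>i. i < m \<Longrightarrow> x \<otimes> e i = complex_of_real (lam i) \<odot> e i"
    using m unfolding Q_def by blast
  note cl = orth_familyD[OF e]
  \<comment> \<open>Any orthogonal family of \<open>m\<close> eigenprojections with one more eigenprojection orthogonal to it contradicts maximality.\<close>
  have extend: False
    if f: "\<And>i. i < m \<Longrightarrow> projection A (f i) \<and> f i \<noteq> \<zero> \<and> (\<exists>c. x \<otimes> f i = complex_of_real c \<odot> f i)"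
      and forth: "\<And>i j. i < m \<Longrightarrow> j < m \<Longrightarrow> i \<noteq> j \<Longrightarrow> f i \<otimes> f j = \<zero>"
      and q: "projection A q" "q \<noteq> \<zero>" "x \<otimes> q = complex_of_real c \<odot> q" and fq: "\<And>i. i < m \<Longrightarrow> f i \<otimes> q = \<zero>" for f q c
  proof -
    have qf: "q \<otimes> f i = \<zero>" if "i < m" for i
      using arg_cong[OF fq[OF that], of "star A"] f[OF that] q(1) by (simp add: projection_def)
    obtain \<mu> where \<mu>: "\<And>i. i < m \<Longrightarrow> x \<otimes> f i = complex_of_real (\<mu> i) \<odot> f i" using f by metis
    have "orth_family (f(m := q)) (Suc m)"
      unfolding orth_family_def using f q forth fq qf by (auto simp: less_Suc_eq)
    moreover have "\<forall>i<Suc m. x \<otimes> (f(m := q)) i = complex_of_real ((\<mu>(m := c)) i) \<odot> (f(m := q)) i"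
      using \<mu> q by (auto simp: less_Suc_eq)
    ultimately have "Q (Suc m)" unfolding Q_def by blast
    then show False using max by fastforce
  qed
  define s where "s = (\<Oplus>i\<in>{..<m}. e i)"
  have s1: "s = (\<Oplus>i\<in>{..<m}. 1 \<odot> e i)" unfolding s_def by (rule finsum_cong') (use cl in auto)
  have s: "s \<in> carrier A" unfolding s_def by (rule finsum_closed) (use cl in auto)
  have ss: "star A s = s" unfolding s_def
    using finsum_star[of "{..<m}" e] finsum_cong'[of "{..<m}" "{..<m}" e "\<lambda>i. star A (e i)"] cl by (simp add: Pi_def)
  have se: "s \<otimes> e i = e i" if "i < m" for i unfolding s1 using orth_finsum_mult(1)[OF e that, of "\<lambda>_. 1"] cl that by simp
  have "s \<otimes> s = (\<Oplus>i\<in>{..<m}. s \<otimes> e i)" unfolding s_def by (rule finsum_rdistr) (use cl s s_def in auto)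
  also have "\<dots> = s" unfolding s_def by (rule finsum_cong') (use cl se s_def in auto)
  finally have sq: "s \<otimes> s = s" .
  have ex: "e i \<otimes> x = complex_of_real (lam i) \<odot> e i" if "i < m" for i
    using arg_cong[OF eig[OF that], of "star A"] cl[OF that] x by simp
  have "x \<otimes> s = (\<Oplus>i\<in>{..<m}. x \<otimes> e i)" unfolding s_def by (rule finsum_rdistr) (use cl x in auto)
  also have "\<dots> = (\<Oplus>i\<in>{..<m}. e i \<otimes> x)" by (rule finsum_cong') (use cl x ex eig in auto)
  also have "\<dots> = s \<otimes> x" unfolding s_def by (rule finsum_ldistr[symmetric]) (use cl x in auto)
  finally have xs: "x \<otimes> s = s \<otimes> x" .
  define r where "r = \<one> \<ominus> s"
  have r: "projection A r" unfolding projection_def r_def using s ss sq by (simp add: ring_normalize)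
  have "r = \<zero>"
  proof (rule ccontr)
    assume "r \<noteq> \<zero>"
    have "r \<otimes> x = x \<otimes> r" unfolding r_def using s x(1) xs by (simp add: mult_diff)
    then obtain q c where q: "projection A q" "q \<noteq> \<zero>" "r \<otimes> q = q" "x \<otimes> q = complex_of_real c \<odot> q"
      using eigenprojection[OF fd x r \<open>r \<noteq> \<zero>\<close>] by blast
    have "e i \<otimes> q = \<zero>" if "i < m" for i
    proof -
      have "e i \<otimes> s = e i" using arg_cong[OF se[OF that], of "star A"] s ss cl[OF that] by simp
      then have "e i \<otimes> r = \<zero>" unfolding r_def using cl[OF that] s by (simp add: mult_diff)
      then have "e i \<otimes> (r \<otimes> q) = \<zero>"
        using m_assoc[of "e i" r q] cl[OF that] projectionD[OF r] projectionD[OF q(1)] by simp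
      then show ?thesis by (simp add: q(3))
    qed
    then show False
      using extend[of e q c] cl eig orth_familyD2[OF e] q by blast
  qed
  then have "s = \<one>" unfolding r_def using diff_eq_zero[of \<one> s] s by simp
  moreover have "minimal_projection A (e i)" if i: "i < m" for i
    unfolding minimal_projection_def
  proof (intro conjI allI impI)
    fix q assume q: "projection A q" "e i \<otimes> q = q"
    note qc = projectionD[OF q(1)]
    show "q = \<zero> \<or> q = e i"
    proof (rule ccontr)
      assume neg: "\<not> (q = \<zero> \<or> q = e i)"
      have qe: "q \<otimes> e i = q" using arg_cong[OF q(2), of "star A"] qc cl[OF i] by simp
      define p where "p = e i \<ominus> q"
      have p: "projection A p" unfolding p_def projection_def
        using cl[OF i] qc q(2) qe by (simp add: mult_diff) (simp add: ring_normalize)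
      have p0: "p \<noteq> \<zero>" unfolding p_def using diff_eq_zero[of "e i" q] cl[OF i] qc neg by auto
      have xq: "x \<otimes> q = complex_of_real (lam i) \<odot> q"
        using m_assoc[of x "e i" q] x(1) cl[OF i] qc eig[OF i] q(2) smult_mult_left[of "e i" q "complex_of_real (lam i)"] by simp
      have xp: "x \<otimes> p = complex_of_real (lam i) \<odot> p"
        unfolding p_def using x(1) cl[OF i] qc xq eig[OF i] by (simp add: mult_diff smult_diff)
      define f where "f = e(i := q)"
      have eq0: "e j \<otimes> q = \<zero>" "q \<otimes> e j = \<zero>" if "j < m" "j \<noteq> i" for j
      proof -
        have "e j \<otimes> (e i \<otimes> q) = \<zero>"
          using m_assoc[of "e j" "e i" q] orth_familyD2[OF e that(1) i that(2)] cl[OF i] cl[OF that(1)] qc by simp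
        then show *: "e j \<otimes> q = \<zero>" by (simp add: q(2))
        show "q \<otimes> e j = \<zero>" using arg_cong[OF *, of "star A"] cl[OF that(1)] qc by simp
      qed
      have fp: "f j \<otimes> p = \<zero>" if "j < m" for j
      proof (cases "j = i")
        case True
        then show ?thesis unfolding f_def p_def using cl[OF i] qc qe by (simp add: mult_diff)
      next
        case False
        then show ?thesis unfolding f_def p_def
          using cl[OF i] cl[OF that] qc eq0[OF that False] orth_familyD2[OF e that i False] by (simp add: mult_diff)
      qed
      have f1: "projection A (f j) \<and> f j \<noteq> \<zero> \<and> (\<exists>c. x \<otimes> f j = complex_of_real c \<odot> f j)" if "j < m" for j
        using cl[OF that] eig[OF that] q(1) neg xq by (cases "j = i") (auto simp: f_def)
      have f2: "f j \<otimes> f k = \<zero>" if "j < m" "k < m" "j \<noteq> k" for j k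
        using orth_familyD2[OF e that] eq0 that by (auto simp: f_def)
      show False by (rule extend[OF f1 f2 p p0 xp fp])
    qed
  qed (use cl i in auto)
  ultimately have "resolution x e lam m" unfolding resolution_def s_def[symmetric] using e eig by blast
  then show ?thesis by (rule that)
qed

end

section \<open>Trace, densities and the Gibbs inequality\<close>

locale fd_cstar = cstar_algebra +
  assumes finite_dim: "finite_dim A"
begin

lemma resolutionD:
  assumes "resolution x e lam m"
  shows "orth_family e m" "\<And>i. i < m \<Longrightarrow> minimal_projection A (e i)"
    "\<And>i. i < m \<Longrightarrow> x \<otimes> e i = complex_of_real (lam i) \<odot> e i" "(\<Oplus>i\<in>{..<m}. e i) = \<one>"
  using assms unfolding resolution_def by auto

lemma minimal_projectionD:
  assumes "minimal_projection A p"
  shows "p \<in> carrier A" "star A p = p" "p \<otimes> p = p" "p \<noteq> \<zero>"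
  using assms by (auto simp: minimal_projection_def projection_def)

text \<open>The corner of a minimal projection consists of scalars, since an eigenprojection below it must be
  the projection itself.\<close>

lemma corner_scalar:
  assumes p: "minimal_projection A p" and x: "x \<in> carrier A"
  shows "\<exists>c. p \<otimes> x \<otimes> p = c \<odot> p"
proof -
  note pc = minimal_projectionD[OF p]
  have sa: "\<exists>c. p \<otimes> a \<otimes> p = c \<odot> p" if a: "a \<in> carrier A" "star A a = a" for a
  proof -
    define y where "y = p \<otimes> a \<otimes> p"
    have y: "y \<in> carrier A" "star A y = y" using a pc by (simp_all add: y_def m_assoc)
    have yp: "y \<otimes> p = y" using a pc by (simp add: y_def m_assoc)
    have "p \<otimes> p \<otimes> (a \<otimes> p) = p \<otimes> (p \<otimes> (a \<otimes> p))" by (rule m_assoc) (use a pc in auto)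
    then have py: "p \<otimes> y = y" using a pc(1) by (simp add: y_def pc(3) m_assoc)
    have proj: "projection A p" using p by (simp add: minimal_projection_def)
    obtain q c where q: "projection A q" "q \<noteq> \<zero>" "p \<otimes> q = q" "y \<otimes> q = complex_of_real c \<odot> q"
      using eigenprojection[OF finite_dim y proj pc(4)] yp py by metis
    have "q = p" using p q(1,2,3) unfolding minimal_projection_def by blast
    then show ?thesis using q(4) yp unfolding y_def by auto
  qed
  note ab = re_im_parts[OF x]
  obtain c d where c: "p \<otimes> re_part x \<otimes> p = c \<odot> p" and d: "p \<otimes> im_part x \<otimes> p = d \<odot> p"
    using sa[OF ab(1,2)] sa[OF ab(3,4)] by blast
  have "p \<otimes> x \<otimes> p = p \<otimes> (re_part x \<oplus> \<i> \<odot> im_part x) \<otimes> p" using ab(5) by simp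
  also have "\<dots> = p \<otimes> re_part x \<otimes> p \<oplus> \<i> \<odot> (p \<otimes> im_part x \<otimes> p)"
    using ab(1,3) pc(1) by (simp add: r_distr l_distr smult_mult_right smult_mult_left)
  also have "\<dots> = (c + \<i> * d) \<odot> p" unfolding c d using pc(1) by (simp add: smult_smult smult_add_left)
  finally show ?thesis by blast
qed

definition corner_coeff :: "'a \<Rightarrow> 'a \<Rightarrow> complex" where
  "corner_coeff p x = (THE c. p \<otimes> x \<otimes> p = c \<odot> p)"

lemma corner_coeffI:
  assumes "minimal_projection A p" "p \<otimes> x \<otimes> p = c \<odot> p" shows "corner_coeff p x = c"
  unfolding corner_coeff_def
  by (rule the_equality) (use assms minimal_projectionD[OF assms(1)] smult_right_cancel in auto)

lemma corner_coeff:
  assumes "minimal_projection A p" "x \<in> carrier A" shows "p \<otimes> x \<otimes> p = corner_coeff p x \<odot> p"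
  using corner_scalar[OF assms] corner_coeffI[OF assms(1)] by auto

lemma corner_coeff_linear:
  assumes p: "minimal_projection A p" shows "linear_functional A (corner_coeff p)"
proof -
  note pc = minimal_projectionD[OF p]
  have "corner_coeff p (x \<oplus> y) = corner_coeff p x + corner_coeff p y" if "x \<in> carrier A" "y \<in> carrier A" for x y
    by (rule corner_coeffI[OF p])
       (use that pc(1) corner_coeff[OF p] in \<open>simp add: r_distr l_distr smult_add_left\<close>)
  moreover have "corner_coeff p (c \<odot> x) = c * corner_coeff p x" if "x \<in> carrier A" for x c
    by (rule corner_coeffI[OF p])
       (use that pc(1) corner_coeff[OF p] in \<open>simp add: smult_mult_right smult_mult_left smult_smult\<close>)
  ultimately show ?thesis unfolding linear_functional_def by blast
qed

lemma lf_add: "linear_functional A f \<Longrightarrow> x \<in> carrier A \<Longrightarrow> y \<in> carrier A \<Longrightarrow> f (x \<oplus> y) = f x + f y"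
  and lf_smult: "linear_functional A f \<Longrightarrow> x \<in> carrier A \<Longrightarrow> f (c \<odot> x) = c * f x"
  unfolding linear_functional_def by auto

lemma lf_zero: "linear_functional A f \<Longrightarrow> f \<zero> = 0"
  using lf_smult[of f \<zero> 0] by simp

text \<open>For \<open>u = p x q\<close> and \<open>w = q y p\<close> the products \<open>u w\<close> and \<open>w u\<close> are multiples \<open>\<alpha> p\<close> and \<open>\<beta> q\<close>. Evaluating \<open>u w u\<close>
  in both ways gives \<open>\<alpha> u = \<beta> u\<close>. This symmetry is the source of the trace property.\<close>

lemma corner_coeff_swap:
  assumes p: "minimal_projection A p" and q: "minimal_projection A q" and xy: "x \<in> carrier A" "y \<in> carrier A"
  shows "corner_coeff p (x \<otimes> q \<otimes> y) = corner_coeff q (y \<otimes> p \<otimes> x)"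
proof -
  note pc = minimal_projectionD[OF p] and qc = minimal_projectionD[OF q]
  define u w where "u = p \<otimes> x \<otimes> q" and "w = q \<otimes> y \<otimes> p"
  have cl: "u \<in> carrier A" "w \<in> carrier A" using pc qc xy by (simp_all add: u_def w_def)
  let ?a = "corner_coeff p (x \<otimes> q \<otimes> y)" and ?b = "corner_coeff q (y \<otimes> p \<otimes> x)"
  have qq: "q \<otimes> (q \<otimes> z) = q \<otimes> z" if "z \<in> carrier A" for z using m_assoc[of q q z] that qc by simp
  have pp: "p \<otimes> (p \<otimes> z) = p \<otimes> z" if "z \<in> carrier A" for z using m_assoc[of p p z] that pc by simp
  have "u \<otimes> w = p \<otimes> (x \<otimes> q \<otimes> y) \<otimes> p" unfolding u_def w_def using pc(1) qc(1) xy by (simp add: m_assoc qq)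
  then have uw: "u \<otimes> w = ?a \<odot> p" using corner_coeff[OF p] xy qc(1) by simp
  have "w \<otimes> u = q \<otimes> (y \<otimes> p \<otimes> x) \<otimes> q" unfolding u_def w_def using pc(1) qc(1) xy by (simp add: m_assoc pp)
  then have wu: "w \<otimes> u = ?b \<odot> q" using corner_coeff[OF q] xy pc(1) by simp
  have pu: "p \<otimes> u = u" "u \<otimes> q = u" unfolding u_def using pc(1) qc(1) qc(3) xy by (simp_all add: m_assoc pp)
  have "?a \<odot> u = u \<otimes> w \<otimes> u" unfolding uw using cl pc(1) by (simp add: smult_mult_left pu)
  also have "\<dots> = u \<otimes> (w \<otimes> u)" using cl by (simp add: m_assoc)
  also have "\<dots> = ?b \<odot> u" unfolding wu using cl qc(1) by (simp add: smult_mult_right pu)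
  finally have eq: "?a \<odot> u = ?b \<odot> u" .
  show ?thesis
  proof (cases "u = \<zero>")
    case True
    have "?a \<odot> p = \<zero> \<otimes> w" using uw unfolding True by (rule sym)
    moreover have "?b \<odot> q = w \<otimes> \<zero>" using wu unfolding True by (rule sym)
    ultimately have "?a \<odot> p = \<zero>" "?b \<odot> q = \<zero>" using cl(2) by simp_all
    then show ?thesis using smult_eq_zero[OF pc(1,4)] smult_eq_zero[OF qc(1,4)] by metis
  next
    case False
    then show ?thesis using smult_right_cancel[OF cl(1) False eq] by simp
  qed
qed

text \<open>The trace is the sum of the diagonal coefficients along a complete family of minimal projections. Inserting the
  family between \<open>x\<close> and \<open>y\<close> turns \<open>\<tau> (x y)\<close> into a double sum that is symmetric by \<open>corner_coeff_swap\<close>; the same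
  lemma moves a minimal projection \<open>p\<close> into the corner, where the family sums to the unit.\<close>

lemma trace_exists:
  "\<exists>\<tau>. linear_functional A \<tau> \<and> (\<forall>x\<in>carrier A. \<forall>y\<in>carrier A. \<tau> (x \<otimes> y) = \<tau> (y \<otimes> x)) \<and>
    (\<forall>p. minimal_projection A p \<longrightarrow> \<tau> p = 1)"
proof -
  obtain e lam m where R: "resolution \<zero> e lam m" using spectral_theorem[OF finite_dim, of \<zero>] by auto
  note e = resolutionD[OF R]
  have cl: "e i \<in> carrier A" if "i < m" for i using orth_familyD(1)[OF e(1) that] .
  have insert_one: "f (x \<otimes> y) = (\<Sum>j<m. f (x \<otimes> e j \<otimes> y))"
    if f: "linear_functional A f" and xy: "x \<in> carrier A" "y \<in> carrier A" for f x y
  proof -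
    have "x \<otimes> y = x \<otimes> (\<Oplus>j\<in>{..<m}. e j) \<otimes> y" using e(4) xy by simp
    also have "x \<otimes> (\<Oplus>j\<in>{..<m}. e j) = (\<Oplus>j\<in>{..<m}. x \<otimes> e j)" by (rule finsum_rdistr) (use cl xy in auto)
    also have "\<dots> \<otimes> y = (\<Oplus>j\<in>{..<m}. x \<otimes> e j \<otimes> y)" by (rule finsum_ldistr) (use cl xy in auto)
    finally show ?thesis using functional_finsum[OF f, of "{..<m}" "\<lambda>j. x \<otimes> e j \<otimes> y"] cl xy by simp
  qed
  define \<tau> where "\<tau> x = (\<Sum>i<m. corner_coeff (e i) x)" for x
  have lin: "linear_functional A \<tau>"
    using corner_coeff_linear[OF e(2)] unfolding linear_functional_def \<tau>_def
    by (simp add: sum.distrib sum_distrib_left)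
  have "\<tau> (x \<otimes> y) = \<tau> (y \<otimes> x)" if "x \<in> carrier A" "y \<in> carrier A" for x y
  proof -
    have "\<tau> (x \<otimes> y) = (\<Sum>i<m. \<Sum>j<m. corner_coeff (e i) (x \<otimes> e j \<otimes> y))"
      unfolding \<tau>_def using insert_one[OF corner_coeff_linear[OF e(2)] that] by simp
    also have "\<dots> = (\<Sum>i<m. \<Sum>j<m. corner_coeff (e j) (y \<otimes> e i \<otimes> x))"
      by (intro sum.cong refl corner_coeff_swap e that) auto
    also have "\<dots> = (\<Sum>j<m. \<Sum>i<m. corner_coeff (e j) (y \<otimes> e i \<otimes> x))" by (rule sum.swap)
    also have "\<dots> = \<tau> (y \<otimes> x)"
      unfolding \<tau>_def using insert_one[OF corner_coeff_linear[OF e(2)] that(2,1)] by simp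
    finally show ?thesis .
  qed
  moreover have "\<tau> p = 1" if p: "minimal_projection A p" for p
  proof -
    note pc = minimal_projectionD[OF p]
    have "\<tau> p = (\<Sum>i<m. corner_coeff p (e i))"
      unfolding \<tau>_def using corner_coeff_swap[OF e(2) p, of _ \<one> \<one>] pc cl by simp
    also have "\<dots> = corner_coeff p (\<one> \<otimes> \<one>)"
      using insert_one[OF corner_coeff_linear[OF p], of \<one> \<one>] cl by simp
    also have "\<dots> = 1" by (rule corner_coeffI[OF p]) (use pc in simp)
    finally show ?thesis .
  qed
  ultimately show ?thesis using lin by blast
qed

abbreviation Tr where "Tr \<equiv> fd_trace A"

lemma Tr_props:
  "linear_functional A Tr" "\<And>x y. x \<in> carrier A \<Longrightarrow> y \<in> carrier A \<Longrightarrow> Tr (x \<otimes> y) = Tr (y \<otimes> x)"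
  "\<And>p. minimal_projection A p \<Longrightarrow> Tr p = 1"
  using someI_ex[OF trace_exists] unfolding fd_trace_def[symmetric] by blast+

lemma resolution_closed:
  assumes "resolution x e lam m" "i < m" shows "e i \<in> carrier A" "star A (e i) = e i" "e i \<otimes> e i = e i" "e i \<noteq> \<zero>"
  using orth_familyD[OF resolutionD(1)[OF assms(1)] assms(2)] by auto

lemma resolution_decompose:
  assumes R: "resolution x e lam m" and y: "y \<in> carrier A" shows "y = (\<Oplus>i\<in>{..<m}. y \<otimes> e i)"
proof -
  have "y = y \<otimes> (\<Oplus>i\<in>{..<m}. e i)" using resolutionD(4)[OF R] y by simp
  also have "\<dots> = (\<Oplus>i\<in>{..<m}. y \<otimes> e i)" by (rule finsum_rdistr) (use resolution_closed[OF R] y in auto)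
  finally show ?thesis .
qed

lemma resolution_eqI:
  assumes R: "resolution x e lam m" and "y \<in> carrier A" "z \<in> carrier A" "\<And>i. i < m \<Longrightarrow> y \<otimes> e i = z \<otimes> e i"
  shows "y = z"
proof -
  have "(\<Oplus>i\<in>{..<m}. y \<otimes> e i) = (\<Oplus>i\<in>{..<m}. z \<otimes> e i)"
    by (rule finsum_cong') (use assms resolution_closed[OF R] in auto)
  then show ?thesis using resolution_decompose[OF R] assms by metis
qed

lemma resolution_functional:
  assumes R: "resolution x e lam m" and f: "linear_functional A f" and y: "y \<in> carrier A"
  shows "f y = (\<Sum>i<m. f (y \<otimes> e i))"
  using functional_finsum[OF f, of "{..<m}" "\<lambda>i. y \<otimes> e i"] resolution_decompose[OF R y] resolution_closed[OF R] y by simp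

text \<open>Eigenvalues are counted once per minimal projection, each of which has trace 1.\<close>

lemma Tr_diagonal:
  assumes R: "resolution x e lam m" and y: "y \<in> carrier A" "\<And>i. i < m \<Longrightarrow> y \<otimes> e i = c i \<odot> e i"
  shows "Tr y = (\<Sum>i<m. c i)"
proof -
  have "Tr y = (\<Sum>i<m. Tr (c i \<odot> e i))" using resolution_functional[OF R Tr_props(1) y(1)] y(2) by simp
  also have "\<dots> = (\<Sum>i<m. c i)"
    by (intro sum.cong refl) (use lf_smult[OF Tr_props(1)] resolution_closed[OF R] Tr_props(3)[OF resolutionD(2)[OF R]] in simp)
  finally show ?thesis .
qed

lemma resolution_exists: "x \<in> carrier A \<Longrightarrow> star A x = x \<Longrightarrow> \<exists>e lam m. resolution x e lam m"
  using spectral_theorem[OF finite_dim] by metis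

lemma Tr_sa: assumes x: "x \<in> carrier A" "star A x = x" shows "cnj (Tr x) = Tr x"
proof -
  obtain e lam m where R: "resolution x e lam m" using resolution_exists[OF x] by blast
  show ?thesis using Tr_diagonal[OF R x(1) resolutionD(3)[OF R]] by simp
qed

lemma hermitian_functional:
  assumes f: "linear_functional A f" and real: "\<And>x. x \<in> carrier A \<Longrightarrow> star A x = x \<Longrightarrow> cnj (f x) = f x"
    and x: "x \<in> carrier A"
  shows "f (star A x) = cnj (f x)"
proof -
  define a b where "a = re_part x" and "b = im_part x"
  note ab = re_im_parts(1-4)[OF x, folded a_def b_def]
  have xx: "x = a \<oplus> \<i> \<odot> b" using re_im_parts(5)[OF x] unfolding a_def b_def .
  have "star A x = a \<oplus> (- \<i>) \<odot> b" unfolding xx using ab by simp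
  then show ?thesis unfolding xx using ab real[OF ab(1,2)] real[OF ab(3,4)] by (simp add: lf_add[OF f] lf_smult[OF f])
qed

lemma Tr_star: "x \<in> carrier A \<Longrightarrow> Tr (star A x) = cnj (Tr x)"
  by (rule hermitian_functional[OF Tr_props(1) Tr_sa])

lemma Tr_square:
  assumes x: "x \<in> carrier A" "star A x = x"
  shows "0 \<le> Re (Tr (x \<otimes> x))" "Re (Tr (x \<otimes> x)) = 0 \<Longrightarrow> x = \<zero>"
proof -
  obtain e lam m where R: "resolution x e lam m" using resolution_exists[OF x] by blast
  note cl = resolution_closed[OF R]
  have "(x \<otimes> x) \<otimes> e i = complex_of_real ((lam i)\<^sup>2) \<odot> e i" if "i < m" for i
    using x(1) cl[OF that] resolutionD(3)[OF R that] by (simp add: m_assoc smult_mult_right smult_smult power2_eq_square)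
  then have "Tr (x \<otimes> x) = (\<Sum>i<m. complex_of_real ((lam i)\<^sup>2))" using Tr_diagonal[OF R] x(1) by simp
  then have Tr: "Re (Tr (x \<otimes> x)) = (\<Sum>i<m. (lam i)\<^sup>2)" by simp
  then show "0 \<le> Re (Tr (x \<otimes> x))" by (simp add: sum_nonneg)
  assume "Re (Tr (x \<otimes> x)) = 0"
  then have "lam i = 0" if "i < m" for i using Tr that by (simp add: sum_nonneg_eq_0_iff)
  then show "x = \<zero>" using resolution_eqI[OF R x(1), of \<zero>] resolutionD(3)[OF R] cl by simp
qed

text \<open>By the trace property \<open>2 Tr (x\<^sup>* x) = Tr (x\<^sup>* x + x x\<^sup>*)\<close>, which is \<open>2 Tr (a\<^sup>2) + 2 Tr (b\<^sup>2)\<close> for the real and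
  imaginary parts \<open>a\<close> and \<open>b\<close>. This reduces the claim to self-adjoint elements and their eigenvalues.\<close>

lemma Tr_star_mult:
  assumes x: "x \<in> carrier A"
  shows "0 \<le> Re (Tr (star A x \<otimes> x))" "Re (Tr (star A x \<otimes> x)) = 0 \<Longrightarrow> x = \<zero>"
proof -
  define a b where "a = re_part x" and "b = im_part x"
  note ab = re_im_parts(1-4)[OF x, folded a_def b_def]
  have "2 * Tr (star A x \<otimes> x) = Tr (star A x \<otimes> x \<oplus> x \<otimes> star A x)"
    using x Tr_props(2)[of x "star A x"] by (simp add: lf_add[OF Tr_props(1)])
  also have "\<dots> = 2 * Tr (a \<otimes> a) + 2 * Tr (b \<otimes> b)"
    unfolding star_mult_add_mult_star[OF x] a_def[symmetric] b_def[symmetric]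
    using ab by (simp add: lf_add[OF Tr_props(1)] lf_smult[OF Tr_props(1)])
  finally have "Re (2 * Tr (star A x \<otimes> x)) = Re (2 * Tr (a \<otimes> a) + 2 * Tr (b \<otimes> b))" by (rule arg_cong)
  then have eq: "Re (Tr (star A x \<otimes> x)) = Re (Tr (a \<otimes> a)) + Re (Tr (b \<otimes> b))" by simp
  note sq = Tr_square[OF ab(1,2)] Tr_square[OF ab(3,4)]
  show "0 \<le> Re (Tr (star A x \<otimes> x))" using eq sq(1,3) by simp
  assume "Re (Tr (star A x \<otimes> x)) = 0"
  then have "Re (Tr (a \<otimes> a)) = 0" "Re (Tr (b \<otimes> b)) = 0" using eq sq(1,3) by linarith+
  then have ab0: "a = \<zero>" "b = \<zero>" using sq(2,4) by blast+
  have "x = a \<oplus> \<i> \<odot> b" using re_im_parts(5)[OF x] unfolding a_def b_def .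
  then have "x = \<zero> \<oplus> \<i> \<odot> \<zero>" unfolding ab0 .
  then show "x = \<zero>" by simp
qed

lemma Tr_faithful:
  assumes x: "x \<in> carrier A" and zero: "\<And>y. y \<in> carrier A \<Longrightarrow> Tr (x \<otimes> y) = 0" shows "x = \<zero>"
proof -
  have "Tr (star A x \<otimes> x) = 0" using zero[of "star A x"] Tr_props(2)[of x "star A x"] x by simp
  then show ?thesis using Tr_star_mult(2)[OF x] by simp
qed

text \<open>The corner between two minimal projections is at most one-dimensional; \<open>w\<close> spans it and \<open>v\<close> is
  the dual vector with respect to the trace.\<close>

lemma off_diagonal:
  assumes p: "minimal_projection A p" and q: "minimal_projection A q"
  shows "\<exists>w\<in>carrier A. \<exists>v\<in>carrier A. \<forall>x\<in>carrier A. p \<otimes> x \<otimes> q = Tr (v \<otimes> x) \<odot> w"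
proof (cases "\<forall>x\<in>carrier A. p \<otimes> x \<otimes> q = \<zero>")
  case True
  then show ?thesis by (intro bexI[of _ \<zero>]) auto
next
  case False
  note pc = minimal_projectionD[OF p] and qc = minimal_projectionD[OF q]
  obtain x0 where x0: "x0 \<in> carrier A" "p \<otimes> x0 \<otimes> q \<noteq> \<zero>" using False by blast
  define w where "w = p \<otimes> x0 \<otimes> q"
  have w: "w \<in> carrier A" "w \<noteq> \<zero>" using x0 pc qc by (simp_all add: w_def)
  have pp: "p \<otimes> (p \<otimes> z) = p \<otimes> z" if "z \<in> carrier A" for z using m_assoc[of p p z] that pc by simp
  have qq: "q \<otimes> (q \<otimes> z) = q \<otimes> z" if "z \<in> carrier A" for z using m_assoc[of q q z] that qc by simp
  have pw: "p \<otimes> w = w" "w \<otimes> q = w" using x0(1) pc(1) qc(1,3) by (simp_all add: w_def m_assoc pp)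
  have swp: "star A w \<otimes> p = star A w" "q \<otimes> star A w = star A w"
    using arg_cong[OF pw(1), of "star A"] arg_cong[OF pw(2), of "star A"] w pc qc by simp_all
  have "q \<otimes> (star A w \<otimes> w) \<otimes> q = corner_coeff q (star A w \<otimes> w) \<odot> q"
    by (rule corner_coeff[OF q]) (use w in simp)
  moreover have "q \<otimes> (star A w \<otimes> w) \<otimes> q = star A w \<otimes> w"
    using w qc(1) m_assoc[of q "star A w" w] m_assoc[of "star A w" w q] by (simp add: pw swp)
  ultimately obtain g where g: "star A w \<otimes> w = g \<odot> q" by metis
  have "g \<noteq> 0" using star_mult_eq_zero[OF w(1)] w(2) g qc(1) by auto
  define v where "v = inverse g \<odot> star A w"
  have v: "v \<in> carrier A" using w by (simp add: v_def)
  have vw: "v \<otimes> w = q" unfolding v_def using w qc(1) \<open>g \<noteq> 0\<close> by (simp add: smult_mult_left g smult_smult)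
  have vp: "v \<otimes> p = v" "q \<otimes> v = v" unfolding v_def using w pc qc by (simp_all add: smult_mult_left smult_mult_right swp)
  have "p \<otimes> x \<otimes> q = Tr (v \<otimes> x) \<odot> w" if x: "x \<in> carrier A" for x
  proof -
    define y where "y = p \<otimes> x \<otimes> q"
    have y: "y \<in> carrier A" using x pc qc by (simp add: y_def)
    have yq: "y \<otimes> q = y" using x pc qc by (simp add: y_def m_assoc)
    define c where "c = corner_coeff p (x \<otimes> q \<otimes> v)"
    have "y \<otimes> v = p \<otimes> (x \<otimes> q \<otimes> v) \<otimes> p" using x v pc(1) qc(1) by (simp add: y_def m_assoc vp)
    then have yv: "y \<otimes> v = c \<odot> p" unfolding c_def using corner_coeff[OF p, of "x \<otimes> q \<otimes> v"] x v qc(1) by simp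
    have "y = (y \<otimes> v) \<otimes> w" using y v w yq by (simp add: m_assoc vw)
    then have yw: "y = c \<odot> w" unfolding yv using pc(1) w by (simp add: smult_mult_left pw)
    have "Tr (v \<otimes> x) = Tr ((q \<otimes> v \<otimes> p) \<otimes> x)" by (simp add: vp)
    also have "\<dots> = Tr (q \<otimes> (v \<otimes> p \<otimes> x))" using v x pc(1) qc(1) by (simp add: m_assoc)
    also have "\<dots> = Tr ((v \<otimes> p \<otimes> x) \<otimes> q)" by (rule Tr_props(2)) (use v x pc(1) qc(1) in auto)
    also have "\<dots> = Tr (v \<otimes> y)" using v x pc(1) qc(1) by (simp add: y_def m_assoc)
    also have "\<dots> = c" unfolding yw using v w qc by (simp add: smult_mult_right vw lf_smult[OF Tr_props(1)] Tr_props(3)[OF q])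
    finally show ?thesis using yw unfolding y_def by simp
  qed
  then show ?thesis using w v by blast
qed

text \<open>Splitting \<open>x\<close> into its corners \<open>e i x e j\<close> and writing each one by \<open>off_diagonal\<close> as \<open>Tr (v x) w\<close> exhibits \<open>f\<close> as a
  sum of functionals \<open>f w \<cdot> Tr (v x)\<close>. Uniqueness is faithfulness of the trace.\<close>

lemma density_exists:
  assumes f: "linear_functional A f"
  shows "\<exists>!\<rho>. \<rho> \<in> carrier A \<and> (\<forall>x\<in>carrier A. f x = Tr (\<rho> \<otimes> x))"
proof (rule ex_ex1I)
  obtain e lam m where R: "resolution \<zero> e lam m" using resolution_exists[of \<zero>] by auto
  note cl = resolution_closed[OF R]
  have "\<forall>i j. \<exists>w v. i < m \<longrightarrow> j < m \<longrightarrow> w \<in> carrier A \<and> v \<in> carrier A \<and> (\<forall>x\<in>carrier A. e i \<otimes> x \<otimes> e j = Tr (v \<otimes> x) \<odot> w)"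
    using off_diagonal resolutionD(2)[OF R] by meson
  then obtain w v where wv: "\<And>i j. i < m \<Longrightarrow> j < m \<Longrightarrow> w i j \<in> carrier A \<and> v i j \<in> carrier A \<and>
      (\<forall>x\<in>carrier A. e i \<otimes> x \<otimes> e j = Tr (v i j \<otimes> x) \<odot> w i j)" by metis
  define \<rho>1 where "\<rho>1 i = (\<Oplus>j\<in>{..<m}. f (w i j) \<odot> v i j)" for i
  define \<rho> where "\<rho> = (\<Oplus>i\<in>{..<m}. \<rho>1 i)"
  have \<rho>1: "\<rho>1 i \<in> carrier A" if "i < m" for i unfolding \<rho>1_def by (rule finsum_closed) (use wv that in auto)
  have \<rho>: "\<rho> \<in> carrier A" unfolding \<rho>_def by (rule finsum_closed) (use \<rho>1 in auto)
  have "f x = Tr (\<rho> \<otimes> x)" if x: "x \<in> carrier A" for x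
  proof -
    have left: "y = (\<Oplus>i\<in>{..<m}. e i \<otimes> y)" if y: "y \<in> carrier A" for y
    proof -
      have "y = (\<Oplus>i\<in>{..<m}. e i) \<otimes> y" using resolutionD(4)[OF R] y by simp
      also have "\<dots> = (\<Oplus>i\<in>{..<m}. e i \<otimes> y)" by (rule finsum_ldistr) (use cl y in auto)
      finally show ?thesis .
    qed
    have "f x = (\<Sum>i<m. f (e i \<otimes> x))"
      using left[OF x] functional_finsum[OF f, of "{..<m}" "\<lambda>i. e i \<otimes> x"] cl x by simp
    also have "\<dots> = (\<Sum>i<m. \<Sum>j<m. f (e i \<otimes> x \<otimes> e j))"
      by (intro sum.cong refl resolution_functional[OF R f]) (use cl x in auto)
    also have "\<dots> = (\<Sum>i<m. \<Sum>j<m. f (w i j) * Tr (v i j \<otimes> x))"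
      by (intro sum.cong refl) (use wv x lf_smult[OF f] in \<open>auto simp: mult.commute\<close>)
    also have "\<dots> = (\<Sum>i<m. Tr (\<rho>1 i \<otimes> x))"
    proof (intro sum.cong refl)
      fix i assume i: "i \<in> {..<m}"
      have "\<rho>1 i \<otimes> x = (\<Oplus>j\<in>{..<m}. f (w i j) \<odot> v i j \<otimes> x)"
        unfolding \<rho>1_def by (rule finsum_ldistr) (use wv x i in auto)
      then have "Tr (\<rho>1 i \<otimes> x) = (\<Sum>j<m. Tr (f (w i j) \<odot> v i j \<otimes> x))"
        using functional_finsum[OF Tr_props(1), of "{..<m}" "\<lambda>j. f (w i j) \<odot> v i j \<otimes> x"] wv x i by simp
      also have "\<dots> = (\<Sum>j<m. f (w i j) * Tr (v i j \<otimes> x))"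
        by (intro sum.cong refl) (use wv x i lf_smult[OF Tr_props(1)] in \<open>auto simp: smult_mult_left\<close>)
      finally show "(\<Sum>j<m. f (w i j) * Tr (v i j \<otimes> x)) = Tr (\<rho>1 i \<otimes> x)" by simp
    qed
    also have "\<dots> = Tr (\<rho> \<otimes> x)"
    proof -
      have "\<rho> \<otimes> x = (\<Oplus>i\<in>{..<m}. \<rho>1 i \<otimes> x)" unfolding \<rho>_def by (rule finsum_ldistr) (use \<rho>1 x in auto)
      then show ?thesis using functional_finsum[OF Tr_props(1), of "{..<m}" "\<lambda>i. \<rho>1 i \<otimes> x"] \<rho>1 x by simp
    qed
    finally show ?thesis .
  qed
  then show "\<exists>\<rho>. \<rho> \<in> carrier A \<and> (\<forall>x\<in>carrier A. f x = Tr (\<rho> \<otimes> x))" using \<rho> by blast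
next
  fix \<rho> \<rho>' assume r: "\<rho> \<in> carrier A \<and> (\<forall>x\<in>carrier A. f x = Tr (\<rho> \<otimes> x))" "\<rho>' \<in> carrier A \<and> (\<forall>x\<in>carrier A. f x = Tr (\<rho>' \<otimes> x))"
  have "\<rho> \<ominus> \<rho>' = \<zero>"
  proof (rule Tr_faithful)
    fix y assume y: "y \<in> carrier A"
    have "Tr (\<rho> \<otimes> y \<oplus> (-1) \<odot> (\<rho>' \<otimes> y)) = Tr (\<rho> \<otimes> y) + (-1) * Tr (\<rho>' \<otimes> y)"
      using r y by (simp add: lf_add[OF Tr_props(1)] lf_smult[OF Tr_props(1)] del: mult_minus1)
    moreover have cl: "\<rho> \<in> carrier A" "\<rho>' \<in> carrier A" using r by auto
    then have "(\<rho> \<ominus> \<rho>') \<otimes> y = \<rho> \<otimes> y \<oplus> (-1) \<odot> (\<rho>' \<otimes> y)"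
      unfolding mult_diff(2)[OF cl(1) cl(2) y] using cl y by (intro diff_smult) auto
    moreover have "f y = Tr (\<rho> \<otimes> y)" "f y = Tr (\<rho>' \<otimes> y)" using r y by blast+
    ultimately show "Tr ((\<rho> \<ominus> \<rho>') \<otimes> y) = 0" by simp
  qed (use r in auto)
  then show "\<rho> = \<rho>'" using diff_eq_zero r by blast
qed

lemma density:
  assumes f: "linear_functional A f"
  shows "density A f \<in> carrier A" "\<And>x. x \<in> carrier A \<Longrightarrow> f x = Tr (density A f \<otimes> x)"
  using theI'[OF density_exists[OF f]] unfolding density_def[symmetric] by auto

lemma density_sa:
  assumes f: "linear_functional A f" and herm: "\<And>x. x \<in> carrier A \<Longrightarrow> f (star A x) = cnj (f x)"
  shows "star A (density A f) = density A f"
proof -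
  let ?\<rho> = "density A f"
  note d = density[OF f]
  have "f x = Tr (star A ?\<rho> \<otimes> x)" if x: "x \<in> carrier A" for x
  proof -
    have "f x = cnj (f (star A x))" using herm[OF x] by simp
    also have "\<dots> = cnj (Tr (?\<rho> \<otimes> star A x))" using d(2)[of "star A x"] x by simp
    also have "\<dots> = Tr (star A (?\<rho> \<otimes> star A x))" using Tr_star[of "?\<rho> \<otimes> star A x"] d(1) x by simp
    also have "\<dots> = Tr (star A ?\<rho> \<otimes> x)" using Tr_props(2)[of x "star A ?\<rho>"] d(1) x by simp
    finally show ?thesis .
  qed
  then show ?thesis using density_exists[OF f] d star_closed[OF d(1)] by blast
qed

lemma spectrum_resolution:
  assumes R: "resolution x e lam m" and x: "x \<in> carrier A"
  shows "spectrum A x = (\<lambda>i. complex_of_real (lam i)) ` {..<m}"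
proof (intro equalityI subsetI)
  note cl = resolution_closed[OF R]
  fix c assume c: "c \<in> spectrum A x"
  show "c \<in> (\<lambda>i. complex_of_real (lam i)) ` {..<m}"
  proof (rule ccontr)
    assume "c \<notin> (\<lambda>i. complex_of_real (lam i)) ` {..<m}"
    then have ne: "complex_of_real (lam i) - c \<noteq> 0" if "i < m" for i using that by auto
    define u where "u = (\<Oplus>i\<in>{..<m}. inverse (complex_of_real (lam i) - c) \<odot> e i)"
    have u: "u \<in> carrier A" unfolding u_def by (rule finsum_closed) (use cl in auto)
    have ue: "u \<otimes> e i = inverse (complex_of_real (lam i) - c) \<odot> e i" if "i < m" for i
      unfolding u_def by (rule orth_finsum_mult(1)[OF resolutionD(1)[OF R] that])
    define z where "z = x \<ominus> c \<odot> \<one>"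
    have z: "z \<in> carrier A" using x by (simp add: z_def)
    have ze: "z \<otimes> e i = (complex_of_real (lam i) - c) \<odot> e i" if "i < m" for i
      unfolding z_def using x cl[OF that] resolutionD(3)[OF R that] by (simp add: mult_diff smult_mult_left smult_diff_left)
    have "u \<otimes> z = \<one>" by (rule resolution_eqI[OF R]) (use u z ue ze ne cl in \<open>simp_all add: m_assoc smult_mult_right smult_smult\<close>)
    moreover have "z \<otimes> u = \<one>" by (rule resolution_eqI[OF R]) (use u z ue ze ne cl in \<open>simp_all add: m_assoc smult_mult_right smult_smult\<close>)
    ultimately have "z \<in> Units A" using u z unfolding Units_def by blast
    then show False using c unfolding spectrum_def z_def by blast
  qed
next
  note cl = resolution_closed[OF R]
  fix c assume "c \<in> (\<lambda>i. complex_of_real (lam i)) ` {..<m}"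
  then obtain i where i: "i < m" "c = complex_of_real (lam i)" by blast
  show "c \<in> spectrum A x"
  proof (rule ccontr)
    assume "c \<notin> spectrum A x"
    then have "x \<ominus> c \<odot> \<one> \<in> Units A" unfolding spectrum_def by blast
    then obtain u where u: "u \<in> carrier A" "u \<otimes> (x \<ominus> c \<odot> \<one>) = \<one>" unfolding Units_def by blast
    have "(x \<ominus> c \<odot> \<one>) \<otimes> e i = \<zero>"
      using x cl[OF i(1)] resolutionD(3)[OF R i(1)] by (simp add: mult_diff smult_mult_left i(2))
    then have "u \<otimes> ((x \<ominus> c \<odot> \<one>) \<otimes> e i) = \<zero>" using u by simp
    then have "e i = \<zero>" using m_assoc[of u "x \<ominus> c \<odot> \<one>" "e i"] u x cl[OF i(1)] by simp
    then show False using cl[OF i(1)] by blast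
  qed
qed

text \<open>An interpolating polynomial acts on the \<open>i\<close>th eigenprojection as the number \<open>g (lam i)\<close>, whichever polynomial is chosen.\<close>

lemma Tr_calculus:
  assumes R: "resolution x e lam m" and x: "x \<in> carrier A"
  shows "Tr (fd_calculus A g x) = (\<Sum>i<m. complex_of_real (g (lam i)))"
proof -
  note cl = resolution_closed[OF R]
  obtain p where p: "\<forall>c\<in>spectrum A x. poly p c = complex_of_real (g (Re c))"
    using interpolation[of "spectrum A x" "\<lambda>c. complex_of_real (g (Re c))"] spectrum_resolution[OF R x] by auto
  have val: "poly_cstar A q x \<otimes> e i = complex_of_real (g (lam i)) \<odot> e i"
    if "\<forall>c\<in>spectrum A x. poly q c = complex_of_real (g (Re c))" "i < m" for q i
    using poly_cstar_eigen[OF x cl(1)[OF that(2)] resolutionD(3)[OF R that(2)], of q] that spectrum_resolution[OF R x] by auto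
  have "fd_calculus A g x = poly_cstar A p x"
    unfolding fd_calculus_def
  proof (rule the_equality)
    show "\<exists>q. (\<forall>c\<in>spectrum A x. poly q c = complex_of_real (g (Re c))) \<and> poly_cstar A p x = poly_cstar A q x"
      using p by blast
    fix y assume "\<exists>q. (\<forall>c\<in>spectrum A x. poly q c = complex_of_real (g (Re c))) \<and> y = poly_cstar A q x"
    then obtain q where q: "\<forall>c\<in>spectrum A x. poly q c = complex_of_real (g (Re c))" "y = poly_cstar A q x" by blast
    show "y = poly_cstar A p x" unfolding q(2)
      by (rule resolution_eqI[OF R]) (use x val[OF q(1)] val[OF p] in simp_all)
  qed
  then show ?thesis using Tr_diagonal[OF R, of "poly_cstar A p x"] val[OF p] x by simp
qed

text \<open>The partial sums of the exponential series converge on each eigenprojection, and there are finitely many of them.\<close>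

lemma Tr_exp:
  assumes R: "resolution x e lam m" and x: "x \<in> carrier A"
  shows "Tr (cstar_exp A x) = (\<Sum>i<m. complex_of_real (exp (lam i)))"
proof -
  note cl = resolution_closed[OF R]
  define y where "y = (\<Oplus>i\<in>{..<m}. complex_of_real (exp (lam i)) \<odot> e i)"
  have y: "y \<in> carrier A" unfolding y_def by (rule finsum_closed) (use cl in auto)
  have ye: "y \<otimes> e i = complex_of_real (exp (lam i)) \<odot> e i" if "i < m" for i
    unfolding y_def by (rule orth_finsum_mult(1)[OF resolutionD(1)[OF R] that])
  define s where "s n = (\<Oplus>k\<in>{..<n}. complex_of_real (1 / fact k) \<odot> (x [^] k))" for n :: nat
  have s: "s n \<in> carrier A" for n unfolding s_def by (rule finsum_closed) (use x in auto)
  have pe: "x [^] (k::nat) \<otimes> e i = complex_of_real (lam i ^ k) \<odot> e i" if i: "i < m" for i k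
  proof (induction k)
    case (Suc k)
    have "x [^] Suc k \<otimes> e i = x \<otimes> (x [^] k \<otimes> e i)" using x cl[OF i] by (simp only: pow_Suc2 m_assoc pow_closed)
    then show ?case using x cl[OF i] resolutionD(3)[OF R i] by (simp add: Suc.IH smult_mult_right smult_smult mult.commute)
  qed (use cl[OF i] pow_0 in simp)
  have se: "s n \<otimes> e i = complex_of_real (\<Sum>k<n. lam i ^ k / fact k) \<odot> e i" if i: "i < m" for i n
  proof -
    have "s n \<otimes> e i = (\<Oplus>k\<in>{..<n}. complex_of_real (1 / fact k) \<odot> (x [^] k) \<otimes> e i)"
      unfolding s_def by (rule finsum_ldistr) (use x cl[OF i] in auto)
    also have "\<dots> = (\<Oplus>k\<in>{..<n}. complex_of_real (lam i ^ k / fact k) \<odot> e i)"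
      by (rule finsum_cong') (use x cl[OF i] pe[OF i] in \<open>auto simp: smult_mult_left smult_smult\<close>)
    also have "\<dots> = (\<Sum>k<n. complex_of_real (lam i ^ k / fact k)) \<odot> e i" by (rule sum_smult[symmetric]) (use cl[OF i] in auto)
    finally show ?thesis by simp
  qed
  have norm_sum: "cnorm A (\<Oplus>i\<in>I. f i) \<le> (\<Sum>i\<in>I. cnorm A (f i))" if "finite I" "\<And>i. i \<in> I \<Longrightarrow> f i \<in> carrier A" for I :: "nat set" and f
    using that
  proof (induction I rule: finite_induct)
    case (insert i I)
    have "cnorm A (f i \<oplus> (\<Oplus>i\<in>I. f i)) \<le> cnorm A (f i) + cnorm A (\<Oplus>i\<in>I. f i)"
      by (rule cnorm_add) (use insert finsum_closed[of f I] in \<open>auto simp: Pi_def\<close>)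
    then show ?case using insert finsum_insert[of I i f] by (simp add: Pi_def)
  qed (simp add: finsum_empty)
  have lim: "limit s y"
  proof (rule limit_squeeze)
    fix n
    have "s n \<ominus> y = (\<Oplus>i\<in>{..<m}. (s n \<ominus> y) \<otimes> e i)" by (rule resolution_decompose[OF R]) (use s y in simp)
    then have "cnorm A (s n \<ominus> y) \<le> (\<Sum>i<m. cnorm A ((s n \<ominus> y) \<otimes> e i))"
      using norm_sum[of "{..<m}" "\<lambda>i. (s n \<ominus> y) \<otimes> e i"] s y cl by simp
    also have "\<dots> = (\<Sum>i<m. \<bar>(\<Sum>k<n. lam i ^ k / fact k) - exp (lam i)\<bar> * cnorm A (e i))"
    proof (intro sum.cong refl)
      fix i assume i: "i \<in> {..<m}"
      have "(s n \<ominus> y) \<otimes> e i = complex_of_real ((\<Sum>k<n. lam i ^ k / fact k) - exp (lam i)) \<odot> e i"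
        using s[of n] y cl[of i] i se[of i n] ye[of i] by (simp add: mult_diff smult_diff_left)
      then show "cnorm A ((s n \<ominus> y) \<otimes> e i) = \<bar>(\<Sum>k<n. lam i ^ k / fact k) - exp (lam i)\<bar> * cnorm A (e i)"
        using cl[of i] i by (simp only: cnorm_smult norm_of_real lessThan_iff)
    qed
    finally show "cnorm A (s n \<ominus> y) \<le> (\<Sum>i<m. \<bar>(\<Sum>k<n. lam i ^ k / fact k) - exp (lam i)\<bar> * cnorm A (e i))" .
  next
    have "(\<lambda>n. \<Sum>k<n. l ^ k / fact k) \<longlonglongrightarrow> exp l" for l :: real
      using exp_converges[of l] unfolding sums_def by (simp add: divide_inverse mult.commute)
    then have "(\<lambda>n. \<Sum>i<m. \<bar>(\<Sum>k<n. lam i ^ k / fact k) - exp (lam i)\<bar> * cnorm A (e i))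
        \<longlonglongrightarrow> (\<Sum>i<m. \<bar>exp (lam i) - exp (lam i)\<bar> * cnorm A (e i))"
      by (intro tendsto_intros)
    then show "(\<lambda>n. \<Sum>i<m. \<bar>(\<Sum>k<n. lam i ^ k / fact k) - exp (lam i)\<bar> * cnorm A (e i)) \<longlonglongrightarrow> 0" by simp
  qed (use s y in auto)
  have "cstar_exp A x = y"
    unfolding cstar_exp_def s_def[symmetric] limit_def[symmetric]
    by (rule the_equality) (use y lim s limit_unique[of s _ y] in blast)+
  then show ?thesis using Tr_diagonal[OF R y ye] by simp
qed

text \<open>The array \<open>c i j = Tr (p\<^sub>i q\<^sub>j)\<close>, formed from the minimal spectral projections of the density and of \<open>h\<close>, is
  nonnegative with row and column sums 1. It turns \<open>S(f) + f(h) - ln (Tr (exp h))\<close> into an average of the terms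
  \<open>lam\<^sub>i (mu\<^sub>j - ln lam\<^sub>i - ln Z)\<close>, each estimated by \<open>ln t \<le> t - 1\<close>; the estimates sum to 0.\<close>

theorem Gibbs_inequality:
  assumes f: "linear_functional A f" and pos: "\<And>x. x \<in> carrier A \<Longrightarrow> f (star A x \<otimes> x) \<in> \<real>\<^sub>\<ge>\<^sub>0"
    and unit: "f \<one> = 1" and h: "h \<in> carrier A" "star A h = h"
  shows "exp (von_neumann_entropy A f + Re (f h)) \<le> Re (Tr (cstar_exp A h))"
proof -
  have real: "cnj (f x) = f x" if x: "x \<in> carrier A" "star A x = x" for x
  proof -
    have sq: "cnj (f (y \<otimes> y)) = f (y \<otimes> y)" if "y \<in> carrier A" "star A y = y" for y
      using pos[OF that(1)] that(2) by (auto simp: nonneg_Reals_def)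
    have "(x \<oplus> \<one>) \<otimes> (x \<oplus> \<one>) = x \<otimes> x \<oplus> (2 \<odot> x \<oplus> \<one>)" using x(1) by (simp add: smult_2 ring_normalize)
    then have "f ((x \<oplus> \<one>) \<otimes> (x \<oplus> \<one>)) = f (x \<otimes> x) + (2 * f x + 1)"
      using x(1) by (simp add: lf_add[OF f] lf_smult[OF f] unit)
    then have "2 * f x = f ((x \<oplus> \<one>) \<otimes> (x \<oplus> \<one>)) - f (x \<otimes> x) - 1" by simp
    then have "cnj (2 * f x) = 2 * f x" using sq[of "x \<oplus> \<one>"] sq[OF x] x by simp
    then show ?thesis by simp
  qed
  define \<rho> where "\<rho> = density A f"
  have fT: "f x = Tr (\<rho> \<otimes> x)" if "x \<in> carrier A" for x
    unfolding \<rho>_def by (rule density(2)[OF f that])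
  have herm: "f (star A x) = cnj (f x)" if "x \<in> carrier A" for x
    by (rule hermitian_functional[OF f _ that], rule real)
  have \<rho>: "\<rho> \<in> carrier A" "star A \<rho> = \<rho>"
    unfolding \<rho>_def by (rule density(1)[OF f], rule density_sa[OF f herm])
  obtain p lam m where P: "resolution \<rho> p lam m" using resolution_exists[OF \<rho>] by blast
  obtain q mu n where Q: "resolution h q mu n" using resolution_exists[OF h] by blast
  note pc = resolution_closed[OF P] and qc = resolution_closed[OF Q]
  have fp: "f (p i \<otimes> x) = complex_of_real (lam i) * Tr (p i \<otimes> x)" if "i < m" "x \<in> carrier A" for i x
  proof -
    have "\<rho> \<otimes> (p i \<otimes> x) = (\<rho> \<otimes> p i) \<otimes> x" using \<rho>(1) pc(1)[OF that(1)] that(2) by (simp add: m_assoc)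
    also have "\<dots> = complex_of_real (lam i) \<odot> (p i \<otimes> x)"
      unfolding resolutionD(3)[OF P that(1)] using pc(1)[OF that(1)] that(2) by (rule smult_mult_left)
    finally have "f (p i \<otimes> x) = Tr (complex_of_real (lam i) \<odot> (p i \<otimes> x))"
      using fT[of "p i \<otimes> x"] pc(1)[OF that(1)] that(2) by simp
    then show ?thesis using lf_smult[OF Tr_props(1)] pc(1)[OF that(1)] that(2) by simp
  qed
  have fpi: "f (p i) = complex_of_real (lam i)" if "i < m" for i
    using fp[OF that, of \<one>] pc[OF that] Tr_props(3)[OF resolutionD(2)[OF P that]] by simp
  have lam0: "0 \<le> lam i" if "i < m" for i
    using pos[OF pc(1)[OF that]] pc[OF that] fpi[OF that] by simp
  have sumP: "g x = (\<Sum>i<m. g (p i \<otimes> x))" if "linear_functional A g" "x \<in> carrier A" for g x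
  proof -
    have "x = (\<Oplus>i\<in>{..<m}. p i) \<otimes> x" using resolutionD(4)[OF P] that(2) by simp
    also have "\<dots> = (\<Oplus>i\<in>{..<m}. p i \<otimes> x)" by (rule finsum_ldistr) (use pc that(2) in auto)
    finally show ?thesis using functional_finsum[OF that(1), of "{..<m}" "\<lambda>i. p i \<otimes> x"] pc that(2) by simp
  qed
  define c where "c i j = Re (Tr (p i \<otimes> q j))" for i j
  have c0: "0 \<le> c i j" if "i < m" "j < n" for i j
  proof -
    note pi = pc[OF that(1)] and qj = qc[OF that(2)]
    have "p i \<otimes> (p i \<otimes> q j) = (p i \<otimes> p i) \<otimes> q j" by (rule m_assoc[symmetric]) (rule pi qj)+
    then have pp: "p i \<otimes> (p i \<otimes> q j) = p i \<otimes> q j" unfolding pi(3) .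
    have "star A (p i \<otimes> q j) \<otimes> (p i \<otimes> q j) = q j \<otimes> (p i \<otimes> (p i \<otimes> q j))"
      using pi(1,2) qj(1,2) by (simp add: m_assoc)
    then have "star A (p i \<otimes> q j) \<otimes> (p i \<otimes> q j) = q j \<otimes> (p i \<otimes> q j)" unfolding pp .
    then have "Tr (star A (p i \<otimes> q j) \<otimes> (p i \<otimes> q j)) = Tr ((p i \<otimes> q j) \<otimes> q j)"
      using Tr_props(2)[of "q j" "p i \<otimes> q j"] pi(1) qj(1) by simp
    also have "(p i \<otimes> q j) \<otimes> q j = p i \<otimes> q j" using pi(1) qj(1,3) by (simp add: m_assoc)
    finally show ?thesis using Tr_star_mult(1)[of "p i \<otimes> q j"] pc[OF that(1)] qc[OF that(2)] by (simp add: c_def)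
  qed
  have row: "(\<Sum>j<n. c i j) = 1" if "i < m" for i
    using resolution_functional[OF Q Tr_props(1) pc(1)[OF that]] Tr_props(3)[OF resolutionD(2)[OF P that]]
    by (simp add: c_def flip: Re_sum)
  have col: "(\<Sum>i<m. c i j) = 1" if "j < n" for j
    using sumP[OF Tr_props(1) qc(1)[OF that]] Tr_props(3)[OF resolutionD(2)[OF Q that]]
    by (simp add: c_def flip: Re_sum)
  have rowK: "(\<Sum>j<n. c i j * K) = K" if "i < m" for i K
    using row[OF that] by (simp add: sum_distrib_right[symmetric])
  have colK: "(\<Sum>i<m. c i j * K) = K" if "j < n" for j K
    using col[OF that] by (simp add: sum_distrib_right[symmetric])
  have sum1: "(\<Sum>i<m. lam i) = 1"
  proof -
    have "1 = (\<Sum>i<m. complex_of_real (lam i))" using sumP[OF f, of \<one>] unit fpi pc by simp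
    then show ?thesis by (metis of_real_eq_iff of_real_sum of_real_1)
  qed
  have fh: "Re (f h) = (\<Sum>i<m. \<Sum>j<n. lam i * c i j * mu j)"
  proof -
    have "f h = (\<Sum>i<m. f (p i \<otimes> h))" by (rule sumP[OF f h(1)])
    also have "\<dots> = (\<Sum>i<m. complex_of_real (lam i) * (\<Sum>j<n. complex_of_real (mu j) * Tr (p i \<otimes> q j)))"
    proof (intro sum.cong refl)
      fix i assume i: "i \<in> {..<m}"
      have "Tr (p i \<otimes> h) = (\<Sum>j<n. Tr ((p i \<otimes> h) \<otimes> q j))"
        by (rule resolution_functional[OF Q Tr_props(1)]) (use pc i h in auto)
      also have "\<dots> = (\<Sum>j<n. complex_of_real (mu j) * Tr (p i \<otimes> q j))"
        by (intro sum.cong refl)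
           (use pc[of i] qc i h resolutionD(3)[OF Q] lf_smult[OF Tr_props(1)] in \<open>simp add: m_assoc smult_mult_right\<close>)
      finally show "f (p i \<otimes> h) = complex_of_real (lam i) * (\<Sum>j<n. complex_of_real (mu j) * Tr (p i \<otimes> q j))"
        using fp[of i h] i h by simp
    qed
    finally show ?thesis by (simp add: c_def sum_distrib_left mult_ac)
  qed
  have entropy: "von_neumann_entropy A f = (\<Sum>i<m. - lam i * ln (lam i))"
    unfolding von_neumann_entropy_def \<rho>_def[symmetric] Tr_calculus[OF P \<rho>(1)] by simp
  define Z where "Z = (\<Sum>j<n. exp (mu j))"
  have Z: "Re (Tr (cstar_exp A h)) = Z" unfolding Tr_exp[OF Q h(1)] Z_def by simp
  have "n \<noteq> 0"
  proof
    assume "n = 0"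
    have "m \<noteq> 0"
    proof
      assume "m = 0"
      then show False using sum1 by simp
    qed
    then show False using row[of 0] \<open>n = 0\<close> by simp
  qed
  then have Zpos: "0 < Z" unfolding Z_def by (intro sum_pos) auto
  \<comment> \<open>For \<open>lam i = 0\<close> the convention \<open>ln 0 = 0\<close> is harmless because of the factor \<open>lam i\<close>.\<close>
  have term_le: "lam i * (mu j - ln (lam i) - ln Z) \<le> exp (mu j) / Z - lam i" if "i < m" for i j
  proof (cases "lam i = 0")
    case True
    then show ?thesis using Zpos by simp
  next
    case False
    then have l: "0 < lam i" using lam0[OF that] by simp
    define t where "t = exp (mu j) / (Z * lam i)"
    have t: "0 < t" unfolding t_def using l Zpos by simp
    have "ln t = mu j - ln (lam i) - ln Z" unfolding t_def using l Zpos by (simp add: ln_div ln_mult)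
    moreover have "lam i * ln t \<le> lam i * (t - 1)" using ln_le_minus_one[OF t] l by (intro mult_left_mono) auto
    moreover have "lam i * (t - 1) = exp (mu j) / Z - lam i" unfolding t_def using l Zpos by (simp add: field_simps)
    ultimately show ?thesis by simp
  qed
  have "von_neumann_entropy A f + Re (f h) - ln Z = (\<Sum>i<m. \<Sum>j<n. c i j * (lam i * (mu j - ln (lam i) - ln Z)))"
  proof -
    have 1: "(\<Sum>i<m. - lam i * ln (lam i)) = (\<Sum>i<m. \<Sum>j<n. c i j * (- lam i * ln (lam i)))"
      by (rule sum.cong[OF refl], rule rowK[symmetric]) simp
    have "(\<Sum>i<m. \<Sum>j<n. c i j * (lam i * ln Z)) = (\<Sum>i<m. lam i * ln Z)"
      by (rule sum.cong[OF refl], rule rowK) simp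
    also have "\<dots> = ln Z" using sum1 by (simp add: sum_distrib_right[symmetric])
    finally have 2: "ln Z = (\<Sum>i<m. \<Sum>j<n. c i j * (lam i * ln Z))" by simp
    have "(\<Sum>i<m. \<Sum>j<n. c i j * (lam i * (mu j - ln (lam i) - ln Z))) =
        (\<Sum>i<m. \<Sum>j<n. c i j * (- lam i * ln (lam i)) + lam i * c i j * mu j - c i j * (lam i * ln Z))"
      by (intro sum.cong refl) (simp add: algebra_simps)
    also have "\<dots> = (\<Sum>i<m. \<Sum>j<n. c i j * (- lam i * ln (lam i))) + (\<Sum>i<m. \<Sum>j<n. lam i * c i j * mu j)
        - (\<Sum>i<m. \<Sum>j<n. c i j * (lam i * ln Z))"
      by (simp only: sum.distrib sum_subtractf)
    finally show ?thesis unfolding entropy fh 1 using 2 by simp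
  qed
  also have "\<dots> \<le> (\<Sum>i<m. \<Sum>j<n. c i j * (exp (mu j) / Z - lam i))"
    by (intro sum_mono mult_left_mono term_le c0) auto
  also have "\<dots> = (\<Sum>i<m. \<Sum>j<n. c i j * (exp (mu j) / Z)) - (\<Sum>i<m. \<Sum>j<n. c i j * lam i)"
    by (simp add: sum_subtractf right_diff_distrib)
  also have "(\<Sum>i<m. \<Sum>j<n. c i j * lam i) = (\<Sum>i<m. lam i)"
    by (rule sum.cong[OF refl], rule rowK) simp
  also have "(\<Sum>i<m. \<Sum>j<n. c i j * (exp (mu j) / Z)) = (\<Sum>j<n. \<Sum>i<m. c i j * (exp (mu j) / Z))" by (rule sum.swap)
  also have "\<dots> = (\<Sum>j<n. exp (mu j) / Z)" by (rule sum.cong[OF refl], rule colK) simp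
  also have "\<dots> = Z / Z" unfolding Z_def by (rule sum_divide_distrib[symmetric])
  also have "Z / Z - (\<Sum>i<m. lam i) = 0" using Zpos sum1 by simp
  finally have "von_neumann_entropy A f + Re (f h) \<le> ln Z" by simp
  then have "exp (von_neumann_entropy A f + Re (f h)) \<le> exp (ln Z)" by simp
  then show ?thesis unfolding Z exp_ln[OF Zpos] .
qed

end

section \<open>Pressure and entropy\<close>

lemma limsup_le_add:
  fixes u v :: "nat \<Rightarrow> ereal"
  assumes "\<And>n. n \<ge> 1 \<Longrightarrow> u n + ereal r \<le> v n" shows "limsup u + ereal r \<le> limsup v"
proof -
  have "limsup u + ereal r = limsup (\<lambda>n. u n + ereal r)"
    by (rule Limsup_add_ereal_right[symmetric]) auto
  also have "\<dots> \<le> limsup v"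
    by (rule Limsup_mono) (use assms in \<open>auto simp: eventually_sequentially\<close>)
  finally show ?thesis .
qed

lemma SUP_add_real_leI:
  fixes f :: "'i \<Rightarrow> ereal"
  assumes "\<And>i. i \<in> I \<Longrightarrow> f i + ereal r \<le> b" shows "(SUP i\<in>I. f i) + ereal r \<le> b"
proof -
  have "(SUP i\<in>I. f i) \<le> b - ereal r"
  proof (rule SUP_least)
    fix i assume "i \<in> I"
    from assms[OF this] show "f i \<le> b - ereal r" by (cases "f i"; cases b) auto
  qed
  then show ?thesis by (cases "SUP i\<in>I. f i"; cases b) auto
qed

text \<open>The Cauchy-Schwarz inequality \<open>\<bar>\<omega>(x)\<bar>\<^sup>2 \<le> \<omega>(1) \<omega>(x\<^sup>* x)\<close> bounds \<open>\<omega>\<close> on the unit ball by the square root of \<open>\<omega>(1)\<close>, so norm 1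
  forces \<open>\<omega>(1) = 1\<close>.\<close>

lemma state_one:
  assumes D: "cstar_algebra D" and st: "state D \<omega>"
  shows "\<omega> \<one>\<^bsub>D\<^esub> = 1" and "\<And>x. x \<in> carrier D \<Longrightarrow> cmod (\<omega> x) \<le> cnorm D x"
proof -
  interpret D: cstar_algebra D by fact
  have lf: "linear_functional D \<omega>" and pos: "\<And>x. x \<in> carrier D \<Longrightarrow> \<omega> (star D x \<otimes>\<^bsub>D\<^esub> x) \<in> \<real>\<^sub>\<ge>\<^sub>0"
    and sup: "(SUP x\<in>{x\<in>carrier D. cnorm D x \<le> 1}. ereal (cmod (\<omega> x))) = 1"
    using st by (auto simp: state_def)
  have le1: "cmod (\<omega> x) \<le> 1" if "x \<in> carrier D" "cnorm D x \<le> 1" for x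
  proof -
    have "ereal (cmod (\<omega> x)) \<le> (SUP x\<in>{x\<in>carrier D. cnorm D x \<le> 1}. ereal (cmod (\<omega> x)))"
      by (rule SUP_upper) (use that in auto)
    then show ?thesis unfolding sup by simp
  qed
  have add: "\<omega> (x \<oplus>\<^bsub>D\<^esub> y) = \<omega> x + \<omega> y" and sm: "\<omega> (c \<odot>\<^bsub>D\<^esub> x) = c * \<omega> x"
    if "x \<in> carrier D" "y \<in> carrier D" for x y c
    using lf that unfolding linear_functional_def by auto
  have z: "\<omega> \<zero>\<^bsub>D\<^esub> = 0" using sm[of "\<zero>\<^bsub>D\<^esub>" "\<zero>\<^bsub>D\<^esub>" 0] by simp
  show "cmod (\<omega> x) \<le> cnorm D x" if x: "x \<in> carrier D" for x
  proof (cases "x = \<zero>\<^bsub>D\<^esub>")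
    case False
    obtain t y where y: "0 < t" "y \<in> carrier D" "cnorm D y = 1" "x = complex_of_real t \<odot>\<^bsub>D\<^esub> y" "t = cnorm D x"
      by (rule D.norm_scale_unit[OF x False])
    have "cmod (\<omega> x) = t * cmod (\<omega> y)" unfolding y(4) using sm[OF y(2) y(2)] y(1) by (simp add: norm_mult)
    also have "\<dots> \<le> t * 1" using le1[OF y(2)] y(1,3) by (intro mult_left_mono) auto
    finally show ?thesis using y(5) by simp
  qed (simp add: z)
  define s where "s = Re (\<omega> \<one>\<^bsub>D\<^esub>)"
  have w1: "\<omega> \<one>\<^bsub>D\<^esub> = complex_of_real s" "0 \<le> s"
    using pos[of "\<one>\<^bsub>D\<^esub>"] by (auto simp: s_def nonneg_Reals_def)
  have "s \<le> 1" using le1[of "\<one>\<^bsub>D\<^esub>"] D.cnorm_one_le w1 by simp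
  have cs: "(cmod (\<omega> x))\<^sup>2 \<le> s" if x: "x \<in> carrier D" "cnorm D x \<le> 1" for x
  proof -
    define p where "p = Re (\<omega> (star D x \<otimes>\<^bsub>D\<^esub> x))"
    have p: "\<omega> (star D x \<otimes>\<^bsub>D\<^esub> x) = complex_of_real p" "0 \<le> p"
      using pos[OF x(1)] by (auto simp: p_def nonneg_Reals_def)
    have "p \<le> 1"
      using le1[of "star D x \<otimes>\<^bsub>D\<^esub> x"] D.cnorm_cstar[OF x(1)] x p by (simp add: power_le_one)
    have ex: "\<omega> (star D (c \<odot>\<^bsub>D\<^esub> x \<oplus>\<^bsub>D\<^esub> \<one>\<^bsub>D\<^esub>) \<otimes>\<^bsub>D\<^esub> (c \<odot>\<^bsub>D\<^esub> x \<oplus>\<^bsub>D\<^esub> \<one>\<^bsub>D\<^esub>)) =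
        (c * cnj c) * complex_of_real p + (c * \<omega> x + (cnj c * \<omega> (star D x) + complex_of_real s))" for c
    proof -
      have "star D (c \<odot>\<^bsub>D\<^esub> x \<oplus>\<^bsub>D\<^esub> \<one>\<^bsub>D\<^esub>) \<otimes>\<^bsub>D\<^esub> (c \<odot>\<^bsub>D\<^esub> x \<oplus>\<^bsub>D\<^esub> \<one>\<^bsub>D\<^esub>) =
          (c * cnj c) \<odot>\<^bsub>D\<^esub> (star D x \<otimes>\<^bsub>D\<^esub> x) \<oplus>\<^bsub>D\<^esub> (c \<odot>\<^bsub>D\<^esub> x \<oplus>\<^bsub>D\<^esub> (cnj c \<odot>\<^bsub>D\<^esub> star D x \<oplus>\<^bsub>D\<^esub> \<one>\<^bsub>D\<^esub>))"
        using x(1) by (simp add: D.calg mult.commute)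
      then show ?thesis using x(1) by (simp add: add sm p(1) w1(1))
    qed
    have nonneg: "\<omega> (star D (c \<odot>\<^bsub>D\<^esub> x \<oplus>\<^bsub>D\<^esub> \<one>\<^bsub>D\<^esub>) \<otimes>\<^bsub>D\<^esub> (c \<odot>\<^bsub>D\<^esub> x \<oplus>\<^bsub>D\<^esub> \<one>\<^bsub>D\<^esub>)) \<in> \<real>\<^sub>\<ge>\<^sub>0" for c
      by (rule pos) (use x(1) in simp)
    have nnR: "Im z = 0 \<and> 0 \<le> Re z" if "z \<in> \<real>\<^sub>\<ge>\<^sub>0" for z using that by (auto simp: nonneg_Reals_def)
    have sx: "\<omega> (star D x) = cnj (\<omega> x)"
    proof -
      have im: "Im (c * \<omega> x + cnj c * \<omega> (star D x)) = 0" for c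
      proof -
        have "Im ((c * cnj c) * complex_of_real p + (c * \<omega> x + (cnj c * \<omega> (star D x) + complex_of_real s))) = 0"
          using nnR[OF nonneg[of c]] unfolding ex by blast
        then show ?thesis unfolding complex_norm_square[symmetric] by simp
      qed
      show ?thesis using im[of 1] im[of \<i>] by (simp add: complex_eq_iff)
    qed
    \<comment> \<open>Positivity of \<open>\<omega>\<close> at \<open>(c x + 1)\<^sup>* (c x + 1)\<close>; the useful choice is \<open>c = - cnj (\<omega> x)\<close>.\<close>
    have quad: "0 \<le> (cmod c)\<^sup>2 * p + 2 * Re (c * \<omega> x) + s" for c
    proof -
      have "0 \<le> Re ((c * cnj c) * complex_of_real p + (c * \<omega> x + (cnj c * cnj (\<omega> x) + complex_of_real s)))"
        using nnR[OF nonneg[of c]] unfolding ex sx by blast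
      then show ?thesis unfolding complex_norm_square[symmetric] by simp
    qed
    have expand: "0 \<le> p * t\<^sup>2 + 2 * t * Re (w * \<omega> x) + s" if w: "cmod w = 1" for t :: real and w
    proof -
      have "(cmod (complex_of_real t * w))\<^sup>2 = t\<^sup>2" using w by (simp add: norm_mult)
      moreover have "Re (complex_of_real t * w * \<omega> x) = t * Re (w * \<omega> x)" by (simp add: algebra_simps)
      ultimately show ?thesis using quad[of "complex_of_real t * w"] by (simp only: mult.commute[of p] mult.assoc)
    qed
    show ?thesis
    proof (cases "\<omega> x = 0")
      case True then show ?thesis using w1(2) by simp
    next
      case False
      define w where "w = cnj (\<omega> x) / complex_of_real (cmod (\<omega> x))"
      have "cmod w = 1" using False by (simp add: w_def norm_divide)
      have "cnj (\<omega> x) * \<omega> x = complex_of_real (cmod (\<omega> x)) * complex_of_real (cmod (\<omega> x))"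
        using complex_norm_square[of "\<omega> x"] by (simp add: power2_eq_square mult.commute)
      then have "w * \<omega> x = complex_of_real (cmod (\<omega> x))" using False by (simp add: w_def)
      then have "0 \<le> p * (cmod (\<omega> x))\<^sup>2 + 2 * (- cmod (\<omega> x)) * cmod (\<omega> x) + s"
        using expand[OF \<open>cmod w = 1\<close>, of "- cmod (\<omega> x)"] by simp
      moreover have "p * (cmod (\<omega> x))\<^sup>2 \<le> 1 * (cmod (\<omega> x))\<^sup>2" using \<open>p \<le> 1\<close> by (intro mult_right_mono) auto
      ultimately show ?thesis by (simp add: power2_eq_square)
    qed
  qed
  have "(SUP x\<in>{x\<in>carrier D. cnorm D x \<le> 1}. ereal (cmod (\<omega> x))) \<le> ereal (sqrt s)"
  proof (rule SUP_least)
    fix x assume "x \<in> {x\<in>carrier D. cnorm D x \<le> 1}"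
    then have "cmod (\<omega> x) \<le> sqrt s" using cs[of x] by (auto intro: real_le_rsqrt)
    then show "ereal (cmod (\<omega> x)) \<le> ereal (sqrt s)" by simp
  qed
  then have "1 \<le> sqrt s" unfolding sup by (simp add: one_ereal_def)
  then have "1 \<le> s" by simp
  then show "\<omega> \<one>\<^bsub>D\<^esub> = 1" using w1(1) \<open>s \<le> 1\<close> by simp
qed

text \<open>The map \<open>\<iota> \<circ> \<pi>\<^sup>-\<^sup>1\<close> on the operator system \<open>\<pi>(A)\<close> is completely positive by
  \<open>matrix_pos_reflect\<close>; injectivity of \<open>D\<close> extends it to all bounded operators.\<close>

lemma extension_to_bounded_ops:
  fixes \<pi> :: "'a \<Rightarrow> 'h::complex_hilbert_space \<Rightarrow> 'h"
  assumes A: "cstar_algebra A" and hom: "unital_star_hom A bounded_ops \<pi>" and inj: "inj_on \<pi> (carrier A)"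
    and D: "cstar_algebra D" and injD: "injective_cstar TYPE('h \<Rightarrow> 'h) D"
    and emb: "unital_complete_order_embedding A D \<iota>"
  shows "\<exists>\<Phi>. cp_on bounded_ops (carrier bounded_ops) D \<Phi> \<and> \<Phi> \<one>\<^bsub>bounded_ops\<^esub> = \<one>\<^bsub>D\<^esub> \<and>
    (\<forall>x\<in>carrier A. \<Phi> (\<pi> x) = \<iota> x)"
proof -
  interpret star_hom A "bounded_ops :: ('h \<Rightarrow> 'h) cstar" \<pi>
    by (intro star_hom.intro star_hom_axioms.intro A hom bounded_ops.cstar_algebra_R)
  let ?E = "\<pi> ` carrier A"
  define f where "f T = \<iota> (inv_into (carrier A) \<pi> T)" for T
  have f\<pi>: "f (\<pi> x) = \<iota> x" if "x \<in> carrier A" for x using inv_into_f_f[OF inj that] by (simp add: f_def)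
  have lin: "clinear_on A (carrier A) D \<iota>" and unit: "\<iota> \<one>\<^bsub>A\<^esub> = \<one>\<^bsub>D\<^esub>"
    and order: "\<And>n X. (\<forall>i<n. \<forall>j<n. X i j \<in> carrier A) \<Longrightarrow> matrix_pos A n X \<longleftrightarrow> matrix_pos D n (\<lambda>i j. \<iota> (X i j))"
    using emb unfolding unital_complete_order_embedding_def by blast+
  have "operator_system bounded_ops ?E"
  proof -
    have "\<one>\<^bsub>bounded_ops\<^esub> \<in> ?E" by (rule image_eqI[of _ _ "\<one>\<^bsub>A\<^esub>"]) simp_all
    moreover have "\<pi> x \<oplus>\<^bsub>bounded_ops\<^esub> \<pi> y \<in> ?E" if "x \<in> carrier A" "y \<in> carrier A" for x y
      by (rule image_eqI[of _ _ "x \<oplus>\<^bsub>A\<^esub> y"]) (use that in auto)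
    moreover have "c \<odot>\<^bsub>bounded_ops\<^esub> \<pi> x \<in> ?E" if "x \<in> carrier A" for x c
      by (rule image_eqI[of _ _ "c \<odot>\<^bsub>A\<^esub> x"]) (use that in auto)
    moreover have "star bounded_ops (\<pi> x) \<in> ?E" if "x \<in> carrier A" for x
      by (rule image_eqI[of _ _ "star A x"]) (use that in auto)
    ultimately show ?thesis unfolding operator_system_def by auto
  qed
  moreover have "cp_on bounded_ops ?E D f"
    unfolding cp_on_def
  proof (intro conjI allI impI)
    have "f (\<pi> x \<oplus>\<^bsub>bounded_ops\<^esub> \<pi> y) = f (\<pi> x) \<oplus>\<^bsub>D\<^esub> f (\<pi> y)" if "x \<in> carrier A" "y \<in> carrier A" for x y
      using f\<pi>[of "x \<oplus>\<^bsub>A\<^esub> y"] f\<pi>[OF that(1)] f\<pi>[OF that(2)] that lin unfolding clinear_on_def by simp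
    moreover have "f (c \<odot>\<^bsub>bounded_ops\<^esub> \<pi> x) = c \<odot>\<^bsub>D\<^esub> f (\<pi> x)" if "x \<in> carrier A" for x c
      using f\<pi>[of "c \<odot>\<^bsub>A\<^esub> x"] f\<pi>[OF that] that lin unfolding clinear_on_def by simp
    ultimately show "clinear_on bounded_ops ?E D f"
      using f\<pi> lin unfolding clinear_on_def by (auto simp: Pi_def)
  next
    fix n X assume X: "\<forall>i<n. \<forall>j<n. X i j \<in> ?E" and pos: "matrix_pos bounded_ops n X"
    define x where "x i j = inv_into (carrier A) \<pi> (X i j)" for i j
    have x: "x i j \<in> carrier A" "\<pi> (x i j) = X i j" if "i < n" "j < n" for i j
      using X that inv_into_into f_inv_into_f unfolding x_def by metis+
    have posx: "matrix_pos bounded_ops n (\<lambda>i j. \<pi> (x i j))" using pos x(2) unfolding matrix_pos_def by simp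
    have "matrix_pos A n x"
      by (rule matrix_pos_reflect[OF A hom inj _ posx]) (rule x(1))
    then have "matrix_pos D n (\<lambda>i j. \<iota> (x i j))" using order[of n x] x(1) by blast
    then show "matrix_pos D n (\<lambda>i j. f (X i j))" unfolding f_def x_def .
  qed
  ultimately obtain \<Phi> where \<Phi>: "cp_on bounded_ops (carrier bounded_ops) D \<Phi>" "\<forall>T\<in>?E. \<Phi> T = f T"
    using injD bounded_ops.cstar_algebra_R unfolding injective_cstar_def by blast
  have \<Phi>\<pi>: "\<Phi> (\<pi> x) = \<iota> x" if "x \<in> carrier A" for x using bspec[OF \<Phi>(2), of "\<pi> x"] f\<pi>[OF that] that by simp
  have "\<Phi> (\<pi> \<one>\<^bsub>A\<^esub>) = \<one>\<^bsub>D\<^esub>" using \<Phi>\<pi>[of "\<one>\<^bsub>A\<^esub>"] unit by simp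
  then have "\<Phi> \<one>\<^bsub>bounded_ops\<^esub> = \<one>\<^bsub>D\<^esub>" by simp
  then show ?thesis using \<Phi>(1) \<Phi>\<pi> by blast
qed

lemma cp_on_compose:
  assumes "cp_on B (carrier B) C \<psi>" "cp_on C (carrier C) D \<Phi>" shows "cp_on B (carrier B) D (\<Phi> \<circ> \<psi>)"
proof -
  have \<psi>: "\<psi> \<in> carrier B \<rightarrow> carrier C" using assms(1) unfolding cp_on_def clinear_on_def by blast
  have "clinear_on B (carrier B) D (\<Phi> \<circ> \<psi>)"
    using assms unfolding cp_on_def clinear_on_def by (auto simp: Pi_def)
  moreover have "matrix_pos D n (\<lambda>i j. (\<Phi> \<circ> \<psi>) (X i j))"
    if "\<forall>i<n. \<forall>j<n. X i j \<in> carrier B" "matrix_pos B n X" for n X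
  proof -
    have "matrix_pos C n (\<lambda>i j. \<psi> (X i j))" using assms(1) that unfolding cp_on_def by blast
    moreover have "\<forall>i<n. \<forall>j<n. \<psi> (X i j) \<in> carrier C" using that(1) \<psi> by blast
    ultimately have "matrix_pos D n (\<lambda>i j. \<Phi> (\<psi> (X i j)))"
      using assms(2)[unfolded cp_on_def, THEN conjunct2, rule_format, of n "\<lambda>i j. \<psi> (X i j)"] by blast
    then show ?thesis by simp
  qed
  ultimately show ?thesis unfolding cp_on_def by blast
qed

lemma CPA_mono:
  assumes "\<Omega> \<subseteq> \<Omega>'" "\<delta> \<le> \<delta>'" shows "CPA A C \<pi> \<Omega>' \<delta> \<subseteq> CPA A C \<pi> \<Omega> \<delta>'"
  using assms(1) less_le_trans[OF _ assms(2)] unfolding CPA_def by blast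

lemma orbit_set_mono: "\<Omega> \<subseteq> \<Omega>' \<Longrightarrow> orbit_set \<theta> n \<Omega> \<subseteq> orbit_set \<theta> n \<Omega>'"
  unfolding orbit_set_def by blast

lemma orbit_sum_facts:
  assumes A: "cstar_algebra A" and \<theta>: "ucp A A \<theta>" and a: "a \<in> carrier A" "star A a = a"
  shows "(\<theta> ^^ j) a \<in> carrier A" "star A ((\<theta> ^^ j) a) = (\<theta> ^^ j) a"
    "orbit_sum A \<theta> n a \<in> carrier A" "star A (orbit_sum A \<theta> n a) = orbit_sum A \<theta> n a"
proof -
  interpret T: cp_map A A \<theta>
    by (intro cp_map.intro cp_map_axioms.intro A) (use \<theta> in \<open>simp add: ucp_def\<close>)
  have *: "(\<theta> ^^ j) a \<in> carrier A \<and> star A ((\<theta> ^^ j) a) = (\<theta> ^^ j) a" for j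
    by (induction j) (use a T.lin(1) T.sa in auto)
  then show "(\<theta> ^^ j) a \<in> carrier A" "star A ((\<theta> ^^ j) a) = (\<theta> ^^ j) a" by auto
  show "orbit_sum A \<theta> n a \<in> carrier A" unfolding orbit_sum_def by (rule T.A.finsum_closed) (use * in auto)
  have "star A (orbit_sum A \<theta> n a) = (\<Oplus>\<^bsub>A\<^esub>j\<in>{..<n}. star A ((\<theta> ^^ j) a))"
    unfolding orbit_sum_def by (rule T.A.finsum_star) (use * in auto)
  also have "\<dots> = orbit_sum A \<theta> n a" unfolding orbit_sum_def by (rule T.A.finsum_cong') (use * in auto)
  finally show "star A (orbit_sum A \<theta> n a) = orbit_sum A \<theta> n a" .
qed

text \<open>The Gibbs inequality for the state \<open>\<omega> \<circ> \<Phi> \<circ> \<psi>\<close> and the self-adjoint element \<open>\<phi> (orbit_sum A \<theta> n a)\<close>. Each of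
  the \<open>n\<close> summands \<open>\<theta>^j(a)\<close> has expectation within \<open>6 \<delta>\<close> of \<open>\<sigma>(\<theta>^j(a)) = \<sigma>(a)\<close>, the factor 6 coming from
  \<open>cp_map.bound\<close> for \<open>\<Phi>\<close>.\<close>

lemma triple_estimate:
  assumes A: "cstar_algebra A" and \<theta>: "ucp A A \<theta>" and a: "a \<in> carrier A" "star A a = a"
    and C: "cstar_algebra C" and D: "cstar_algebra D"
    and \<Phi>: "cp_on C (carrier C) D \<Phi>" "\<Phi> \<one>\<^bsub>C\<^esub> = \<one>\<^bsub>D\<^esub>"
    and \<pi>: "\<And>x. x \<in> carrier A \<Longrightarrow> \<pi> x \<in> carrier C" and \<Phi>\<pi>: "\<And>x. x \<in> carrier A \<Longrightarrow> \<Phi> (\<pi> x) = \<iota> x"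
    and \<omega>: "state D \<omega>" "\<And>x. x \<in> carrier A \<Longrightarrow> \<omega> (\<iota> x) = \<sigma> x"
    and inv: "\<forall>x\<in>carrier A. \<sigma> (\<theta> x) = \<sigma> x"
    and \<Omega>: "\<Omega> \<subseteq> carrier A" "a \<in> \<Omega>"
    and triple: "(\<phi>, \<psi>, B) \<in> CPA A C \<pi> (orbit_set \<theta> n \<Omega>) \<delta>"
  shows "(\<phi>, \<Phi> \<circ> \<psi>, B) \<in> CPA A D \<iota> (orbit_set \<theta> n \<Omega>) (6 * \<delta>)"
    and "exp (von_neumann_entropy B (\<omega> \<circ> (\<Phi> \<circ> \<psi>)) + real n * (Re (\<sigma> a) - 6 * \<delta>))
      \<le> Re (fd_trace B (cstar_exp B (\<phi> (orbit_sum A \<theta> n a))))"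
proof -
  have B: "cstar_algebra B" "finite_dim B" and \<phi>: "ucp A B \<phi>" and \<psi>: "ucp B C \<psi>"
    and close: "\<And>x. x \<in> orbit_set \<theta> n \<Omega> \<Longrightarrow> cnorm C (\<psi> (\<phi> x) \<ominus>\<^bsub>C\<^esub> \<pi> x) < \<delta>"
    using triple unfolding CPA_def by auto
  interpret A: cstar_algebra A by fact
  interpret C: cstar_algebra C by fact
  interpret D: cstar_algebra D by fact
  interpret B: fd_cstar B using B by (intro fd_cstar.intro fd_cstar_axioms.intro)
  interpret P: cp_map C D \<Phi> by (intro cp_map.intro cp_map_axioms.intro C D \<Phi>(1))
  interpret F: cp_map A B \<phi> by (intro cp_map.intro cp_map_axioms.intro A B(1)) (use \<phi> in \<open>simp add: ucp_def\<close>)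
  interpret G: cp_map B C \<psi> by (intro cp_map.intro cp_map_axioms.intro C B(1)) (use \<psi> in \<open>simp add: ucp_def\<close>)
  have cp: "cp_on B (carrier B) D (\<Phi> \<circ> \<psi>)" by (rule cp_on_compose[OF G.cp P.cp])
  interpret H: cp_map B D "\<Phi> \<circ> \<psi>" by (intro cp_map.intro cp_map_axioms.intro D B(1) cp)
  have unitH: "(\<Phi> \<circ> \<psi>) \<one>\<^bsub>B\<^esub> = \<one>\<^bsub>D\<^esub>" using \<psi> \<Phi>(2) by (simp add: ucp_def)
  interpret T: cp_map A A \<theta> by (intro cp_map.intro cp_map_axioms.intro A) (use \<theta> in \<open>simp add: ucp_def\<close>)
  have pow_closed: "(\<theta> ^^ j) x \<in> carrier A" if "x \<in> carrier A" for x j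
    by (induction j) (use that T.lin(1) in auto)
  then have orb: "orbit_set \<theta> n \<Omega> \<subseteq> carrier A" unfolding orbit_set_def using \<Omega>(1) by auto
  have close': "cnorm D ((\<Phi> \<circ> \<psi>) (\<phi> x) \<ominus>\<^bsub>D\<^esub> \<iota> x) < 6 * \<delta>" if x: "x \<in> orbit_set \<theta> n \<Omega>" for x
  proof -
    have xA: "x \<in> carrier A" using orb x by blast
    have cl: "\<psi> (\<phi> x) \<in> carrier C" "\<pi> x \<in> carrier C" using F.lin(1)[OF xA] G.lin(1) \<pi>[OF xA] by auto
    have "(\<Phi> \<circ> \<psi>) (\<phi> x) \<ominus>\<^bsub>D\<^esub> \<iota> x = \<Phi> (\<psi> (\<phi> x) \<ominus>\<^bsub>C\<^esub> \<pi> x)"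
      using P.lin_diff[OF cl] \<Phi>\<pi>[OF xA] by simp
    then have "cnorm D ((\<Phi> \<circ> \<psi>) (\<phi> x) \<ominus>\<^bsub>D\<^esub> \<iota> x) \<le> 6 * cnorm C (\<psi> (\<phi> x) \<ominus>\<^bsub>C\<^esub> \<pi> x)"
      using P.bound[OF \<Phi>(2)] cl by simp
    then show ?thesis using close[OF x] by simp
  qed
  show "(\<phi>, \<Phi> \<circ> \<psi>, B) \<in> CPA A D \<iota> (orbit_set \<theta> n \<Omega>) (6 * \<delta>)"
    unfolding CPA_def using B \<phi> cp unitH close' by (auto simp: ucp_def)
  define f where "f = \<omega> \<circ> (\<Phi> \<circ> \<psi>)"
  have lf\<omega>: "linear_functional D \<omega>" and pos\<omega>: "\<And>x. x \<in> carrier D \<Longrightarrow> \<omega> (star D x \<otimes>\<^bsub>D\<^esub> x) \<in> \<real>\<^sub>\<ge>\<^sub>0"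
    using \<omega>(1) by (auto simp: state_def)
  have lf: "linear_functional B f"
    using lf\<omega> H.lin unfolding linear_functional_def f_def by simp
  have posf: "f (star B x \<otimes>\<^bsub>B\<^esub> x) \<in> \<real>\<^sub>\<ge>\<^sub>0" if "x \<in> carrier B" for x
    using H.star_mult_image[OF that] pos\<omega> unfolding f_def by auto
  have unitf: "f \<one>\<^bsub>B\<^esub> = 1" using unitH state_one(1)[OF D \<omega>(1)] by (simp add: f_def)
  define h where "h = \<phi> (orbit_sum A \<theta> n a)"
  note os = orbit_sum_facts[OF A \<theta> a]
  have h: "h \<in> carrier B" "star B h = h" unfolding h_def using F.lin(1)[OF os(3)] F.sa[OF os(3,4)] by auto
  have gibbs: "exp (von_neumann_entropy B f + Re (f h)) \<le> Re (fd_trace B (cstar_exp B h))"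
    by (rule B.Gibbs_inequality[OF lf posf unitf h])
  have lfg: "linear_functional A (\<lambda>x. f (\<phi> x))"
    using lf F.lin unfolding linear_functional_def by simp
  have fh: "f h = (\<Sum>j<n. f (\<phi> ((\<theta> ^^ j) a)))"
    unfolding h_def orbit_sum_def using A.functional_finsum[OF lfg, of "{..<n}" "\<lambda>j. (\<theta> ^^ j) a"] os(1) by simp
  have \<sigma>j: "\<sigma> ((\<theta> ^^ j) a) = \<sigma> a" for j
    by (induction j) (use inv os(1) in auto)
  have each: "Re (\<sigma> a) - 6 * \<delta> \<le> Re (f (\<phi> ((\<theta> ^^ j) a)))" if j: "j < n" for j
  proof -
    let ?x = "(\<theta> ^^ j) a"
    have x: "?x \<in> orbit_set \<theta> n \<Omega>" unfolding orbit_set_def using j \<Omega>(2) by blast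
    have cl: "(\<Phi> \<circ> \<psi>) (\<phi> ?x) \<in> carrier D" "\<iota> ?x \<in> carrier D"
      using H.lin(1)[OF F.lin(1)[OF os(1)]] P.lin(1)[OF \<pi>[OF os(1)]] \<Phi>\<pi>[OF os(1)] by auto
    have "\<omega> ((\<Phi> \<circ> \<psi>) (\<phi> ?x) \<ominus>\<^bsub>D\<^esub> \<iota> ?x) = f (\<phi> ?x) - \<sigma> a"
    proof -
      have "\<omega> ((\<Phi> \<circ> \<psi>) (\<phi> ?x) \<oplus>\<^bsub>D\<^esub> (-1) \<odot>\<^bsub>D\<^esub> \<iota> ?x) = \<omega> ((\<Phi> \<circ> \<psi>) (\<phi> ?x)) + (-1) * \<omega> (\<iota> ?x)"
        using lf\<omega> cl unfolding linear_functional_def by (metis D.smult_in)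
      then show ?thesis using cl \<omega>(2)[OF os(1)] \<sigma>j by (simp add: D.diff_smult f_def)
    qed
    then have "cmod (f (\<phi> ?x) - \<sigma> a) \<le> 6 * \<delta>"
      using state_one(2)[OF D \<omega>(1), of "(\<Phi> \<circ> \<psi>) (\<phi> ?x) \<ominus>\<^bsub>D\<^esub> \<iota> ?x"] cl close'[OF x] by simp
    then have "\<bar>Re (f (\<phi> ?x) - \<sigma> a)\<bar> \<le> 6 * \<delta>" using abs_Re_le_cmod order_trans by blast
    then show ?thesis by (simp add: abs_le_iff)
  qed
  have "real n * (Re (\<sigma> a) - 6 * \<delta>) \<le> Re (f h)"
    using sum_mono[of "{..<n}" "\<lambda>j. Re (\<sigma> a) - 6 * \<delta>" "\<lambda>j. Re (f (\<phi> ((\<theta> ^^ j) a)))"] each by (simp add: fh)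
  then have "exp (von_neumann_entropy B f + real n * (Re (\<sigma> a) - 6 * \<delta>)) \<le> exp (von_neumann_entropy B f + Re (f h))" by simp
  also note gibbs
  finally show "exp (von_neumann_entropy B (\<omega> \<circ> (\<Phi> \<circ> \<psi>)) + real n * (Re (\<sigma> a) - 6 * \<delta>))
      \<le> Re (fd_trace B (cstar_exp B (\<phi> (orbit_sum A \<theta> n a))))"
    unfolding f_def h_def .
qed

text \<open>An infinite \<open>c\<close> is possible only for empty \<open>I\<close>, where the infimum is infinite as well. For finite \<open>c\<close> the bound
  keeps the infimum positive, so that its logarithm is the real one.\<close>

lemma ln_ereal_INF_ge:
  fixes z s :: "'t \<Rightarrow> real"
  assumes le: "\<And>t. t \<in> I \<Longrightarrow> c \<le> ereal (s t)" and ex: "\<And>t. t \<in> I \<Longrightarrow> exp (s t + k) \<le> z t"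
  shows "c + ereal k \<le> ln_ereal (INF t\<in>I. ereal (z t))"
proof (cases c)
  case (real r)
  have "ereal (exp (r + k)) \<le> (INF t\<in>I. ereal (z t))"
  proof (rule INF_greatest)
    fix t assume t: "t \<in> I"
    have "exp (r + k) \<le> exp (s t + k)" using le[OF t] real by simp
    also have "\<dots> \<le> z t" by (rule ex[OF t])
    finally show "ereal (exp (r + k)) \<le> ereal (z t)" by simp
  qed
  then show ?thesis
  proof (cases "INF t\<in>I. ereal (z t)")
    case (real y)
    then have y: "exp (r + k) \<le> y" using \<open>ereal (exp (r + k)) \<le> _\<close> by simp
    then have "0 < y" using exp_gt_zero[of "r + k"] by linarith
    have "r + k \<le> ln y" using ln_mono[OF y exp_gt_zero] by simp
    then show ?thesis using \<open>c = ereal r\<close> real \<open>0 < y\<close> by (simp add: ln_ereal_def)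
  qed (auto simp: ln_ereal_def)
next
  case PInf
  have "I = {}"
  proof (rule ccontr)
    assume "I \<noteq> {}"
    then obtain t where "t \<in> I" by blast
    then show False using le[of t] PInf by simp
  qed
  then show ?thesis by (simp add: ln_ereal_def top_ereal_def)
qed simp

theorem proposition4p14:
  fixes A :: "'a cstar"
    and \<theta> :: "'a \<Rightarrow> 'a"
    and \<pi> :: "'a \<Rightarrow> 'h::complex_hilbert_space \<Rightarrow> 'h"
    and D :: "'d cstar"
    and \<iota> :: "'a \<Rightarrow> 'd"
    and \<sigma> :: "'a \<Rightarrow> complex"
    and a :: 'a
  assumes "cstar_algebra A"
    and "exact_cstar TYPE('k::complex_hilbert_space) A"
    and "ucp A A \<theta>"
    and "unital_star_hom A bounded_ops \<pi>" and "inj_on \<pi> (carrier A)"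
    and "cstar_algebra D" and "injective_cstar TYPE('h \<Rightarrow> 'h) D"
    and "unital_complete_order_embedding A D \<iota>"
    and "a \<in> carrier A" and "star A a = a"
    and "state A \<sigma>" and "\<forall>x\<in>carrier A. \<sigma> (\<theta> x) = \<sigma> x"
  shows "approx_pressure A \<theta> \<pi> a \<ge> local_state_entropy A \<theta> \<sigma> D \<iota> + ereal (Re (\<sigma> a))"
proof -
  obtain \<Phi> where \<Phi>: "cp_on bounded_ops (carrier bounded_ops) D \<Phi>" "\<Phi> \<one>\<^bsub>bounded_ops\<^esub> = \<one>\<^bsub>D\<^esub>"
    and \<Phi>\<pi>': "\<forall>x\<in>carrier A. \<Phi> (\<pi> x) = \<iota> x"
    using extension_to_bounded_ops[OF assms(1,4,5,6,7,8)] by (elim exE conjE) (rule that, assumption+)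
  have \<Phi>\<pi>: "\<Phi> (\<pi> x) = \<iota> x" if "x \<in> carrier A" for x by (rule bspec[OF \<Phi>\<pi>' that])
  have \<pi>_in: "\<pi> x \<in> carrier bounded_ops" if "x \<in> carrier A" for x
    using assms(4) that unfolding unital_star_hom_def ring_hom_def by blast
  have main: "limsup (\<lambda>n. ereal (1 / real n) * cpe A D \<iota> \<omega> (orbit_set \<theta> n \<Omega>) \<delta>) + ereal (Re (\<sigma> a))
      \<le> approx_pressure A \<theta> \<pi> a"
    if \<omega>: "\<omega> \<in> state_extensions A D \<sigma> \<iota>" and \<Omega>: "finite \<Omega>" "\<Omega> \<subseteq> carrier A" and \<delta>: "0 < \<delta>" for \<omega> \<Omega> \<delta>
  proof (rule ereal_le_epsilon2)
    fix e :: real assume e: "0 < e"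
    \<comment> \<open>The tolerance grows by the factor 6 under \<open>\<Phi>\<close>; it has to stay below both \<open>\<delta>\<close> and the error \<open>e\<close>.\<close>
    define d where "d = min \<delta> e / 6"
    have d: "0 < d" "6 * d \<le> \<delta>" "6 * d \<le> e" using \<delta> e by (auto simp: d_def)
    \<comment> \<open>Adding \<open>a\<close> makes the triples approximate along the orbit of \<open>a\<close>, where \<open>\<sigma>(a)\<close> is recovered.\<close>
    define \<Omega>' where "\<Omega>' = insert a \<Omega>"
    have \<Omega>': "finite \<Omega>'" "\<Omega>' \<subseteq> carrier A" "a \<in> \<Omega>'" using \<Omega> assms(9) by (auto simp: \<Omega>'_def)
    have st: "state D \<omega>" and ext: "\<And>x. x \<in> carrier A \<Longrightarrow> \<omega> (\<iota> x) = \<sigma> x"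
      using \<omega> by (auto simp: state_extensions_def)
    have step: "ereal (1 / real n) * cpe A D \<iota> \<omega> (orbit_set \<theta> n \<Omega>) \<delta> + ereal (Re (\<sigma> a) - 6 * d)
        \<le> ereal (1 / real n) * ln_ereal (partition_fun A \<theta> n \<pi> a \<Omega>' d)" if n: "1 \<le> n" for n
    proof -
      let ?I = "CPA A bounded_ops \<pi> (orbit_set \<theta> n \<Omega>') d"
      let ?c = "cpe A D \<iota> \<omega> (orbit_set \<theta> n \<Omega>) \<delta>"
      let ?k = "real n * (Re (\<sigma> a) - 6 * d)"
      define s where "s = (\<lambda>(\<phi>::'a \<Rightarrow> fd_elem, \<psi> :: fd_elem \<Rightarrow> 'h \<Rightarrow> 'h, B :: fd_elem cstar). von_neumann_entropy B (\<omega> \<circ> (\<Phi> \<circ> \<psi>)))"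
      define z where "z = (\<lambda>(\<phi>::'a \<Rightarrow> fd_elem, \<psi> :: fd_elem \<Rightarrow> 'h \<Rightarrow> 'h, B :: fd_elem cstar). Re (fd_trace B (cstar_exp B (\<phi> (orbit_sum A \<theta> n a)))))"
      have est: "(\<phi>, \<Phi> \<circ> \<psi>, B) \<in> CPA A D \<iota> (orbit_set \<theta> n \<Omega>') (6 * d) \<and>
          exp (s (\<phi>, \<psi>, B) + ?k) \<le> z (\<phi>, \<psi>, B)" if "(\<phi>, \<psi>, B) \<in> ?I" for \<phi> \<psi> B
        unfolding s_def z_def prod.case
        using triple_estimate[OF assms(1,3,9,10) bounded_ops.cstar_algebra_R assms(6) \<Phi> \<pi>_in \<Phi>\<pi> st ext assms(12) \<Omega>'(2,3) that]
        by blast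
      have "?c \<le> ereal (s t)" if t: "t \<in> ?I" for t
      proof -
        obtain \<phi> \<psi> B where t': "t = (\<phi>, \<psi>, B)" by (cases t)
        have "(\<phi>, \<Phi> \<circ> \<psi>, B) \<in> CPA A D \<iota> (orbit_set \<theta> n \<Omega>') (6 * d)" using est t unfolding t' by blast
        then have "(\<phi>, \<Phi> \<circ> \<psi>, B) \<in> CPA A D \<iota> (orbit_set \<theta> n \<Omega>) \<delta>"
          using CPA_mono[OF orbit_set_mono d(2), of \<Omega> \<Omega>' A D \<iota> \<theta> n] unfolding \<Omega>'_def by blast
        then have "?c \<le> (case (\<phi>, \<Phi> \<circ> \<psi>, B) of (\<phi>, \<psi>, B) \<Rightarrow> ereal (von_neumann_entropy B (\<omega> \<circ> \<psi>)))"
          unfolding cpe_def by (rule INF_lower)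
        then show ?thesis by (simp add: s_def t')
      qed
      moreover have "exp (s t + ?k) \<le> z t" if t: "t \<in> ?I" for t
        using est t by (cases t) blast
      ultimately have "?c + ereal ?k \<le> ln_ereal (INF t\<in>?I. ereal (z t))" by (rule ln_ereal_INF_ge)
      also have "(INF t\<in>?I. ereal (z t)) = partition_fun A \<theta> n \<pi> a \<Omega>' d"
        unfolding partition_fun_def z_def by (intro INF_cong refl) auto
      finally have "ereal (1 / real n) * (?c + ereal ?k) \<le> ereal (1 / real n) * ln_ereal (partition_fun A \<theta> n \<pi> a \<Omega>' d)"
        by (rule ereal_mult_left_mono) simp
      moreover have "ereal (1 / real n) * (?c + ereal ?k) = ereal (1 / real n) * ?c + ereal (Re (\<sigma> a) - 6 * d)"
        using n by (cases ?c) (auto simp: field_simps)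
      ultimately show ?thesis by simp
    qed
    have "limsup (\<lambda>n. ereal (1 / real n) * cpe A D \<iota> \<omega> (orbit_set \<theta> n \<Omega>) \<delta>) + ereal (Re (\<sigma> a) - 6 * d)
        \<le> limsup (\<lambda>n. ereal (1 / real n) * ln_ereal (partition_fun A \<theta> n \<pi> a \<Omega>' d))"
      by (rule limsup_le_add[OF step])
    also have "\<dots> \<le> approx_pressure A \<theta> \<pi> a"
      unfolding approx_pressure_def using \<Omega>'(1,2) d(1) by (intro SUP_upper2[of \<Omega>'] SUP_upper2[of d]) auto
    finally have le: "limsup (\<lambda>n. ereal (1 / real n) * cpe A D \<iota> \<omega> (orbit_set \<theta> n \<Omega>) \<delta>) + ereal (Re (\<sigma> a) - 6 * d)
        \<le> approx_pressure A \<theta> \<pi> a" .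
    show "limsup (\<lambda>n. ereal (1 / real n) * cpe A D \<iota> \<omega> (orbit_set \<theta> n \<Omega>) \<delta>) + ereal (Re (\<sigma> a))
        \<le> approx_pressure A \<theta> \<pi> a + ereal e"
      using le d(3)
      by (cases "limsup (\<lambda>n. ereal (1 / real n) * cpe A D \<iota> \<omega> (orbit_set \<theta> n \<Omega>) \<delta>)"; cases "approx_pressure A \<theta> \<pi> a") auto
  qed
  show ?thesis
    unfolding local_state_entropy_def
    by (intro SUP_add_real_leI) (use main in auto)
qed

end
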